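(* Let $(X,\mathcal F)$ be a compact Polish foliated space, and let $X_0\subset X$ be the union of the leaves without holonomy. If $\mathcal F$ is minimal, then the topological disjoint union $\bigsqcup_L\nu L$ of the Higson coronas $\nu L$, with $L$ running in the set of all leaves in $X_0$, is semi weakly homogeneous.
   Context: Foliated spaces. A (topological) foliated structure $\mathcal F$ of dimension $n$ on a space $X$ is given by an atlas $\{(U_i,\phi_i)\}$, where $\{U_i\}$ is an open cover of $X$ and $\phi_i:U_i\to B_i\times Z_i$ are homeomorphisms, with $B_i\subset\mathbb R^n$ an open ball and $Z_i$ a locally compact Polish space, whose changes of coordinates are locally of the form $\phi_j\phi_i^{-1}(x,z)=(x_{ij}(x,z),h_{ij}(z))$. The sets $\phi_i^{-1}(B_i\times\{z\})$ are the plaques; the leaves are the connected components of $X$ with the (leaf) topology whose basic open sets are the plaques of all foliated charts. $(X,\mathcal F)$ is a compact Polish foliated space if $X$ is compact, Hausdorff and second countable. $\mathcal F$ is minimal if every leaf is dense in $X$. Regular atlas and holonomy. A foliated atlas $\mathcal U=\{(U_i,\phi_i)\}$ is regular if: each $(U_i,\phi_i)$ is the restriction of a foliated chart $(\widetilde U_i,\tilde\phi_i)$ with $\overline{U_i}\subset\widetilde U_i$; $\{U_i\}$ is locally finite; and the closure of every plaque of $(U_i,\phi_i)$ meets at most the closure of one plaque of $(U_j,\phi_j)$, for all $i,j$. Let $p_i:U_i\to Z_i$ be $\phi_i$ followed by the second projection; there are homeomorphisms $h_{ij}:p_i(U_i\cap U_j)\to p_j(U_i\cap U_j)$ with $p_j=h_{ij}p_i$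 on $U_i\cap U_j$, generating the holonomy pseudogroup $\mathcal H$ on $\bigsqcup_iZ_i$. The holonomy group of the leaf through $x\in U_i$ is the group of germs at $p_i(x)$ of maps in $\mathcal H$ fixing $p_i(x)$; a leaf is without holonomy if this group is trivial. Leaf metrics. Fix a regular foliated atlas $\mathcal U$. For $x,y$ in the same leaf, $d^*_{\mathcal U}(x,y)=0$ if $x=y$, and otherwise it is the minimum number of $\mathcal U$-plaques whose union is connected and contains $x$ and $y$. Leaves are considered as metric spaces with $d^*_{\mathcal U}$. Higson corona. Let $M$ be a metric space. A function $f:M\to\mathbb C$ vanishes at infinity if for every $\epsilon>0$ there is a bounded set $B\subset M$ with $|f|<\epsilon$ on $M\setminus B$. For $R>0$, $\mathsf V_Rf(x)=\sup\{|f(x)-f(y)|\mid d(x,y)<R\}$. A (possibly non-continuous) bounded function $f:M\to\mathbb C$ is a Higson function if $\mathsf V_Rf$ vanishes at infinity for all $R>0$. Let $\mathcal B_\nu(M)$ be the commutative $C^*$-algebra of Higson functions (with the supremum norm) and $\mathcal B_0(M)\subset\mathcal B_\nu(M)$ the closed ideal of bounded functions that vanish at infinity. The Higson corona $\nu M$ is the compact Hausdorff space (Gelfand spectrum) corresponding to $\mathcal B_\nu(M)/\mathcal B_0(M)$. For a leaf $L$, $\nu L=\nu(L,d^*_{\mathcal U})$, which is independent of $\mathcal U$ up to canonical homeomorphism. Semi weak homogeneity. A topological space is semi weakly homogeneous if, for all nonempty open subsets $V,V'$, there are homeomorphic nonempty open subsets $\Omega\subset V$ and $\Omega'\subset V'$.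 *)

theory Defs
  imports "HOL-Analysis.Analysis"
begin

section \<open>Foliated spaces\<close>

text \<open>A chart \<open>\<phi> : U \<rightarrow> B \<times> Z\<close>. All transversals \<open>Z\<close> live on subsets of one type \<open>'z\<close>, which is
  a free type variable wherever it occurs; only the values of \<open>chart_map\<close> on \<open>chart_dom\<close> matter.\<close>

record ('x, 'z) foliated_chart =
  chart_dom :: "'x set"
  chart_ball :: "(nat \<Rightarrow> real) set"
  chart_trans :: "'z topology"
  chart_map :: "'x \<Rightarrow> (nat \<Rightarrow> real) \<times> 'z"

text \<open>Here \<open>\<real>\<^sup>n\<close> is \<^term>\<open>Euclidean_space n\<close>, the sequences that vanish from index \<open>n\<close> on.\<close>

definition euclidean_open_ball :: "nat \<Rightarrow> (nat \<Rightarrow> real) set \<Rightarrow> bool" where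
  "euclidean_open_ball n B \<longleftrightarrow>
     (\<exists>c \<in> topspace (Euclidean_space n). \<exists>r>0.
        B = {x \<in> topspace (Euclidean_space n). sqrt (\<Sum>i<n. (x i - c i)\<^sup>2) < r})"

definition Polish_space :: "'a topology \<Rightarrow> bool" where
  "Polish_space Z \<longleftrightarrow> completely_metrizable_space Z \<and> separable_space Z"

definition is_foliated_chart :: "nat \<Rightarrow> 'x topology \<Rightarrow> ('x, 'z) foliated_chart \<Rightarrow> bool" where
  "is_foliated_chart n X c \<longleftrightarrow>
     openin X (chart_dom c) \<and>
     euclidean_open_ball n (chart_ball c) \<and>
     locally_compact_space (chart_trans c) \<and> Polish_space (chart_trans c) \<and>
     homeomorphic_map (subtopology X (chart_dom c))
       (prod_topology (subtopology (Euclidean_space n) (chart_ball c)) (chart_trans c))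
       (chart_map c)"

definition chart_proj :: "('x, 'z) foliated_chart \<Rightarrow> 'x \<Rightarrow> 'z" where
  "chart_proj c q = snd (chart_map c q)"

text \<open>Near every point the change of coordinates from \<open>c\<close> to \<open>c'\<close> has the form
  \<open>(x, z) \<mapsto> (f (x, z), h z)\<close>. Continuity of \<open>f\<close> and \<open>h\<close> is automatic, because \<open>chart_map\<close> is a
  homeomorphism and \<open>chart_proj\<close> is an open map.\<close>

definition foliated_change :: "'x topology \<Rightarrow> ('x, 'z) foliated_chart \<Rightarrow> ('x, 'z) foliated_chart \<Rightarrow> bool" where
  "foliated_change X c c' \<longleftrightarrow>
     (\<forall>p \<in> chart_dom c \<inter> chart_dom c'.
        \<exists>W f h. openin X W \<and> p \<in> W \<and> W \<subseteq> chart_dom c \<inter> chart_dom c' \<and>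
          (\<forall>q\<in>W. chart_map c' q = (f (chart_map c q), h (chart_proj c q))))"

definition foliated_atlas :: "nat \<Rightarrow> 'x topology \<Rightarrow> ('x, 'z) foliated_chart set \<Rightarrow> bool" where
  "foliated_atlas n X \<F> \<longleftrightarrow>
     (\<forall>c\<in>\<F>. is_foliated_chart n X c) \<and>
     (\<Union>c\<in>\<F>. chart_dom c) = topspace X \<and>
     (\<forall>c\<in>\<F>. \<forall>c'\<in>\<F>. foliated_change X c c')"

text \<open>The charts of the foliated structure given by the atlas \<open>\<F>\<close>, i.e. its maximal atlas.\<close>

definition foliated_charts ::
    "nat \<Rightarrow> 'x topology \<Rightarrow> ('x, 'z) foliated_chart set \<Rightarrow> ('x, 'z) foliated_chart set" where
  "foliated_charts n X \<F> =
     {c. is_foliated_chart n X c \<and> (\<forall>c'\<in>\<F>. foliated_change X c c' \<and> foliated_change X c' c)}"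

definition chart_plaques :: "('x, 'z) foliated_chart \<Rightarrow> 'x set set" where
  "chart_plaques c = {{q \<in> chart_dom c. chart_proj c q = z} | z. z \<in> topspace (chart_trans c)}"

definition leaf_topology :: "nat \<Rightarrow> 'x topology \<Rightarrow> ('x, 'z) foliated_chart set \<Rightarrow> 'x topology" where
  "leaf_topology n X \<F> = topology_generated_by (\<Union>c \<in> foliated_charts n X \<F>. chart_plaques c)"

definition leaves :: "nat \<Rightarrow> 'x topology \<Rightarrow> ('x, 'z) foliated_chart set \<Rightarrow> 'x set set" where
  "leaves n X \<F> = connected_components_of (leaf_topology n X \<F>)"

definition compact_Polish_foliated_space ::
    "nat \<Rightarrow> 'x topology \<Rightarrow> ('x, 'z) foliated_chart set \<Rightarrow> bool" where
  "compact_Polish_foliated_space n X \<F> \<longleftrightarrow>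
     foliated_atlas n X \<F> \<and> compact_space X \<and> Hausdorff_space X \<and> second_countable X"

definition minimal_foliation :: "nat \<Rightarrow> 'x topology \<Rightarrow> ('x, 'z) foliated_chart set \<Rightarrow> bool" where
  "minimal_foliation n X \<F> \<longleftrightarrow> (\<forall>L \<in> leaves n X \<F>. X closure_of L = topspace X)"

section \<open>Regular atlases and holonomy\<close>

definition chart_restriction :: "('x, 'z) foliated_chart \<Rightarrow> ('x, 'z) foliated_chart \<Rightarrow> bool" where
  "chart_restriction c c' \<longleftrightarrow>
     chart_dom c \<subseteq> chart_dom c' \<and> (\<forall>q \<in> chart_dom c. chart_map c q = chart_map c' q)"

definition regular_foliated_atlas ::
    "nat \<Rightarrow> 'x topology \<Rightarrow> ('x, 'z) foliated_chart set \<Rightarrow> ('x, 'z) foliated_chart set \<Rightarrow> bool" where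
  "regular_foliated_atlas n X \<F> \<U> \<longleftrightarrow>
     \<U> \<subseteq> foliated_charts n X \<F> \<and> foliated_atlas n X \<U> \<and>
     (\<forall>c\<in>\<U>. \<exists>c' \<in> foliated_charts n X \<F>.
        chart_restriction c c' \<and> X closure_of (chart_dom c) \<subseteq> chart_dom c') \<and>
     (\<forall>x \<in> topspace X. \<exists>V. openin X V \<and> x \<in> V \<and> finite {c\<in>\<U>. chart_dom c \<inter> V \<noteq> {}}) \<and>
     (\<forall>c\<in>\<U>. \<forall>c'\<in>\<U>. \<forall>P \<in> chart_plaques c. \<forall>Q \<in> chart_plaques c'. \<forall>Q' \<in> chart_plaques c'.
        X closure_of P \<inter> X closure_of Q \<noteq> {} \<and> X closure_of P \<inter> X closure_of Q' \<noteq> {} \<longrightarrow> Q = Q')"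

text \<open>Homeomorphisms between open subsets of \<open>T\<close> are represented by their graphs. With
  \<open>relcomp\<close>, \<open>g O h\<close> is the graph of \<open>h \<circ> g\<close>.\<close>

definition partial_homeo :: "'a topology \<Rightarrow> ('a \<times> 'a) set \<Rightarrow> bool" where
  "partial_homeo T g \<longleftrightarrow>
     openin T (Domain g) \<and> openin T (Range g) \<and>
     (\<exists>f. homeomorphic_map (subtopology T (Domain g)) (subtopology T (Range g)) f \<and>
          g = (\<lambda>y. (y, f y)) ` Domain g)"

inductive_set generated_pseudogroup ::
    "'a topology \<Rightarrow> ('a \<times> 'a) set set \<Rightarrow> ('a \<times> 'a) set set"
  for T :: "'a topology" and G :: "('a \<times> 'a) set set" where
  generator: "g \<in> G \<Longrightarrow> g \<in> generated_pseudogroup T G"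
| identity: "Id_on (topspace T) \<in> generated_pseudogroup T G"
| composition: "g \<in> generated_pseudogroup T G \<Longrightarrow> h \<in> generated_pseudogroup T G \<Longrightarrow>
    g O h \<in> generated_pseudogroup T G"
| inversion: "g \<in> generated_pseudogroup T G \<Longrightarrow> g\<inverse> \<in> generated_pseudogroup T G"
| restriction: "g \<in> generated_pseudogroup T G \<Longrightarrow> openin T W \<Longrightarrow>
    g \<inter> (W \<times> UNIV) \<in> generated_pseudogroup T G"
| combination: "\<forall>g\<in>\<G>. g \<in> generated_pseudogroup T G \<Longrightarrow> partial_homeo T (\<Union>\<G>) \<Longrightarrow>
    \<Union>\<G> \<in> generated_pseudogroup T G"

definition transversal_space ::
    "('x, 'z) foliated_chart set \<Rightarrow> (('x, 'z) foliated_chart \<times> 'z) topology" where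
  "transversal_space \<U> = sum_topology chart_trans \<U>"

text \<open>The graph of \<open>h\<^sub>i\<^sub>j\<close>, determined by \<open>p\<^sub>j = h\<^sub>i\<^sub>j p\<^sub>i\<close> on \<open>U\<^sub>i \<inter> U\<^sub>j\<close>; by regularity of the atlas it is
  the graph of a homeomorphism.\<close>

definition elementary_holonomy :: "('x, 'z) foliated_chart \<Rightarrow> ('x, 'z) foliated_chart \<Rightarrow>
    ((('x, 'z) foliated_chart \<times> 'z) \<times> (('x, 'z) foliated_chart \<times> 'z)) set" where
  "elementary_holonomy c c' =
     (\<lambda>q. ((c, chart_proj c q), (c', chart_proj c' q))) ` (chart_dom c \<inter> chart_dom c')"

definition holonomy_pseudogroup :: "('x, 'z) foliated_chart set \<Rightarrow>
    ((('x, 'z) foliated_chart \<times> 'z) \<times> (('x, 'z) foliated_chart \<times> 'z)) set set" where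
  "holonomy_pseudogroup \<U> =
     generated_pseudogroup (transversal_space \<U>)
       {elementary_holonomy c c' | c c'. c \<in> \<U> \<and> c' \<in> \<U>}"

definition germ_at :: "'a topology \<Rightarrow> 'a \<Rightarrow> ('a \<times> 'a) set \<Rightarrow> ('a \<times> 'a) set set" where
  "germ_at T y g = {h. partial_homeo T h \<and>
     (\<exists>W. openin T W \<and> y \<in> W \<and> h \<inter> (W \<times> UNIV) = g \<inter> (W \<times> UNIV))}"

text \<open>The underlying set of the holonomy group at the point \<open>y\<close> of the transversal.\<close>

definition holonomy_germs ::
    "('x, 'z) foliated_chart set \<Rightarrow> ('x, 'z) foliated_chart \<times> 'z \<Rightarrow>
      ((('x, 'z) foliated_chart \<times> 'z) \<times> (('x, 'z) foliated_chart \<times> 'z)) set set set" where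
  "holonomy_germs \<U> y =
     germ_at (transversal_space \<U>) y ` {h \<in> holonomy_pseudogroup \<U>. (y, y) \<in> h}"

definition without_holonomy :: "('x, 'z) foliated_chart set \<Rightarrow> 'x set \<Rightarrow> bool" where
  "without_holonomy \<U> L \<longleftrightarrow>
     (\<forall>x\<in>L. \<forall>c\<in>\<U>. x \<in> chart_dom c \<longrightarrow>
        holonomy_germs \<U> (c, chart_proj c x) =
        {germ_at (transversal_space \<U>) (c, chart_proj c x) (Id_on (topspace (transversal_space \<U>)))})"

definition union_leaves_without_holonomy ::
    "nat \<Rightarrow> 'x topology \<Rightarrow> ('x, 'z) foliated_chart set \<Rightarrow> ('x, 'z) foliated_chart set \<Rightarrow> 'x set" where
  "union_leaves_without_holonomy n X \<F> \<U> = \<Union>{L \<in> leaves n X \<F>. without_holonomy \<U> L}"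

section \<open>Leaf metrics\<close>

text \<open>Connectedness of a union of plaques refers to the leaf topology. The value is only meaningful
  for \<open>x\<close> and \<open>y\<close> in the same leaf.\<close>

definition leaf_metric :: "nat \<Rightarrow> 'x topology \<Rightarrow> ('x, 'z) foliated_chart set \<Rightarrow>
    ('x, 'z) foliated_chart set \<Rightarrow> 'x \<Rightarrow> 'x \<Rightarrow> real" where
  "leaf_metric n X \<F> \<U> x y =
     (if x = y then 0
      else real (LEAST k. \<exists>\<P>. \<P> \<subseteq> (\<Union>c\<in>\<U>. chart_plaques c) \<and> finite \<P> \<and> card \<P> = k \<and>
                   connectedin (leaf_topology n X \<F>) (\<Union>\<P>) \<and> x \<in> \<Union>\<P> \<and> y \<in> \<Union>\<P>))"

section \<open>The Higson corona\<close>

text \<open>The metric space is a pair \<open>M, d\<close> as in \<^locale>\<open>Metric_space\<close>, and functions on \<open>M\<close> are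
  extensional, so that they are determined by their values on \<open>M\<close>.\<close>

definition vanishes_at_infinity ::
    "'a set \<Rightarrow> ('a \<Rightarrow> 'a \<Rightarrow> real) \<Rightarrow> ('a \<Rightarrow> 'b::real_normed_vector) \<Rightarrow> bool" where
  "vanishes_at_infinity M d f \<longleftrightarrow>
     (\<forall>\<epsilon>>0. \<exists>B. Metric_space.mbounded M d B \<and> (\<forall>x \<in> M - B. norm (f x) < \<epsilon>))"

definition R_variation ::
    "'a set \<Rightarrow> ('a \<Rightarrow> 'a \<Rightarrow> real) \<Rightarrow> real \<Rightarrow> ('a \<Rightarrow> complex) \<Rightarrow> 'a \<Rightarrow> real" where
  "R_variation M d R f x = (SUP y \<in> {y\<in>M. d x y < R}. cmod (f x - f y))"

definition higson_functions :: "'a set \<Rightarrow> ('a \<Rightarrow> 'a \<Rightarrow> real) \<Rightarrow> ('a \<Rightarrow> complex) set" where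
  "higson_functions M d =
     {f \<in> extensional M. bounded (f ` M) \<and> (\<forall>R>0. vanishes_at_infinity M d (R_variation M d R f))}"

definition bounded_vanishing_functions ::
    "'a set \<Rightarrow> ('a \<Rightarrow> 'a \<Rightarrow> real) \<Rightarrow> ('a \<Rightarrow> complex) set" where
  "bounded_vanishing_functions M d =
     {f \<in> extensional M. bounded (f ` M) \<and> vanishes_at_infinity M d f}"

definition higson_class ::
    "'a set \<Rightarrow> ('a \<Rightarrow> 'a \<Rightarrow> real) \<Rightarrow> ('a \<Rightarrow> complex) \<Rightarrow> ('a \<Rightarrow> complex) set" where
  "higson_class M d f =
     {g \<in> higson_functions M d. (\<lambda>x\<in>M. g x - f x) \<in> bounded_vanishing_functions M d}"

definition higson_quotient :: "'a set \<Rightarrow> ('a \<Rightarrow> 'a \<Rightarrow> real) \<Rightarrow> ('a \<Rightarrow> complex) set set" where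
  "higson_quotient M d = higson_class M d ` higson_functions M d"

text \<open>Nonzero multiplicative linear functionals of the quotient algebra. They are automatically
  continuous and compatible with the involution.\<close>

definition higson_characters ::
    "'a set \<Rightarrow> ('a \<Rightarrow> 'a \<Rightarrow> real) \<Rightarrow> (('a \<Rightarrow> complex) set \<Rightarrow> complex) set" where
  "higson_characters M d =
     {\<xi> \<in> extensional (higson_quotient M d).
        (\<exists>a \<in> higson_quotient M d. \<xi> a \<noteq> 0) \<and>
        (\<forall>f \<in> higson_functions M d. \<forall>g \<in> higson_functions M d.
           \<xi> (higson_class M d (\<lambda>x\<in>M. f x + g x)) =
             \<xi> (higson_class M d f) + \<xi> (higson_class M d g) \<and>
           \<xi> (higson_class M d (\<lambda>x\<in>M. f x * g x)) =
             \<xi> (higson_class M d f) * \<xi> (higson_class M d g)) \<and>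
        (\<forall>a. \<forall>f \<in> higson_functions M d.
           \<xi> (higson_class M d (\<lambda>x\<in>M. a * f x)) = a * \<xi> (higson_class M d f))}"

text \<open>The Gelfand topology is the topology of pointwise convergence.\<close>

definition higson_corona ::
    "'a set \<Rightarrow> ('a \<Rightarrow> 'a \<Rightarrow> real) \<Rightarrow> (('a \<Rightarrow> complex) set \<Rightarrow> complex) topology" where
  "higson_corona M d =
     subtopology (product_topology (\<lambda>_. euclidean) (higson_quotient M d)) (higson_characters M d)"

section \<open>Semi weak homogeneity\<close>

definition semi_weakly_homogeneous :: "'a topology \<Rightarrow> bool" where
  "semi_weakly_homogeneous T \<longleftrightarrow>
     (\<forall>V V'. openin T V \<and> V \<noteq> {} \<and> openin T V' \<and> V' \<noteq> {} \<longrightarrow>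
        (\<exists>\<Omega> \<Omega>'. openin T \<Omega> \<and> \<Omega> \<noteq> {} \<and> \<Omega> \<subseteq> V \<and> openin T \<Omega>' \<and> \<Omega>' \<noteq> {} \<and> \<Omega>' \<subseteq> V' \<and>
           subtopology T \<Omega> homeomorphic_space subtopology T \<Omega>'))"

end

theory Submission
  imports Defs
begin

text \<open>An open set of a Higson corona \<open>\<nu>L\<close> contains the characters that do not vanish on a bump function
  supported on a sparse sequence of balls \<open>B(x\<^sub>k, k)\<close> going to infinity, and these characters only
  depend on the balls up to a uniform quasi-isometry. It therefore suffices to find, in any two leaves
  without holonomy and far out in any two prescribed regions, balls of the same radius that are
  quasi-isometric with a constant independent of the radius.

  Record the combinatorics of the ball of radius \<open>r\<close> around a plaque by the words of charts that can be
  followed from it, and by which of these words end in the same plaque. There are finitely many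
  possibilities. Triviality of holonomy germs makes this pattern lower semicontinuous at points without
  holonomy, so where it is largest it is constant on an open set, along the leaves without holonomy. By
  minimality and compactness every leaf meets that open set within a bounded distance of each of its
  points.\<close>

section \<open>Higson functions and characters\<close>

text \<open>The balls must grow along the sequence while the distortion stays bounded, and no single
  open set serves all radii. A separate open set is therefore used for each radius \<open>k\<close>.
  The bound for its relative density in the leaves depends on \<open>k\<close>, which is harmless: a
  nonempty open set of the corona is supported on balls of every radius arbitrarily far out, so
  there is always room to move to a point of the \<open>k\<close>-th open set and keep the ball
  around it. Nothing is known about the leaves between the selected balls, so no map of leaves can
  induce the homeomorphism. Multiplying by the bump first makes pullback along an arbitrary
  extension legitimate, and dividing by the value of the character on the bump restores
  multiplicativity. This amounts to localising the Higson algebra at the bump. The final distortion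
  constant is \<open>2\<close>: the leaf metric counts plaques, and translating a distance into a
  chain of adjacent plaques costs one, as does translating back, whatever the radius.\<close>

context Metric_space
begin

text \<open>Makes vanishing at infinity an ordinary limit, so that the calculus of filters applies.
  For bounded \<open>M\<close> the filter is \<open>bot\<close>, and every function vanishes at
  infinity.\<close>

definition far :: "'a filter" where
  "far = (INF B \<in> {B. mbounded B}. principal (M - B))"

lemma eventually_far: "eventually P far \<longleftrightarrow> (\<exists>B. mbounded B \<and> (\<forall>x\<in>M - B. P x))"
  unfolding far_def
proof (subst eventually_INF_base)
  show "\<exists>x\<in>{B. mbounded B}. principal (M - x) \<le> inf (principal (M - a)) (principal (M - b))"
    if "a \<in> {B. mbounded B}" "b \<in> {B. mbounded B}" for a b
    using that by (intro bexI[of _ "a \<union> b"]) (auto simp: mbounded_Un)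
qed (auto simp: eventually_principal)

lemma eventually_far_in_space: "eventually (\<lambda>x. x \<in> M) far"
  unfolding eventually_far by (intro exI[of _ "{}"]) auto

lemma eventually_far_not_in: "mbounded B \<Longrightarrow> eventually (\<lambda>x. x \<in> M \<and> x \<notin> B) far"
  unfolding eventually_far by (intro exI[of _ B]) auto

lemma eventually_far_dist:
  assumes "p \<in> M" shows "eventually (\<lambda>x. x \<in> M \<and> r < d p x) far"
  using eventually_far_not_in[OF mbounded_mcball[of p r]] assms
  by (auto elim!: eventually_mono)

lemma vanishes_at_infinity_far: "vanishes_at_infinity M d f \<longleftrightarrow> (f \<longlongrightarrow> 0) far"
  unfolding vanishes_at_infinity_def tendsto_iff eventually_far by simp

text \<open>Boundedness of \<open>f\<close> makes the set of differences bounded above; otherwise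
  the real supremum would carry no information.\<close>

lemma cmod_diff_le_R_variation:
  assumes "bounded (f ` M)" "x \<in> M" "y \<in> M" "d x y < R"
  shows "cmod (f x - f y) \<le> R_variation M d R f x"
  unfolding R_variation_def
proof (rule cSUP_upper)
  obtain K where K: "\<And>u. u \<in> M \<Longrightarrow> cmod (f u) \<le> K"
    using assms(1) by (auto simp: bounded_iff)
  have "cmod (f x - f u) \<le> K + K" if "u \<in> M" for u
    using norm_triangle_ineq4[of "f x" "f u"] K[OF that] K[OF assms(2)] by linarith
  then show "bdd_above ((\<lambda>y. cmod (f x - f y)) ` {y \<in> M. d x y < R})"
    by (intro bdd_aboveI[of _ "K + K"]) auto
qed (use assms in auto)

lemma higson_functions_iff:
  "f \<in> higson_functions M d \<longleftrightarrow> f \<in> extensional M \<and> bounded (f ` M) \<and>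
     (\<forall>R>0. \<forall>\<epsilon>>0. eventually (\<lambda>x. \<forall>y\<in>M. d x y < R \<longrightarrow> cmod (f x - f y) < \<epsilon>) far)"
  (is "_ \<longleftrightarrow> ?e \<and> ?b \<and> ?v")
proof -
  have "(R_variation M d R f \<longlongrightarrow> 0) far \<longleftrightarrow>
      (\<forall>\<epsilon>>0. eventually (\<lambda>x. \<forall>y\<in>M. d x y < R \<longrightarrow> cmod (f x - f y) < \<epsilon>) far)"
    (is "?l \<longleftrightarrow> ?r") if b: ?b and R: "R > 0" for R
  proof
    assume l: ?l
    show ?r
    proof (intro allI impI)
      fix \<epsilon> :: real assume "\<epsilon> > 0"
      with l have "eventually (\<lambda>x. \<bar>R_variation M d R f x\<bar> < \<epsilon>) far"
        by (simp add: tendsto_iff)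
      then show "eventually (\<lambda>x. \<forall>y\<in>M. d x y < R \<longrightarrow> cmod (f x - f y) < \<epsilon>) far"
        using eventually_far_in_space
        by eventually_elim (use cmod_diff_le_R_variation[OF b] in force)
    qed
  next
    assume r: ?r
    show ?l unfolding tendsto_iff
    proof (intro allI impI)
      fix \<epsilon> :: real assume "\<epsilon> > 0"
      \<comment> \<open>The supremum inherits only a weak inequality, hence the half.\<close>
      then have "eventually (\<lambda>x. \<forall>y\<in>M. d x y < R \<longrightarrow> cmod (f x - f y) < \<epsilon> / 2) far"
        using r[rule_format, of "\<epsilon> / 2"] by simp
      then show "eventually (\<lambda>x. dist (R_variation M d R f x) 0 < \<epsilon>) far"
        using eventually_far_in_space
      proof eventually_elim
        case (elim x)
        then have "R_variation M d R f x \<le> \<epsilon> / 2"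
          unfolding R_variation_def using R by (intro cSUP_least) (auto intro: less_imp_le)
        moreover have "0 \<le> R_variation M d R f x"
          using cmod_diff_le_R_variation[OF b, of x x R] R elim(2) by simp
        ultimately show ?case using \<open>\<epsilon> > 0\<close> by simp
      qed
    qed
  qed
  then show ?thesis
    unfolding higson_functions_def vanishes_at_infinity_far by auto
qed

lemma higson_functionsI:
  assumes "f \<in> extensional M" "\<And>x. x \<in> M \<Longrightarrow> cmod (f x) \<le> K"
    and "\<And>R \<epsilon>. R > 0 \<Longrightarrow> \<epsilon> > 0 \<Longrightarrow>
      eventually (\<lambda>x. \<forall>y\<in>M. d x y < R \<longrightarrow> cmod (f x - f y) < \<epsilon>) far"
  shows "f \<in> higson_functions M d"
  using assms unfolding higson_functions_iff bounded_iff by auto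

lemma higson_functions_extensional: "f \<in> higson_functions M d \<Longrightarrow> f \<in> extensional M"
  by (simp add: higson_functions_iff)

lemma higson_functions_bound:
  assumes "f \<in> higson_functions M d"
  obtains K where "K > 0" "\<And>x. x \<in> M \<Longrightarrow> cmod (f x) \<le> K"
  using assms unfolding higson_functions_iff bounded_pos by auto

lemma higson_functionsD:
  "f \<in> higson_functions M d \<Longrightarrow> R > 0 \<Longrightarrow> \<epsilon> > 0 \<Longrightarrow>
    eventually (\<lambda>x. \<forall>y\<in>M. d x y < R \<longrightarrow> cmod (f x - f y) < \<epsilon>) far"
  unfolding higson_functions_iff by auto

text \<open>The bounded exceptional set \<open>B\<close> admits functions that are cut off on a bounded set, such as the
  inverse of a function bounded away from \<open>0\<close> near infinity.\<close>

lemma higson_lipschitz_image: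
  fixes h :: "'a \<Rightarrow> complex"
  assumes "f \<in> higson_functions M d" "g \<in> higson_functions M d" "L > 0"
    and "\<And>x. x \<in> M \<Longrightarrow> cmod (h x) \<le> K"
    and "eventually (\<lambda>x. \<forall>y\<in>M. cmod (h x - h y) \<le> L * (cmod (f x - f y) + cmod (g x - g y))
      \<or> mbounded B \<and> y \<in> B) far"
  shows "(\<lambda>x\<in>M. h x) \<in> higson_functions M d"
proof (rule higson_functionsI)
  show "(\<lambda>x\<in>M. h x) \<in> extensional M" by simp
  show "cmod ((\<lambda>x\<in>M. h x) x) \<le> K" if "x \<in> M" for x using assms(4) that by simp
next
  fix R \<epsilon> :: real assume "R > 0" "\<epsilon> > 0"
  \<comment> \<open>Seen from far out, all of the bounded set \<open>B\<close> is at distance at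
    least \<open>R\<close>, so the exceptional alternative never concerns a pair at distance less
    than \<open>R\<close>.\<close>
  have far: "eventually (\<lambda>x. \<forall>y. mbounded B \<and> y \<in> B \<longrightarrow> d x y \<ge> R) far"
  proof (cases "B \<noteq> {} \<and> mbounded B")
    case True
    then obtain p r where p: "p \<in> M" "B \<subseteq> mcball p r"
      unfolding mbounded_def by force
    show ?thesis
      using eventually_far_dist[OF p(1), of "r + R"]
    proof eventually_elim
      case (elim x)
      show ?case
      proof (intro allI impI)
        fix y assume "mbounded B \<and> y \<in> B"
        with p have y: "y \<in> M" "d p y \<le> r" by auto
        then show "d x y \<ge> R"
          using triangle[of p y x] p elim commute[of x y] by linarith
      qed
    qed
  qed auto
  have "eventually (\<lambda>x. \<forall>y\<in>M. d x y < R \<longrightarrow> cmod (f x - f y) < \<epsilon> / (2 * L)) far"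
    "eventually (\<lambda>x. \<forall>y\<in>M. d x y < R \<longrightarrow> cmod (g x - g y) < \<epsilon> / (2 * L)) far"
    using assms \<open>R > 0\<close> \<open>\<epsilon> > 0\<close> by (auto intro!: higson_functionsD)
  then show "eventually (\<lambda>x. \<forall>y\<in>M. d x y < R \<longrightarrow> cmod ((\<lambda>x\<in>M. h x) x - (\<lambda>x\<in>M. h x) y) < \<epsilon>) far"
    using assms(5) far eventually_far_in_space
  proof eventually_elim
    case (elim x)
    show ?case
    proof (intro ballI impI)
      fix y assume y: "y \<in> M" "d x y < R"
      then have "cmod (f x - f y) + cmod (g x - g y) < \<epsilon> / (2 * L) + \<epsilon> / (2 * L)"
        using elim by (intro add_strict_mono) auto
      also have "\<dots> = \<epsilon> / L" using \<open>L > 0\<close> by (simp add: field_simps)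
      finally have "L * (cmod (f x - f y) + cmod (g x - g y)) < \<epsilon>"
        using \<open>L > 0\<close> by (simp add: field_simps)
      moreover have "cmod (h x - h y) \<le> L * (cmod (f x - f y) + cmod (g x - g y))"
        using elim y by fastforce
      ultimately show "cmod ((\<lambda>x\<in>M. h x) x - (\<lambda>x\<in>M. h x) y) < \<epsilon>"
        using y elim by simp
    qed
  qed
qed

section \<open>The algebra of Higson functions and the ideal of vanishing functions\<close>

lemma higson_const: "(\<lambda>x\<in>M. c) \<in> higson_functions M d"
  by (rule higson_functionsI[where K = "cmod c"])
     (auto intro!: eventually_mono[OF eventually_far_in_space])

lemma higson_add:
  assumes f: "f \<in> higson_functions M d" and g: "g \<in> higson_functions M d"
  shows "(\<lambda>x\<in>M. f x + g x) \<in> higson_functions M d"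
proof -
  obtain K K' where K: "\<And>x. x \<in> M \<Longrightarrow> cmod (f x) \<le> K" "\<And>x. x \<in> M \<Longrightarrow> cmod (g x) \<le> K'"
    using higson_functions_bound f g by metis
  show ?thesis
  proof (rule higson_lipschitz_image[OF f g zero_less_one, where K = "K + K'" and B = "{}"])
    show "cmod (f x + g x) \<le> K + K'" if "x \<in> M" for x
      using K[OF that] norm_triangle_ineq[of "f x" "g x"] by linarith
    have "cmod (f x + g x - (f y + g y)) \<le> 1 * (cmod (f x - f y) + cmod (g x - g y))" for x y
      by (metis add_diff_add mult_1 norm_triangle_ineq)
    then show "eventually (\<lambda>x. \<forall>y\<in>M. cmod (f x + g x - (f y + g y)) \<le>
        1 * (cmod (f x - f y) + cmod (g x - g y)) \<or> mbounded {} \<and> y \<in> {}) far"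
      by simp
  qed
qed

lemma higson_mult:
  assumes f: "f \<in> higson_functions M d" and g: "g \<in> higson_functions M d"
  shows "(\<lambda>x\<in>M. f x * g x) \<in> higson_functions M d"
proof -
  obtain K K' where K: "K > 0" "K' > 0"
    "\<And>x. x \<in> M \<Longrightarrow> cmod (f x) \<le> K" "\<And>x. x \<in> M \<Longrightarrow> cmod (g x) \<le> K'"
    using higson_functions_bound f g by metis
  have le: "cmod (f x * g x - f y * g y) \<le> (K + K') * (cmod (f x - f y) + cmod (g x - g y))"
    if "x \<in> M" "y \<in> M" for x y
  proof -
    have "f x * g x - f y * g y = f x * (g x - g y) + (f x - f y) * g y"
      by (simp add: algebra_simps)
    then have "cmod (f x * g x - f y * g y) \<le> cmod (f x) * cmod (g x - g y) + cmod (f x - f y) * cmod (g y)"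
      by (metis norm_mult norm_triangle_ineq)
    also have "\<dots> \<le> (K + K') * cmod (g x - g y) + cmod (f x - f y) * (K + K')"
      using K(3)[OF that(1)] K(4)[OF that(2)] K(1,2) by (intro add_mono mult_mono) auto
    finally show ?thesis by (simp add: algebra_simps)
  qed
  show ?thesis
  proof (rule higson_lipschitz_image[OF f g, where K = "K * K'" and L = "K + K'" and B = "{}"])
    show "cmod (f x * g x) \<le> K * K'" if "x \<in> M" for x
      using K that by (simp add: norm_mult mult_mono)
    show "eventually (\<lambda>x. \<forall>y\<in>M. cmod (f x * g x - f y * g y) \<le>
        (K + K') * (cmod (f x - f y) + cmod (g x - g y)) \<or> mbounded {} \<and> y \<in> {}) far"
      using eventually_far_in_space by eventually_elim (use le in blast)
  qed (use K in simp)
qed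

lemma higson_scale:
  "f \<in> higson_functions M d \<Longrightarrow> (\<lambda>x\<in>M. c * f x) \<in> higson_functions M d"
  using higson_mult[OF higson_const[of c], of f] by (simp cong: restrict_cong)

lemma higson_cnj:
  assumes f: "f \<in> higson_functions M d"
  shows "(\<lambda>x\<in>M. cnj (f x)) \<in> higson_functions M d"
proof -
  obtain K where K: "K > 0" "\<And>x. x \<in> M \<Longrightarrow> cmod (f x) \<le> K"
    using higson_functions_bound f by metis
  have "cmod (cnj (f x) - cnj (f y)) \<le> 1 * (cmod (f x - f y) + cmod (f x - f y))" for x y
    by (metis complex_cnj_diff complex_mod_cnj le_add_same_cancel1 mult_1 norm_ge_zero)
  then show ?thesis
    using K by (intro higson_lipschitz_image[OF f f zero_less_one, where K = K and B = "{}"]) auto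
qed

lemma higson_diff:
  assumes f: "f \<in> higson_functions M d" and g: "g \<in> higson_functions M d"
  shows "(\<lambda>x\<in>M. f x - g x) \<in> higson_functions M d"
  using higson_add[OF f higson_scale[OF g, of "-1"]] by (simp cong: restrict_cong)

lemma bounded_vanishing_iff:
  "f \<in> bounded_vanishing_functions M d \<longleftrightarrow> f \<in> extensional M \<and> bounded (f ` M) \<and> (f \<longlongrightarrow> 0) far"
  by (simp add: bounded_vanishing_functions_def vanishes_at_infinity_far)

lemma bounded_vanishing_restrict_iff:
  "(\<lambda>x\<in>M. f x) \<in> bounded_vanishing_functions M d \<longleftrightarrow> bounded (f ` M) \<and> (f \<longlongrightarrow> 0) far"
proof -
  have "((\<lambda>x\<in>M. f x) \<longlongrightarrow> 0) far \<longleftrightarrow> (f \<longlongrightarrow> 0) far"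
    by (intro tendsto_cong eventually_mono[OF eventually_far_in_space]) simp
  then show ?thesis by (simp add: bounded_vanishing_iff)
qed

lemma bounded_vanishing_diff:
  assumes "(\<lambda>x\<in>M. f x) \<in> bounded_vanishing_functions M d"
    and "(\<lambda>x\<in>M. g x) \<in> bounded_vanishing_functions M d"
  shows "(\<lambda>x\<in>M. f x - g x) \<in> bounded_vanishing_functions M d"
proof -
  have "((\<lambda>x. f x - g x) \<longlongrightarrow> 0 - 0) far"
    using assms unfolding bounded_vanishing_restrict_iff by (intro tendsto_diff) auto
  then show ?thesis
    using assms unfolding bounded_vanishing_restrict_iff
    by (auto intro: bounded_minus_comp)
qed

lemma bounded_vanishing_mult:
  assumes "(\<lambda>x\<in>M. f x) \<in> bounded_vanishing_functions M d"
    and "\<And>x. x \<in> M \<Longrightarrow> cmod (g x) \<le> K"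
  shows "(\<lambda>x\<in>M. f x * g x) \<in> bounded_vanishing_functions M d"
proof -
  have f: "bounded (f ` M)" "(f \<longlongrightarrow> 0) far"
    using assms(1) unfolding bounded_vanishing_restrict_iff by auto
  obtain K' where K': "\<And>x. x \<in> M \<Longrightarrow> cmod (f x) \<le> K'"
    using f(1) by (auto simp: bounded_iff)
  have "cmod (f x * g x) \<le> K' * \<bar>K\<bar>" if "x \<in> M" for x
    unfolding norm_mult using K'[OF that] assms(2)[OF that]
    by (intro mult_mono) (auto intro: order_trans[OF norm_ge_zero])
  moreover have "((\<lambda>x. f x * g x) \<longlongrightarrow> 0) far"
  proof (rule Lim_null_comparison)
    show "eventually (\<lambda>x. cmod (f x * g x) \<le> cmod (f x) * \<bar>K\<bar>) far"
      using eventually_far_in_space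
      by eventually_elim (auto simp: norm_mult intro!: mult_left_mono order_trans[OF assms(2)])
    show "((\<lambda>x. cmod (f x) * \<bar>K\<bar>) \<longlongrightarrow> 0) far"
      using tendsto_mult_left_zero[OF tendsto_norm_zero[OF f(2)]] .
  qed
  ultimately show ?thesis
    unfolding bounded_vanishing_restrict_iff bounded_iff by auto
qed

lemma bounded_vanishing_imp_higson:
  assumes "f \<in> bounded_vanishing_functions M d"
  shows "f \<in> higson_functions M d"
proof -
  have f: "f \<in> extensional M" "bounded (f ` M)" "(f \<longlongrightarrow> 0) far"
    using assms by (auto simp: bounded_vanishing_iff)
  show ?thesis unfolding higson_functions_iff
  proof (intro conjI f allI impI)
    fix R \<epsilon> :: real assume R: "R > 0" "\<epsilon> > 0"
    then have "eventually (\<lambda>x. cmod (f x) < \<epsilon> / 2) far"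
      using f(3) by (auto simp: tendsto_iff dest!: spec[of _ "\<epsilon>/2"])
    then obtain B where B: "mbounded B" "\<And>x. x \<in> M - B \<Longrightarrow> cmod (f x) < \<epsilon> / 2"
      unfolding eventually_far by auto
    obtain p r where p: "B \<subseteq> mcball p r" using B(1) unfolding mbounded_def by auto
    \<comment> \<open>Enlarging the radius by \<open>R\<close> forces not only \<open>x\<close> but
      also its neighbour \<open>y\<close> out of \<open>B\<close>.\<close>
    show "eventually (\<lambda>x. \<forall>y\<in>M. d x y < R \<longrightarrow> cmod (f x - f y) < \<epsilon>) far"
      using eventually_far_not_in[OF mbounded_mcball[of p "r + R"]] eventually_far_not_in[OF B(1)]
    proof eventually_elim
      case (elim x)
      show ?case
      proof (intro ballI impI)
        fix y assume y: "y \<in> M" "d x y < R"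
        have "y \<notin> B"
        proof
          assume "y \<in> B"
          then have "p \<in> M" "d p y \<le> r" using p by auto
          then show False using triangle[of p y x] elim y commute[of x y] by auto
        qed
        then have "cmod (f x) < \<epsilon> / 2" "cmod (f y) < \<epsilon> / 2" using B(2) elim y by auto
        then show "cmod (f x - f y) < \<epsilon>" using norm_triangle_ineq4[of "f x" "f y"] by linarith
      qed
    qed
  qed
qed

section \<open>The quotient algebra and its characters\<close>

lemma higson_class_eq_iff:
  assumes "f \<in> higson_functions M d" "g \<in> higson_functions M d"
  shows "higson_class M d f = higson_class M d g \<longleftrightarrow>
    (\<lambda>x\<in>M. f x - g x) \<in> bounded_vanishing_functions M d"
proof -
  have zero: "(\<lambda>x\<in>M. 0) \<in> bounded_vanishing_functions M d"
    unfolding bounded_vanishing_restrict_iff by (auto simp: bounded_iff)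
  show ?thesis
  proof
    assume eq: "higson_class M d f = higson_class M d g"
    have "f \<in> higson_class M d f"
      unfolding higson_class_def using assms zero by simp
    then have "f \<in> higson_class M d g" by (simp only: eq)
    then show "(\<lambda>x\<in>M. f x - g x) \<in> bounded_vanishing_functions M d"
      by (simp add: higson_class_def)
  next
    assume fg: "(\<lambda>x\<in>M. f x - g x) \<in> bounded_vanishing_functions M d"
    then have gf: "(\<lambda>x\<in>M. g x - f x) \<in> bounded_vanishing_functions M d"
      using bounded_vanishing_diff[OF zero fg] by (simp cong: restrict_cong)
    have "(\<lambda>x\<in>M. h x - f x) \<in> bounded_vanishing_functions M d \<longleftrightarrow>
       (\<lambda>x\<in>M. h x - g x) \<in> bounded_vanishing_functions M d" for h
    proof
      show "(\<lambda>x\<in>M. h x - g x) \<in> bounded_vanishing_functions M d"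
        if "(\<lambda>x\<in>M. h x - f x) \<in> bounded_vanishing_functions M d"
        using bounded_vanishing_diff[OF that gf] by (simp cong: restrict_cong)
      show "(\<lambda>x\<in>M. h x - f x) \<in> bounded_vanishing_functions M d"
        if "(\<lambda>x\<in>M. h x - g x) \<in> bounded_vanishing_functions M d"
        using bounded_vanishing_diff[OF that fg] by (simp cong: restrict_cong)
    qed
    then show "higson_class M d f = higson_class M d g"
      unfolding higson_class_def by auto
  qed
qed

lemma higson_class_in_quotient:
  "f \<in> higson_functions M d \<Longrightarrow> higson_class M d f \<in> higson_quotient M d"
  by (auto simp: higson_quotient_def)

text \<open>An arbitrary choice, neither linear nor multiplicative; algebraic identities are always
  obtained on classes, after independence of the representative.\<close>

definition higson_rep :: "('a \<Rightarrow> complex) set \<Rightarrow> 'a \<Rightarrow> complex" where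
  "higson_rep a = (SOME f. f \<in> higson_functions M d \<and> higson_class M d f = a)"

lemma higson_rep:
  assumes "a \<in> higson_quotient M d"
  shows "higson_rep a \<in> higson_functions M d" "higson_class M d (higson_rep a) = a"
proof -
  have "\<exists>f. f \<in> higson_functions M d \<and> higson_class M d f = a"
    using assms by (auto simp: higson_quotient_def)
  then have "higson_rep a \<in> higson_functions M d \<and> higson_class M d (higson_rep a) = a"
    unfolding higson_rep_def by (rule someI_ex)
  then show "higson_rep a \<in> higson_functions M d" "higson_class M d (higson_rep a) = a"
    by auto
qed

lemma higson_rep_class:
  assumes "f \<in> higson_functions M d"
  shows "(\<lambda>x\<in>M. higson_rep (higson_class M d f) x - f x) \<in> bounded_vanishing_functions M d"
  using higson_class_eq_iff[OF higson_rep(1) assms] higson_rep(2) higson_class_in_quotient[OF assms]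
  by auto

lemma topspace_higson_corona: "topspace (higson_corona M d) = higson_characters M d"
  by (auto simp: higson_corona_def higson_characters_def PiE_iff extensional_def)

lemma continuous_map_higson_corona_eval:
  "f \<in> higson_functions M d \<Longrightarrow>
    continuous_map (higson_corona M d) euclidean (\<lambda>\<xi>. \<xi> (higson_class M d f))"
  unfolding higson_corona_def
  by (intro continuous_map_from_subtopology continuous_map_product_projection higson_class_in_quotient)

context
  fixes \<xi> assumes \<xi>: "\<xi> \<in> higson_characters M d"
begin

lemma char_add:
  "f \<in> higson_functions M d \<Longrightarrow> g \<in> higson_functions M d \<Longrightarrow>
    \<xi> (higson_class M d (\<lambda>x\<in>M. f x + g x)) = \<xi> (higson_class M d f) + \<xi> (higson_class M d g)"
  using \<xi> by (simp add: higson_characters_def)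

lemma char_mult:
  "f \<in> higson_functions M d \<Longrightarrow> g \<in> higson_functions M d \<Longrightarrow>
    \<xi> (higson_class M d (\<lambda>x\<in>M. f x * g x)) = \<xi> (higson_class M d f) * \<xi> (higson_class M d g)"
  using \<xi> by (simp add: higson_characters_def)

lemma char_scale:
  "f \<in> higson_functions M d \<Longrightarrow>
    \<xi> (higson_class M d (\<lambda>x\<in>M. c * f x)) = c * \<xi> (higson_class M d f)"
  using \<xi> by (simp add: higson_characters_def)

lemma char_eq:
  "f \<in> higson_functions M d \<Longrightarrow> g \<in> higson_functions M d \<Longrightarrow>
    (\<lambda>x\<in>M. f x - g x) \<in> bounded_vanishing_functions M d \<Longrightarrow>
    \<xi> (higson_class M d f) = \<xi> (higson_class M d g)"
  using higson_class_eq_iff by metis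

text \<open>Evaluate \<open>\<xi>\<close> on \<open>c * f\<close> once as a scalar multiple and once
  as a product of functions, and cancel a nonzero value \<open>\<xi>\<close> of
  \<open>f\<close>.\<close>

lemma char_const: "\<xi> (higson_class M d (\<lambda>x\<in>M. c)) = c"
proof -
  obtain f where f: "f \<in> higson_functions M d" "\<xi> (higson_class M d f) \<noteq> 0"
    using \<xi> by (auto simp: higson_characters_def higson_quotient_def)
  have "(\<lambda>x\<in>M. c * f x) = (\<lambda>x\<in>M. (\<lambda>x\<in>M. c) x * f x)" by auto
  then show ?thesis
    using char_mult[OF higson_const f(1), of c] char_scale[OF f(1), of c] f(2) by simp
qed

lemma char_diff_const:
  assumes "f \<in> higson_functions M d"
  shows "\<xi> (higson_class M d (\<lambda>x\<in>M. f x - c)) = \<xi> (higson_class M d f) - c"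
proof -
  have "(\<lambda>x\<in>M. f x - c) = (\<lambda>x\<in>M. f x + (\<lambda>x\<in>M. -c) x)" by auto
  then show ?thesis using char_add[OF assms higson_const, of "-c"] char_const[of "-c"] by simp
qed

end

end

section \<open>Characters as limits of evaluations\<close>

context Metric_space
begin

text \<open>Otherwise \<open>\<Sum>f\<in>F. \<bar>f - \<xi> f\<bar>\<^sup>2\<close>, which \<open>\<xi>\<close> maps to \<open>0\<close>, would be bounded below outside \<open>B\<close>, hence
  invertible modulo functions that vanish at infinity.\<close>

lemma char_approximation:
  assumes \<xi>: "\<xi> \<in> higson_characters M d" and F: "finite F" "F \<subseteq> higson_functions M d"
    and "\<epsilon> > 0" and B: "mbounded B"
  shows "\<exists>x\<in>M - B. \<forall>f\<in>F. cmod (f x - \<xi> (higson_class M d f)) < \<epsilon>"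
proof (rule ccontr)
  assume "\<not> ?thesis"
  then have not: "\<exists>f\<in>F. cmod (f x - \<xi> (higson_class M d f)) \<ge> \<epsilon>" if "x \<in> M - B" for x
    using that by (meson not_less)
  define h where "h f = (\<lambda>x\<in>M. f x - \<xi> (higson_class M d f))" for f
  define q where "q f = (\<lambda>x\<in>M. h f x * (\<lambda>x\<in>M. cnj (h f x)) x)" for f
  have h: "h f \<in> higson_functions M d" "\<xi> (higson_class M d (h f)) = 0"
    if "f \<in> higson_functions M d" for f
    using higson_diff[OF that higson_const[of "\<xi> (higson_class M d f)"]]
      char_diff_const[OF \<xi> that] by (simp_all add: h_def cong: restrict_cong)
  have q: "q f \<in> higson_functions M d" "\<xi> (higson_class M d (q f)) = 0"
    if "f \<in> higson_functions M d" for f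
    unfolding q_def
    using higson_mult[OF h(1)[OF that] higson_cnj[OF h(1)[OF that]]]
      char_mult[OF \<xi> h(1)[OF that] higson_cnj[OF h(1)[OF that]]] h(2)[OF that] by simp_all
  have q_eq: "q f x = of_real ((cmod (f x - \<xi> (higson_class M d f)))\<^sup>2)" if "x \<in> M" for f x
    using that complex_norm_square[of "f x - \<xi> (higson_class M d f)"] by (simp add: q_def h_def)
  define p where "p F = (\<lambda>x\<in>M. \<Sum>f\<in>F. q f x)" for F
  define g where "g = p F"
  have g: "g \<in> higson_functions M d \<and> \<xi> (higson_class M d g) = 0"
    unfolding g_def using F
  proof (induction F rule: finite_induct)
    case empty
    have "p {} = (\<lambda>x\<in>M. 0)" by (auto simp: p_def)
    then show ?case using higson_const[of 0] char_const[OF \<xi>, of 0] by metis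
  next
    case (insert f F)
    have eq: "p (insert f F) = (\<lambda>x\<in>M. q f x + p F x)"
      using insert by (auto simp: p_def)
    have "f \<in> higson_functions M d" "p F \<in> higson_functions M d" "\<xi> (higson_class M d (p F)) = 0"
      using insert by auto
    then have "(\<lambda>x\<in>M. q f x + p F x) \<in> higson_functions M d \<and>
        \<xi> (higson_class M d (\<lambda>x\<in>M. q f x + p F x)) = 0"
      using q[of f] higson_add[of "q f" "p F"] char_add[OF \<xi>, of "q f" "p F"] by simp
    then show ?case using eq by metis
  qed
  have g_ge: "\<epsilon>\<^sup>2 \<le> cmod (g x)" if x: "x \<in> M - B" for x
  proof -
    obtain f where f: "f \<in> F" "cmod (f x - \<xi> (higson_class M d f)) \<ge> \<epsilon>" using not[OF x] by auto
    have "\<epsilon>\<^sup>2 \<le> (cmod (f x - \<xi> (higson_class M d f)))\<^sup>2"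
      using f(2) \<open>\<epsilon> > 0\<close> by (intro power_mono) auto
    also have "\<dots> \<le> (\<Sum>f\<in>F. (cmod (f x - \<xi> (higson_class M d f)))\<^sup>2)"
      using f(1) F(1) by (intro member_le_sum) auto
    also have "\<dots> \<le> cmod (g x)"
    proof -
      have "g x = of_real (\<Sum>f\<in>F. (cmod (f x - \<xi> (higson_class M d f)))\<^sup>2)"
        unfolding g_def p_def using x by (simp add: q_eq)
      also have "cmod \<dots> = \<bar>\<Sum>f\<in>F. (cmod (f x - \<xi> (higson_class M d f)))\<^sup>2\<bar>"
        by (rule norm_of_real)
      finally show ?thesis by simp
    qed
    finally show ?thesis .
  qed
  \<comment> \<open>An inverse of \<open>g\<close> off \<open>B\<close>. On \<open>B\<close>, where
    \<open>g\<close> may vanish, the value is irrelevant modulo functions that vanish at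
    infinity.\<close>
  define u where "u x = (if x \<in> B then 0 else inverse (g x))" for x
  have \<epsilon>2: "\<epsilon>\<^sup>2 > 0" using \<open>\<epsilon> > 0\<close> by simp
  have u_bd: "cmod (u x) \<le> inverse (\<epsilon>\<^sup>2)" if "x \<in> M" for x
    using g_ge[of x] that \<epsilon>2 by (auto simp: u_def norm_inverse intro!: le_imp_inverse_le)
  have u: "(\<lambda>x\<in>M. u x) \<in> higson_functions M d"
  \<comment> \<open>The constant comes from \<open>1/a - 1/b = (b - a)/(a b)\<close> with both
    denominators at least \<open>\<epsilon>\<^sup>2\<close> in modulus.\<close>
  proof (rule higson_lipschitz_image[where f = g and g = g and L = "inverse (\<epsilon>\<^sup>2) * inverse (\<epsilon>\<^sup>2)" and B = B])
    have "cmod (u x - u y) \<le> inverse (\<epsilon>\<^sup>2) * inverse (\<epsilon>\<^sup>2) * (cmod (g x - g y) + cmod (g x - g y))"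
      if x: "x \<in> M - B" and y: "y \<in> M - B" for x y
    proof -
      have nz: "g x \<noteq> 0" "g y \<noteq> 0" using g_ge[OF x] g_ge[OF y] \<epsilon>2 by auto
      have "u x - u y = - (inverse (g x) * (g x - g y) * inverse (g y))"
        using x y nz by (simp add: u_def inverse_diff_inverse)
      then have "cmod (u x - u y) = cmod (u x) * cmod (u y) * cmod (g x - g y)"
        using x y by (simp add: norm_mult u_def)
      also have "\<dots> \<le> inverse (\<epsilon>\<^sup>2) * inverse (\<epsilon>\<^sup>2) * (cmod (g x - g y) + cmod (g x - g y))"
        using u_bd x y by (intro mult_mono) auto
      finally show ?thesis .
    qed
    then show "eventually (\<lambda>x. \<forall>y\<in>M. cmod (u x - u y) \<le> inverse (\<epsilon>\<^sup>2) * inverse (\<epsilon>\<^sup>2) *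
        (cmod (g x - g y) + cmod (g x - g y)) \<or> mbounded B \<and> y \<in> B) far"
      using eventually_far_not_in[OF B] B by (auto elim!: eventually_mono)
  qed (use g u_bd \<epsilon>2 in auto)
  have "(\<lambda>x\<in>M. (\<lambda>x\<in>M. u x * g x) x - (\<lambda>x\<in>M. 1) x) = (\<lambda>x\<in>M. if x \<in> B then -1 else 0)"
  proof (intro restrict_ext)
    show "(\<lambda>x\<in>M. u x * g x) x - (\<lambda>x\<in>M. 1) x = (if x \<in> B then -1 else 0)" if "x \<in> M" for x
    proof (cases "x \<in> B")
      case False
      then have "g x \<noteq> 0" using g_ge[of x] \<epsilon>2 that by auto
      then show ?thesis using that False by (simp add: u_def)
    qed (use that in \<open>simp add: u_def\<close>)
  qed
  moreover have "\<dots> \<in> bounded_vanishing_functions M d"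
    unfolding bounded_vanishing_restrict_iff
  proof
    show "((\<lambda>x. if x \<in> B then -1 else 0) \<longlongrightarrow> (0::complex)) far"
      by (rule tendsto_eventually) (use eventually_far_not_in[OF B] in \<open>auto elim!: eventually_mono\<close>)
  qed (auto simp: bounded_iff intro!: exI[of _ 1])
  moreover have ug: "(\<lambda>x\<in>M. u x * g x) \<in> higson_functions M d"
    using higson_mult[OF u, of g] g by (simp cong: restrict_cong)
  ultimately have "\<xi> (higson_class M d (\<lambda>x\<in>M. u x * g x)) = 1"
    using char_eq[OF \<xi> ug higson_const[of 1]] char_const[OF \<xi>, of 1] by simp
  moreover have "\<xi> (higson_class M d (\<lambda>x\<in>M. u x * g x)) = 0"
    using char_mult[OF \<xi> u, of g] g by (simp cong: restrict_cong)
  ultimately show False by simp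
qed

text \<open>Tychonoff's theorem gives a cluster point of the evaluations at the points of the sequence.\<close>

lemma character_along_sequence:
  assumes x: "filterlim x far sequentially"
  obtains \<xi> where "\<xi> \<in> higson_characters M d"
    "\<And>f c. f \<in> higson_functions M d \<Longrightarrow> (\<And>k. f (x k) = c) \<Longrightarrow> \<xi> (higson_class M d f) = c"
proof -
  let ?H = "higson_functions M d"
  have "\<exists>K. \<forall>y\<in>M. f \<in> ?H \<longrightarrow> cmod (f y) \<le> K" for f
    using higson_functions_bound[of f] by metis
  then obtain b where b: "\<And>f y. y \<in> M \<Longrightarrow> f \<in> ?H \<Longrightarrow> cmod (f y) \<le> b f" by metis
  \<comment> \<open>All functions serve as indices, so that the compact product lives in the whole
    function type. At indices outside \<open>?H\<close> the point \<open>e k\<close> is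
    \<open>0\<close>, and the absolute value keeps the discs there nonempty.\<close>
  define U where "U = (\<Pi>\<^sub>E f\<in>UNIV. cball (0::complex) \<bar>b f\<bar>)"
  define e where "e k f = (if f \<in> ?H then f (x k) else 0)" for k f
  have "compactin (product_topology (\<lambda>_. euclidean) UNIV) U"
    unfolding U_def compactin_PiE by simp
  then have "compact U"
    by (simp add: euclidean_product_topology)
  have xM: "eventually (\<lambda>k. x k \<in> M) sequentially"
    using x eventually_far_in_space by (rule eventually_compose_filterlim[rotated])
  have "eventually (\<lambda>u. u \<in> U) (filtermap e sequentially)"
    unfolding eventually_filtermap using xM
    by eventually_elim (use b in \<open>force simp: U_def e_def PiE_iff\<close>)
  then obtain u where u: "inf (nhds u) (filtermap e sequentially) \<noteq> bot"
    using \<open>compact U\<close> unfolding compact_filter by (force simp: filtermap_bot_iff)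
  \<comment> \<open>A cluster point is the limit along this finer proper filter, so the algebraic
    identities for \<open>u\<close> follow from limit laws and uniqueness of limits.\<close>
  define G where "G = inf (nhds u) (filtermap e sequentially)"
  have G: "G \<noteq> bot" using u G_def by simp
  have coord: "((\<lambda>v. v f) \<longlongrightarrow> u f) G" for f
  proof -
    have "((\<lambda>v. v f) \<longlongrightarrow> u f) (nhds u)"
      by (rule continuous_on_tendsto_compose[OF continuous_on_product_coordinates filterlim_ident]) auto
    then show ?thesis unfolding G_def by (rule tendsto_mono[rotated]) simp
  qed
  have ev: "eventually P G" if "eventually (\<lambda>k. P (e k)) sequentially" for P
    using that unfolding G_def
    by (metis eventually_filtermap filter_leD inf_le2)
  have u_eq: "u h = c" if "eventually (\<lambda>v. v h = w v) G" "(w \<longlongrightarrow> c) G" for h w c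
  proof (rule tendsto_unique[OF G coord])
    show "((\<lambda>v. v h) \<longlongrightarrow> c) G"
      using tendsto_cong[OF that(1)] that(2) by blast
  qed
  have u_add: "u (\<lambda>x\<in>M. f x + g x) = u f + u g" if "f \<in> ?H" "g \<in> ?H" for f g
  proof (rule u_eq)
    show "eventually (\<lambda>v. v (\<lambda>x\<in>M. f x + g x) = v f + v g) G"
      by (rule ev, use xM in eventually_elim) (use that higson_add in \<open>auto simp: e_def\<close>)
    show "((\<lambda>v. v f + v g) \<longlongrightarrow> u f + u g) G" by (intro tendsto_add coord)
  qed
  have u_mult: "u (\<lambda>x\<in>M. f x * g x) = u f * u g" if "f \<in> ?H" "g \<in> ?H" for f g
  proof (rule u_eq)
    show "eventually (\<lambda>v. v (\<lambda>x\<in>M. f x * g x) = v f * v g) G"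
      by (rule ev, use xM in eventually_elim) (use that higson_mult in \<open>auto simp: e_def\<close>)
    show "((\<lambda>v. v f * v g) \<longlongrightarrow> u f * u g) G" by (intro tendsto_mult coord)
  qed
  have u_scale: "u (\<lambda>x\<in>M. a * f x) = a * u f" if "f \<in> ?H" for f a
  proof (rule u_eq)
    show "eventually (\<lambda>v. v (\<lambda>x\<in>M. a * f x) = a * v f) G"
      by (rule ev, use xM in eventually_elim) (use that higson_scale in \<open>auto simp: e_def\<close>)
    show "((\<lambda>v. a * v f) \<longlongrightarrow> a * u f) G" by (intro tendsto_mult tendsto_const coord)
  qed
  have u_const: "u f = c" if "f \<in> ?H" "\<And>k. f (x k) = c" for f c
    by (rule u_eq[of f "\<lambda>_. c" c]) (use that in \<open>auto intro!: ev simp: e_def\<close>)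
  have u_vanish: "u f = 0" if f: "f \<in> bounded_vanishing_functions M d" for f
  proof -
    have "((\<lambda>k. f (x k)) \<longlongrightarrow> 0) sequentially"
      using f x unfolding bounded_vanishing_iff by (auto intro: filterlim_compose)
    then have "((\<lambda>k. e k f) \<longlongrightarrow> 0) sequentially"
      using bounded_vanishing_imp_higson[OF f] by (simp add: e_def)
    then have "((\<lambda>v. v f) \<longlongrightarrow> 0) (filtermap e sequentially)"
      by (simp add: filterlim_def filtermap_filtermap)
    then have "((\<lambda>v. v f) \<longlongrightarrow> 0) G"
      unfolding G_def by (rule tendsto_mono[rotated]) simp
    then show ?thesis using tendsto_unique[OF G coord] by blast
  qed
  have u_cong: "u f = u g" if "f \<in> ?H" "g \<in> ?H" "(\<lambda>x\<in>M. f x - g x) \<in> bounded_vanishing_functions M d" for f g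
  proof -
    have "(\<lambda>x\<in>M. f x - g x) = (\<lambda>x\<in>M. f x + (\<lambda>x\<in>M. (-1) * g x) x)" by auto
    then show ?thesis
      using u_vanish[OF that(3)] u_add[OF that(1) higson_scale[OF that(2), of "-1"]]
        u_scale[OF that(2), of "-1"] by simp
  qed
  define \<xi> where "\<xi> = (\<lambda>a\<in>higson_quotient M d. u (higson_rep a))"
  have \<xi>: "\<xi> (higson_class M d f) = u f" if "f \<in> ?H" for f
    unfolding \<xi>_def using u_cong[OF _ that higson_rep_class[OF that]]
    by (simp add: higson_class_in_quotient[OF that] higson_rep(1))
  have "\<xi> \<in> higson_characters M d"
    unfolding higson_characters_def
  proof (intro CollectI conjI ballI allI)
    show "\<xi> \<in> extensional (higson_quotient M d)" by (simp add: \<xi>_def)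
    have "u (\<lambda>x\<in>M. 1) \<noteq> 0"
    proof -
      have "u (\<lambda>x\<in>M. 1) = 1"
        by (rule u_eq[of _ "\<lambda>_. 1" 1], rule ev, use xM in eventually_elim)
           (auto simp: e_def higson_const)
      then show ?thesis by simp
    qed
    then show "\<exists>a\<in>higson_quotient M d. \<xi> a \<noteq> 0"
      using \<xi>[OF higson_const, of 1] higson_class_in_quotient[OF higson_const, of 1] by metis
  qed (auto simp: \<xi> u_add u_mult u_scale higson_add higson_mult higson_scale)
  then show ?thesis using that \<xi> u_const by metis
qed

text \<open>\<open>S\<close> collects the points where finitely many Higson functions nearly take
  their values at a character in \<open>V\<close>. Such points lie arbitrarily far out, and slow
  variation spreads them to balls. Conversely, a character that does not vanish on
  \<open>\<psi>\<close> is approximated by evaluations at points where \<open>\<psi>\<close> is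
  nonzero, hence at points of \<open>S\<close>.\<close>

lemma nonempty_openin_higson_corona_support:
  assumes V: "openin (higson_corona M d) V" "V \<noteq> {}"
  obtains S where "\<And>\<rho> B. mbounded B \<Longrightarrow> \<exists>x\<in>M - B. mball x \<rho> \<subseteq> S"
    "\<And>\<psi> \<xi>. \<psi> \<in> higson_functions M d \<Longrightarrow> (\<And>x. x \<in> M \<Longrightarrow> \<psi> x \<noteq> 0 \<Longrightarrow> x \<in> S) \<Longrightarrow>
      \<xi> \<in> higson_characters M d \<Longrightarrow> \<xi> (higson_class M d \<psi>) \<noteq> 0 \<Longrightarrow> \<xi> \<in> V"
proof -
  let ?Q = "higson_quotient M d"
  obtain \<xi>0 where \<xi>0: "\<xi>0 \<in> V" using V by auto
  then have \<xi>0c: "\<xi>0 \<in> higson_characters M d"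
    using openin_subset[OF V(1)] topspace_higson_corona by auto
  obtain W where W: "openin (product_topology (\<lambda>_. euclidean) ?Q) W" "V = W \<inter> higson_characters M d"
    using V(1) unfolding higson_corona_def openin_subtopology by auto
  obtain O' where O': "finite {i \<in> ?Q. O' i \<noteq> topspace (euclidean::complex topology)}"
    "\<And>i. i \<in> ?Q \<Longrightarrow> open (O' i)" "\<xi>0 \<in> PiE ?Q O'" "PiE ?Q O' \<subseteq> W"
    using W \<xi>0 unfolding openin_product_topology_alt by fastforce
  define J where "J = {i \<in> ?Q. O' i \<noteq> UNIV}"
  have J: "finite J" using O'(1) by (simp add: J_def)
  have "\<exists>\<epsilon>>0. ball (\<xi>0 i) \<epsilon> \<subseteq> O' i" if "i \<in> J" for i
  proof -
    have "open (O' i)" "\<xi>0 i \<in> O' i" using O'(2,3) that by (auto simp: J_def PiE_iff)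
    then show ?thesis using open_contains_ball by blast
  qed
  then obtain \<epsilon>f where \<epsilon>f: "\<And>i. i \<in> J \<Longrightarrow> \<epsilon>f i > 0 \<and> ball (\<xi>0 i) (\<epsilon>f i) \<subseteq> O' i" by metis
  \<comment> \<open>The \<open>1\<close> covers an empty \<open>J\<close>.\<close>
  define \<epsilon> where "\<epsilon> = Min (insert 1 (\<epsilon>f ` J))"
  have \<epsilon>: "\<epsilon> > 0" "\<And>i. i \<in> J \<Longrightarrow> \<epsilon> \<le> \<epsilon>f i"
    using J \<epsilon>f by (auto simp: \<epsilon>_def)
  define F where "F = higson_rep ` J"
  have F: "finite F" "F \<subseteq> higson_functions M d"
    using J higson_rep(1) by (auto simp: F_def J_def)
  have class_F: "higson_class M d (higson_rep i) = i" if "i \<in> J" for i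
    using that higson_rep(2) by (simp add: J_def)
  \<comment> \<open>The half is spent as a quarter for the approximation at the centre of a ball and
    a quarter for the variation over the ball; the other half of \<open>\<epsilon>\<close> absorbs
    the distance from an evaluation to \<open>\<xi>\<close>.\<close>
  define S where "S = {x\<in>M. \<forall>f\<in>F. cmod (f x - \<xi>0 (higson_class M d f)) < \<epsilon> / 2}"
  show ?thesis
  proof
    fix \<rho> B assume B: "mbounded B"
    have "eventually (\<lambda>x. \<forall>f\<in>F. \<forall>y\<in>M. d x y < max 1 \<rho> \<longrightarrow> cmod (f x - f y) < \<epsilon> / 4) far"
      using F \<epsilon> by (intro eventually_ball_finite ballI higson_functionsD) auto
    then obtain B' where B': "mbounded B'"
      "\<And>x f y. x \<in> M - B' \<Longrightarrow> f \<in> F \<Longrightarrow> y \<in> M \<Longrightarrow> d x y < max 1 \<rho> \<Longrightarrow> cmod (f x - f y) < \<epsilon> / 4"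
      unfolding eventually_far by blast
    have "\<epsilon> / 4 > 0" using \<epsilon> by simp
    from char_approximation[OF \<xi>0c F this, of "B \<union> B'"] B B'(1)
    obtain x where x: "x \<in> M - (B \<union> B')" "\<And>f. f \<in> F \<Longrightarrow> cmod (f x - \<xi>0 (higson_class M d f)) < \<epsilon> / 4"
      by (auto simp: mbounded_Un)
    have "mball x \<rho> \<subseteq> S"
    proof
      fix y assume y: "y \<in> mball x \<rho>"
      have "cmod (f y - \<xi>0 (higson_class M d f)) < \<epsilon> / 2" if "f \<in> F" for f
      proof -
        have "cmod (f x - f y) < \<epsilon> / 4" using B'(2)[of x f y] x(1) that y by auto
        then show ?thesis
          using x(2)[OF that] norm_triangle_ineq4[of "f x - \<xi>0 (higson_class M d f)" "f x - f y"] by simp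
      qed
      then show "y \<in> S" using y by (auto simp: S_def)
    qed
    then show "\<exists>x\<in>M - B. mball x \<rho> \<subseteq> S" using x by auto
  next
    fix \<psi> \<xi>
    assume \<psi>: "\<psi> \<in> higson_functions M d" "\<And>x. x \<in> M \<Longrightarrow> \<psi> x \<noteq> 0 \<Longrightarrow> x \<in> S"
      and \<xi>: "\<xi> \<in> higson_characters M d" "\<xi> (higson_class M d \<psi>) \<noteq> 0"
    \<comment> \<open>An approximation of \<open>\<xi>\<close> on \<open>\<psi>\<close> better than
      the modulus of its value forces \<open>\<psi> x \<noteq> 0\<close>.\<close>
    define \<epsilon>' where "\<epsilon>' = min (\<epsilon> / 2) (cmod (\<xi> (higson_class M d \<psi>)))"
    have "\<epsilon>' > 0" using \<xi> \<epsilon> by (simp add: \<epsilon>'_def)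
    then obtain x where x: "x \<in> M"
      "\<And>f. f \<in> insert \<psi> F \<Longrightarrow> cmod (f x - \<xi> (higson_class M d f)) < \<epsilon>'"
      using char_approximation[OF \<xi>(1), of "insert \<psi> F" \<epsilon>' "{}"] F \<psi>(1) by auto
    have "\<psi> x \<noteq> 0" using x(2)[of \<psi>] by (auto simp: \<epsilon>'_def)
    then have "x \<in> S" using \<psi>(2) x(1) by blast
    have "\<xi> i \<in> O' i" if i: "i \<in> ?Q" for i
    proof (cases "i \<in> J")
      case True
      have f: "higson_rep i \<in> F" using True by (simp add: F_def)
      have "cmod (higson_rep i x - \<xi>0 i) < \<epsilon> / 2" "cmod (higson_rep i x - \<xi> i) < \<epsilon> / 2"
        using \<open>x \<in> S\<close> f x(2)[of "higson_rep i"] class_F[OF True] by (auto simp: S_def \<epsilon>'_def)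
      then have "cmod (\<xi>0 i - \<xi> i) < \<epsilon>"
        using norm_triangle_ineq4[of "higson_rep i x - \<xi> i" "higson_rep i x - \<xi>0 i"] by simp
      then have "\<xi> i \<in> ball (\<xi>0 i) (\<epsilon>f i)"
        using \<epsilon>(2)[OF True] by (simp add: dist_norm)
      then show ?thesis using \<epsilon>f[OF True] by auto
    qed (use i in \<open>auto simp: J_def\<close>)
    then have "\<xi> \<in> PiE ?Q O'"
      using \<xi>(1) by (auto simp: higson_characters_def PiE_iff)
    then show "\<xi> \<in> V" using O'(4) W(2) \<xi>(1) by auto
  qed
qed

end

section \<open>Homeomorphisms from weighted pullbacks\<close>

locale higson_pullback =
  dom: Metric_space M d + cod: Metric_space M' d'
  for M :: "'a set" and d and M' :: "'b set" and d' +
  fixes \<psi> :: "'a \<Rightarrow> complex" and \<phi> :: "'a \<Rightarrow> 'b"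
  assumes weight: "\<psi> \<in> higson_functions M d"
    and map_in: "x \<in> M \<Longrightarrow> \<phi> x \<in> M'"
    and pull_higson: "f \<in> higson_functions M' d' \<Longrightarrow>
      (\<lambda>x\<in>M. \<psi> x * f (\<phi> x)) \<in> higson_functions M d"
    and pull_vanishing: "f \<in> bounded_vanishing_functions M' d' \<Longrightarrow>
      (\<lambda>x\<in>M. \<psi> x * f (\<phi> x)) \<in> bounded_vanishing_functions M d"
begin

text \<open>Multiplicative because \<open>\<psi> \<cdot> \<psi>(f g \<circ> \<phi>) = \<psi>(f \<circ> \<phi>) \<cdot> \<psi>(g \<circ> \<phi>)\<close>.\<close>

definition push_char :: "(('a \<Rightarrow> complex) set \<Rightarrow> complex) \<Rightarrow> ('b \<Rightarrow> complex) set \<Rightarrow> complex" where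
  "push_char \<xi> = (\<lambda>a\<in>higson_quotient M' d'.
     \<xi> (higson_class M d (\<lambda>x\<in>M. \<psi> x * cod.higson_rep a (\<phi> x))) / \<xi> (higson_class M d \<psi>))"

text \<open>Two representatives differ by a vanishing function, whose weighted pullback vanishes
  again, so the choice made by \<open>higson_rep\<close> disappears.\<close>

lemma push_char_class:
  assumes \<xi>: "\<xi> \<in> higson_characters M d" and f: "f \<in> higson_functions M' d'"
  shows "push_char \<xi> (higson_class M' d' f) =
    \<xi> (higson_class M d (\<lambda>x\<in>M. \<psi> x * f (\<phi> x))) / \<xi> (higson_class M d \<psi>)"
proof -
  let ?r = "cod.higson_rep (higson_class M' d' f)"
  have r: "?r \<in> higson_functions M' d'"
    using cod.higson_rep(1) cod.higson_class_in_quotient f by blast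
  have "(\<lambda>x\<in>M. (\<lambda>x\<in>M. \<psi> x * ?r (\<phi> x)) x - (\<lambda>x\<in>M. \<psi> x * f (\<phi> x)) x) =
     (\<lambda>x\<in>M. \<psi> x * (\<lambda>y\<in>M'. ?r y - f y) (\<phi> x))"
    using map_in by (auto simp: algebra_simps)
  then have "\<xi> (higson_class M d (\<lambda>x\<in>M. \<psi> x * ?r (\<phi> x))) = \<xi> (higson_class M d (\<lambda>x\<in>M. \<psi> x * f (\<phi> x)))"
    using pull_vanishing[OF cod.higson_rep_class[OF f]]
    by (intro dom.char_eq[OF \<xi>] pull_higson r f) simp
  then show ?thesis
    by (simp add: push_char_def cod.higson_class_in_quotient[OF f])
qed

lemma push_char_in_characters:
  assumes \<xi>: "\<xi> \<in> higson_characters M d" and nz: "\<xi> (higson_class M d \<psi>) \<noteq> 0"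
  shows "push_char \<xi> \<in> higson_characters M' d'"
  unfolding higson_characters_def
proof (intro CollectI conjI ballI allI)
  let ?p = "\<lambda>f. (\<lambda>x\<in>M. \<psi> x * f (\<phi> x))"
  show "push_char \<xi> \<in> extensional (higson_quotient M' d')" by (simp add: push_char_def)
  have "?p (\<lambda>y\<in>M'. 1) = \<psi>"
    using map_in dom.higson_functions_extensional[OF weight] by (auto simp: extensional_def)
  then have "push_char \<xi> (higson_class M' d' (\<lambda>y\<in>M'. 1)) = 1"
    using push_char_class[OF \<xi> cod.higson_const, of 1] nz by simp
  then show "\<exists>a\<in>higson_quotient M' d'. push_char \<xi> a \<noteq> 0"
    using cod.higson_class_in_quotient[OF cod.higson_const] by (metis zero_neq_one)
  fix f assume f: "f \<in> higson_functions M' d'"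
  {
    fix g assume g: "g \<in> higson_functions M' d'"
    have "?p (\<lambda>y\<in>M'. f y + g y) = (\<lambda>x\<in>M. ?p f x + ?p g x)"
      using map_in by (auto simp: algebra_simps)
    then show "push_char \<xi> (higson_class M' d' (\<lambda>x\<in>M'. f x + g x)) =
        push_char \<xi> (higson_class M' d' f) + push_char \<xi> (higson_class M' d' g)"
      using dom.char_add[OF \<xi> pull_higson[OF f] pull_higson[OF g]]
      by (simp add: push_char_class[OF \<xi>] f g cod.higson_add add_divide_distrib)
    have "(\<lambda>x\<in>M. \<psi> x * ?p (\<lambda>y\<in>M'. f y * g y) x) = (\<lambda>x\<in>M. ?p f x * ?p g x)"
      using map_in by auto
    then have "\<xi> (higson_class M d \<psi>) * \<xi> (higson_class M d (?p (\<lambda>y\<in>M'. f y * g y))) =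
        \<xi> (higson_class M d (?p f)) * \<xi> (higson_class M d (?p g))"
      using dom.char_mult[OF \<xi> weight pull_higson[OF cod.higson_mult[OF f g]]]
        dom.char_mult[OF \<xi> pull_higson[OF f] pull_higson[OF g]] by simp
    then show "push_char \<xi> (higson_class M' d' (\<lambda>x\<in>M'. f x * g x)) =
        push_char \<xi> (higson_class M' d' f) * push_char \<xi> (higson_class M' d' g)"
      using nz by (simp add: push_char_class[OF \<xi>] f g cod.higson_mult field_simps)
  }
  fix a
  have "?p (\<lambda>y\<in>M'. a * f y) = (\<lambda>x\<in>M. a * ?p f x)"
    using map_in by auto
  then show "push_char \<xi> (higson_class M' d' (\<lambda>x\<in>M'. a * f x)) = a * push_char \<xi> (higson_class M' d' f)"
    using dom.char_scale[OF \<xi> pull_higson[OF f]]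
    by (simp add: push_char_class[OF \<xi>] f cod.higson_scale)
qed

lemma continuous_map_push_char:
  "continuous_map
     (subtopology (higson_corona M d) {\<xi> \<in> higson_characters M d. \<xi> (higson_class M d \<psi>) \<noteq> 0})
     (higson_corona M' d') push_char"
  unfolding higson_corona_def[of M' d']
proof (intro continuous_map_into_subtopology)
  let ?\<Omega> = "{\<xi> \<in> higson_characters M d. \<xi> (higson_class M d \<psi>) \<noteq> 0}"
  show "continuous_map (subtopology (higson_corona M d) ?\<Omega>)
     (product_topology (\<lambda>_. euclidean) (higson_quotient M' d')) push_char"
    unfolding continuous_map_componentwise
  proof (intro conjI ballI)
    fix a assume a: "a \<in> higson_quotient M' d'"
    have "continuous_map (subtopology (higson_corona M d) ?\<Omega>) euclidean
      (\<lambda>\<xi>. \<xi> (higson_class M d (\<lambda>x\<in>M. \<psi> x * cod.higson_rep a (\<phi> x))) / \<xi> (higson_class M d \<psi>))"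
      unfolding continuous_map_atin
    proof
      fix \<xi> assume \<xi>: "\<xi> \<in> topspace (subtopology (higson_corona M d) ?\<Omega>)"
      have "((\<lambda>\<xi>. \<xi> (higson_class M d f)) \<longlongrightarrow> \<xi> (higson_class M d f))
          (atin (subtopology (higson_corona M d) ?\<Omega>) \<xi>)" if "f \<in> higson_functions M d" for f
        using continuous_map_from_subtopology[OF dom.continuous_map_higson_corona_eval[OF that]] \<xi>
        unfolding continuous_map_atin limitin_canonical_iff by blast
      then show "limitin euclidean
         (\<lambda>\<xi>. \<xi> (higson_class M d (\<lambda>x\<in>M. \<psi> x * cod.higson_rep a (\<phi> x))) / \<xi> (higson_class M d \<psi>))
         (\<xi> (higson_class M d (\<lambda>x\<in>M. \<psi> x * cod.higson_rep a (\<phi> x))) / \<xi> (higson_class M d \<psi>))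
         (atin (subtopology (higson_corona M d) ?\<Omega>) \<xi>)"
        using \<xi> cod.higson_rep(1)[OF a] unfolding limitin_canonical_iff
        by (intro tendsto_divide) (auto intro: pull_higson weight)
    qed
    then show "continuous_map (subtopology (higson_corona M d) ?\<Omega>) euclidean (\<lambda>\<xi>. push_char \<xi> a)"
      using a by (simp add: push_char_def)
  qed (auto simp: push_char_def)
  show "push_char \<in> topspace (subtopology (higson_corona M d) ?\<Omega>) \<rightarrow> higson_characters M' d'"
    using push_char_in_characters by auto
qed

end

text \<open>Both conditions are multiplied by \<open>\<psi>\<close>, because the maps are related to
  each other only where \<open>\<psi>\<close> is nonzero, and even there only up to functions that
  vanish at infinity.\<close>

locale higson_partial_equivalence =
  fwd: higson_pullback M d M' d' \<psi> \<phi> + bwd: higson_pullback M' d' M d \<psi>' \<phi>'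
  for M :: "'a set" and d and M' :: "'b set" and d' \<psi> \<phi> \<psi>' \<phi>' +
  assumes weights: "(\<lambda>x\<in>M. \<psi> x * (\<psi>' (\<phi> x) - \<psi> x)) \<in> bounded_vanishing_functions M d"
    and inverse: "f \<in> higson_functions M d \<Longrightarrow>
      (\<lambda>x\<in>M. \<psi> x * (f (\<phi>' (\<phi> x)) - f x)) \<in> bounded_vanishing_functions M d"
begin

text \<open>Modulo vanishing functions, \<open>\<psi>\<close> times the composite
  \<open>\<psi>' (\<phi> x)\<close> is the square of \<open>\<psi>\<close>. In particular the image
  character is nonzero on \<open>\<psi>'\<close>, so the backward map applies to it.\<close>

lemma push_char_weight:
  assumes \<xi>: "\<xi> \<in> higson_characters M d" and nz: "\<xi> (higson_class M d \<psi>) \<noteq> 0"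
  shows "fwd.push_char \<xi> (higson_class M' d' \<psi>') = \<xi> (higson_class M d \<psi>)"
proof -
  have "(\<lambda>x\<in>M. (\<lambda>x\<in>M. \<psi> x * \<psi>' (\<phi> x)) x - (\<lambda>x\<in>M. \<psi> x * \<psi> x) x) = (\<lambda>x\<in>M. \<psi> x * (\<psi>' (\<phi> x) - \<psi> x))"
    by (auto simp: algebra_simps)
  then have "\<xi> (higson_class M d (\<lambda>x\<in>M. \<psi> x * \<psi>' (\<phi> x))) = \<xi> (higson_class M d (\<lambda>x\<in>M. \<psi> x * \<psi> x))"
    using weights
    by (intro fwd.dom.char_eq[OF \<xi>] fwd.pull_higson bwd.weight fwd.dom.higson_mult fwd.weight) simp
  also have "\<dots> = \<xi> (higson_class M d \<psi>) * \<xi> (higson_class M d \<psi>)"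
    using fwd.dom.char_mult[OF \<xi> fwd.weight fwd.weight] .
  finally show ?thesis
    using nz by (simp add: fwd.push_char_class[OF \<xi> bwd.weight])
qed

text \<open>Pulling \<open>f\<close> back to \<open>M'\<close> and then to \<open>M\<close> amounts
  to multiplying it by \<open>?w\<close>, on which \<open>\<xi>\<close> is the square of its value
  at \<open>\<psi>\<close>; the two divisions remove exactly this factor.\<close>

lemma push_char_inverse:
  assumes \<xi>: "\<xi> \<in> higson_characters M d" and nz: "\<xi> (higson_class M d \<psi>) \<noteq> 0"
  shows "bwd.push_char (fwd.push_char \<xi>) = \<xi>"
proof (rule extensionalityI[of _ "higson_quotient M d"])
  show "bwd.push_char (fwd.push_char \<xi>) \<in> extensional (higson_quotient M d)"
    by (simp add: bwd.push_char_def)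
  show "\<xi> \<in> extensional (higson_quotient M d)" using \<xi> by (simp add: higson_characters_def)
  fix a assume "a \<in> higson_quotient M d"
  then obtain f where f: "f \<in> higson_functions M d" "a = higson_class M d f"
    by (auto simp: higson_quotient_def)
  let ?w = "\<lambda>x\<in>M. \<psi> x * \<psi>' (\<phi> x)"
  define g where "g = (\<lambda>y\<in>M'. \<psi>' y * f (\<phi>' y))"
  have g: "g \<in> higson_functions M' d'" unfolding g_def using bwd.pull_higson[OF f(1)] .
  have w: "?w \<in> higson_functions M d" using fwd.pull_higson[OF bwd.weight] .
  obtain K where K: "\<And>y. y \<in> M' \<Longrightarrow> cmod (\<psi>' y) \<le> K"
    using fwd.cod.higson_functions_bound[OF bwd.weight] by metis
  have "(\<lambda>x\<in>M. (\<lambda>x\<in>M. \<psi> x * g (\<phi> x)) x - (\<lambda>x\<in>M. ?w x * f x) x) =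
     (\<lambda>x\<in>M. \<psi> x * (f (\<phi>' (\<phi> x)) - f x) * \<psi>' (\<phi> x))"
    using fwd.map_in by (auto simp: g_def algebra_simps)
  moreover have "\<dots> \<in> bounded_vanishing_functions M d"
    using fwd.dom.bounded_vanishing_mult[OF inverse[OF f(1)], of "\<lambda>x. \<psi>' (\<phi> x)" K] K fwd.map_in by auto
  ultimately have "\<xi> (higson_class M d (\<lambda>x\<in>M. \<psi> x * g (\<phi> x))) = \<xi> (higson_class M d (\<lambda>x\<in>M. ?w x * f x))"
    by (intro fwd.dom.char_eq[OF \<xi>] fwd.pull_higson[OF g] fwd.dom.higson_mult[OF w f(1)]) simp
  also have "\<dots> = \<xi> (higson_class M d ?w) * \<xi> a"
    using fwd.dom.char_mult[OF \<xi> w f(1)] f(2) by simp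
  finally have eq: "\<xi> (higson_class M d (\<lambda>x\<in>M. \<psi> x * g (\<phi> x))) = \<xi> (higson_class M d ?w) * \<xi> a" .
  have w_eq: "\<xi> (higson_class M d ?w) = \<xi> (higson_class M d \<psi>) * \<xi> (higson_class M d \<psi>)"
    using push_char_weight[OF \<xi> nz] nz fwd.push_char_class[OF \<xi> bwd.weight] by (simp add: field_simps)
  have "bwd.push_char (fwd.push_char \<xi>) a =
      fwd.push_char \<xi> (higson_class M' d' g) / fwd.push_char \<xi> (higson_class M' d' \<psi>')"
    unfolding f(2) g_def by (rule bwd.push_char_class[OF fwd.push_char_in_characters[OF \<xi> nz] f(1)])
  also have "\<dots> = \<xi> (higson_class M d \<psi>) * \<xi> (higson_class M d \<psi>) * \<xi> a /
      \<xi> (higson_class M d \<psi>) / \<xi> (higson_class M d \<psi>)"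
    by (simp only: fwd.push_char_class[OF \<xi> g] push_char_weight[OF \<xi> nz] eq w_eq)
  also have "\<dots> = \<xi> a" using nz by simp
  finally show "bwd.push_char (fwd.push_char \<xi>) a = \<xi> a" .
qed

end

proposition higson_partial_equivalence_homeomorphic:
  assumes "higson_partial_equivalence M d M' d' \<psi> \<phi> \<psi>' \<phi>'"
    and "higson_partial_equivalence M' d' M d \<psi>' \<phi>' \<psi> \<phi>"
  shows "subtopology (higson_corona M d) {\<xi> \<in> higson_characters M d. \<xi> (higson_class M d \<psi>) \<noteq> 0}
    homeomorphic_space
    subtopology (higson_corona M' d') {\<xi> \<in> higson_characters M' d'. \<xi> (higson_class M' d' \<psi>') \<noteq> 0}"
    (is "subtopology _ ?\<Omega> homeomorphic_space subtopology _ ?\<Omega>'")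
proof -
  interpret a: higson_partial_equivalence M d M' d' \<psi> \<phi> \<psi>' \<phi>' by fact
  interpret b: higson_partial_equivalence M' d' M d \<psi>' \<phi>' \<psi> \<phi> by fact
  have "homeomorphic_maps (subtopology (higson_corona M d) ?\<Omega>) (subtopology (higson_corona M' d') ?\<Omega>')
      a.fwd.push_char a.bwd.push_char"
    unfolding homeomorphic_maps_def
  proof (intro conjI ballI continuous_map_into_subtopology
      a.fwd.continuous_map_push_char a.bwd.continuous_map_push_char)
    show "a.fwd.push_char \<in> topspace (subtopology (higson_corona M d) ?\<Omega>) \<rightarrow> ?\<Omega>'"
      using a.fwd.push_char_in_characters a.push_char_weight by auto
    show "a.bwd.push_char \<in> topspace (subtopology (higson_corona M' d') ?\<Omega>') \<rightarrow> ?\<Omega>"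
      using a.bwd.push_char_in_characters b.push_char_weight by auto
  qed (auto simp: a.push_char_inverse b.push_char_inverse)
  then show ?thesis by (auto simp: homeomorphic_space_def)
qed

section \<open>Coronas sharing large balls\<close>

text \<open>The bump around \<open>c k\<close> has radius \<open>k + 1\<close>. The larger disjoint
  balls of radius \<open>4 * (k + 1)\<close> leave room for displacements by a fixed amount, which
  is at most \<open>k\<close> once the index is large.\<close>

locale sparse_centers = Metric_space M d for M :: "'a set" and d +
  fixes c :: "nat \<Rightarrow> 'a"
  assumes center_in: "c k \<in> M"
    and center_sep: "j \<noteq> k \<Longrightarrow> 4 * (real j + 1) + 4 * (real k + 1) \<le> d (c j) (c k)"
begin

text \<open>A junk value away from the balls of radius \<open>4 (k + 1)\<close>, where \<open>bump\<close> vanishes anyway. The slope of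
  \<open>bump\<close> near the \<open>k\<close>-th center is \<open>1 / (k + 1)\<close>, so it is a Higson function.\<close>

definition idx :: "'a \<Rightarrow> nat" where
  "idx y = (SOME k. d (c k) y < 4 * (real k + 1))"

lemma idx_eq:
  assumes "y \<in> M" "d (c k) y < 4 * (real k + 1)"
  shows "idx y = k"
  unfolding idx_def
proof (rule some_equality)
  fix j assume j: "d (c j) y < 4 * (real j + 1)"
  show "j = k"
    using center_sep[of j k] triangle[of "c j" y "c k"] center_in assms j commute[of "c k" y]
    by fastforce
qed (use assms in simp)

definition bump :: "'a \<Rightarrow> complex" where
  "bump = (\<lambda>y\<in>M. of_real (max 0 (1 - d (c (idx y)) y / (real (idx y) + 1))))"

lemma bump_near:
  assumes "y \<in> M" "d (c k) y < 4 * (real k + 1)"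
  shows "bump y = of_real (max 0 (1 - d (c k) y / (real k + 1)))"
  using assms idx_eq[OF assms] by (simp add: bump_def)

lemma bump_nonzeroD:
  assumes "y \<in> M" "bump y \<noteq> 0"
  obtains k where "d (c k) y < real k + 1"
proof
  have "0 < 1 - d (c (idx y)) y / (real (idx y) + 1)"
    using assms by (auto simp: bump_def max_def split: if_splits)
  then show "d (c (idx y)) y < real (idx y) + 1"
    by (simp add: field_simps)
qed

lemma bump_center: "bump (c k) = 1"
  using bump_near[of "c k" k] center_in by simp

lemma norm_bump_le: "y \<in> M \<Longrightarrow> cmod (bump y) \<le> 1"
  by (auto simp: bump_def max_def)

text \<open>The finitely many balls of index below \<open>J\<close> have bounded union. Being far
  out thus becomes a lower bound on the index, which makes quantities of order
  \<open>1 / (k + 1)\<close> small.\<close>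

lemma eventually_far_from_centers:
  "eventually (\<lambda>y. y \<in> M \<and> (\<forall>k. d (c k) y < 4 * (real k + 1) + \<rho> \<longrightarrow> J \<le> k)) far"
proof -
  have "mbounded (\<Union>k\<in>{..<J}. mball (c k) (4 * (real k + 1) + \<rho>))"
    by (intro mbounded_Union) auto
  from eventually_far_not_in[OF this] show ?thesis
    by eventually_elim (use center_in in \<open>auto simp: not_le[symmetric]\<close>)
qed

text \<open>Already the separation from \<open>c 0\<close> grows with \<open>k\<close>, so a bounded
  set contains only finitely many centers.\<close>

lemma filterlim_centers: "filterlim c far sequentially"
  unfolding filterlim_iff
proof (intro allI impI)
  fix P assume "eventually P far"
  then obtain B where B: "mbounded B" "\<And>y. y \<in> M - B \<Longrightarrow> P y" by (auto simp: eventually_far)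
  obtain p r where p: "B \<subseteq> mcball p r" using B(1) by (auto simp: mbounded_def)
  have "c k \<notin> B" if k: "k \<ge> nat \<lceil>r + d p (c 0)\<rceil> + 1" for k
  proof
    assume "c k \<in> B"
    then have "p \<in> M" "d p (c k) \<le> r" using p by auto
    moreover have "real k > r + d p (c 0)" using k by linarith
    ultimately show False
      using triangle[of "c 0" p "c k"] center_in center_sep[of 0 k] k commute[of p "c 0"] by force
  qed
  then show "eventually (\<lambda>k. P (c k)) sequentially"
    using B(2) center_in unfolding eventually_sequentially by blast
qed

lemma bump_higson: "bump \<in> higson_functions M d"
proof (rule higson_functionsI[where K = 1])
  fix R \<epsilon> :: real assume R: "R > 0" and \<epsilon>: "\<epsilon> > 0"
  \<comment> \<open>The first bound keeps a pair at distance less than \<open>R\<close> in one large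
    ball; the second makes the slope \<open>1 / (k + 1)\<close> times \<open>R\<close> smaller than
    \<open>\<epsilon>\<close>.\<close>
  obtain J :: nat where J: "R \<le> real J" "R / \<epsilon> < real J + 1"
    using real_arch_simple[of "max R (R / \<epsilon>)"] by force
  show "eventually (\<lambda>a. \<forall>b\<in>M. d a b < R \<longrightarrow> cmod (bump a - bump b) < \<epsilon>) far"
    using eventually_far_from_centers[of R J]
  proof eventually_elim
    case (elim a)
    show ?case
    proof (intro ballI impI)
      fix b assume b: "b \<in> M" "d a b < R"
      show "cmod (bump a - bump b) < \<epsilon>"
      proof (cases "bump a = 0 \<and> bump b = 0")
        case False
        then obtain k where k: "d (c k) a < real k + 1 \<or> d (c k) b < real k + 1"
          using bump_nonzeroD elim b(1) by metis
        have ab: "d (c k) b < d (c k) a + R" "d (c k) a < d (c k) b + R"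
          using triangle[of "c k" a b] triangle[of "c k" b a] center_in[of k] elim b commute[of a b]
          by auto
        then have "d (c k) a < 4 * (real k + 1) + R" using k by auto
        then have Jk: "real J \<le> real k" using elim by auto
        have near: "d (c k) a < 4 * (real k + 1)" "d (c k) b < 4 * (real k + 1)"
          using k ab J Jk by auto
        have "bump a - bump b = of_real (max 0 (1 - d (c k) a / (real k + 1)) - max 0 (1 - d (c k) b / (real k + 1)))"
          using bump_near near elim b(1) by simp
        then have "cmod (bump a - bump b) =
            \<bar>max 0 (1 - d (c k) a / (real k + 1)) - max 0 (1 - d (c k) b / (real k + 1))\<bar>"
          by (simp only: norm_of_real)
        also have "\<dots> \<le> \<bar>d (c k) a / (real k + 1) - d (c k) b / (real k + 1)\<bar>"
          by linarith
        also have "\<dots> = \<bar>d (c k) a - d (c k) b\<bar> / (real k + 1)"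
          by (simp flip: diff_divide_distrib)
        also have "\<dots> \<le> R / (real k + 1)"
          using ab by (intro divide_right_mono) auto
        also have "\<dots> < \<epsilon>"
        proof -
          have "R / \<epsilon> < real k + 1" using J Jk by linarith
          then show ?thesis using \<epsilon> by (simp add: field_simps)
        qed
        finally show ?thesis .
      qed (use \<epsilon> in simp)
    qed
  qed
qed (auto simp: norm_bump_le, simp add: bump_def)

text \<open>The bump is \<open>1\<close> at every center, so a character obtained along the centers
  takes the value \<open>1\<close> on it.\<close>

lemma nonempty_bump_characters: "{\<xi> \<in> higson_characters M d. \<xi> (higson_class M d bump) \<noteq> 0} \<noteq> {}"
proof -
  obtain \<xi> where "\<xi> \<in> higson_characters M d" "\<xi> (higson_class M d bump) = 1"
    using character_along_sequence[OF filterlim_centers] bump_higson bump_center by metis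
  then show ?thesis by auto
qed

end

section \<open>Choice of the centers\<close>

context Metric_space
begin

lemma openin_nonvanishing_characters:
  assumes "f \<in> higson_functions M d"
  shows "openin (higson_corona M d) {\<xi> \<in> higson_characters M d. \<xi> (higson_class M d f) \<noteq> 0}"
  using openin_continuous_map_preimage[OF continuous_map_higson_corona_eval[OF assms], of "-{0}"]
  by (simp add: topspace_higson_corona open_Compl)

text \<open>A greedy choice: at each stage the earlier centers exclude only a bounded set.\<close>

lemma sparse_centers_exist:
  assumes "\<And>k B. mbounded B \<Longrightarrow> \<exists>x\<in>M - B. Q k x"
  obtains c where "sparse_centers M d c" "\<And>k. Q k (c k)"
proof -
  define P where "P f k x \<longleftrightarrow> x \<in> M \<and> Q k x \<and>
      (\<forall>j<k. 4 * (real j + 1) + 4 * (real k + 1) \<le> d (f j) x)" for f k x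
  have "\<exists>c. \<forall>k. P c k (c k)"
  proof (rule dependent_wf_choice[of less_than])
    fix f k assume f: "\<And>j. (j, k) \<in> less_than \<Longrightarrow> P f j (f j)"
    have "mbounded (\<Union>j\<in>{..<k}. mball (f j) (4 * (real j + 1) + 4 * (real k + 1)))"
      by (intro mbounded_Union) auto
    from assms[OF this, of k] obtain x where x: "x \<in> M" "Q k x"
      "\<And>j. j < k \<Longrightarrow> x \<notin> mball (f j) (4 * (real j + 1) + 4 * (real k + 1))"
      by auto
    have "4 * (real j + 1) + 4 * (real k + 1) \<le> d (f j) x" if "j < k" for j
    proof -
      have "f j \<in> M" using f[of j] that by (simp add: P_def)
      then show ?thesis using x(1) x(3)[OF that] by simp
    qed
    then show "\<exists>x. P f k x" using x unfolding P_def by blast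
  qed (auto simp: P_def)
  then obtain c where c: "\<And>k. P c k (c k)" by auto
  have "sparse_centers M d c"
  proof
    show "c k \<in> M" for k using c by (simp add: P_def)
    show "4 * (real j + 1) + 4 * (real k + 1) \<le> d (c j) (c k)" if "j \<noteq> k" for j k
    proof (cases "j < k")
      case True
      then show ?thesis using c[of k] by (simp add: P_def)
    next
      case False
      then have "4 * (real k + 1) + 4 * (real j + 1) \<le> d (c k) (c j)"
        using c[of j] that by (simp add: P_def)
      then show ?thesis by (simp add: commute add.commute)
    qed
  qed
  then show ?thesis using that c by (auto simp: P_def)
qed

end

text \<open>Relations rather than maps, because plaques and not points will be matched, and because
  the reverse direction is then given by the converse relations.\<close>

locale center_correspondence =
  dom: sparse_centers M d c + cod: sparse_centers M' d' c'
  for M :: "'a set" and d c and M' :: "'b set" and d' c' +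
  fixes \<R> :: "nat \<Rightarrow> ('a \<times> 'b) set" and C :: real
  assumes corr_sub: "\<R> k \<subseteq> M \<times> M'"
    and corr_center: "(c k, c' k) \<in> \<R> k"
    and corr_total: "a \<in> M \<Longrightarrow> d (c k) a < 4 * (real k + 1) \<Longrightarrow> \<exists>a'. (a, a') \<in> \<R> k"
    and corr_dist: "(a, a') \<in> \<R> k \<Longrightarrow> (b, b') \<in> \<R> k \<Longrightarrow> \<bar>d a b - d' a' b'\<bar> \<le> C"
begin

text \<open>The default \<open>c' 0\<close> only makes the map total with values in
  \<open>M'\<close>: where the bump is nonzero, \<open>corr_total\<close> supplies a
  partner.\<close>

definition transfer :: "'a \<Rightarrow> 'b" where
  "transfer a = (if \<exists>a'. (a, a') \<in> \<R> (dom.idx a) then SOME a'. (a, a') \<in> \<R> (dom.idx a) else c' 0)"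

lemma transfer_in: "transfer a \<in> M'"
proof (cases "\<exists>a'. (a, a') \<in> \<R> (dom.idx a)")
  case True
  then have "(a, transfer a) \<in> \<R> (dom.idx a)"
    unfolding transfer_def using someI_ex[OF True] by simp
  then show ?thesis using corr_sub by blast
qed (simp add: transfer_def cod.center_in)

lemma transfer_corr:
  assumes "a \<in> M" "d (c k) a < 4 * (real k + 1)"
  shows "(a, transfer a) \<in> \<R> k"
proof -
  have ex: "\<exists>a'. (a, a') \<in> \<R> k" using corr_total[OF assms] .
  then show ?thesis
    using dom.idx_eq[OF assms] someI_ex[OF ex] by (simp add: transfer_def)
qed

lemma C_nonneg: "C \<ge> 0"
  using corr_dist[OF corr_center corr_center, of 0] by simp

lemma transfer_near_center:
  assumes "a \<in> M" "d (c k) a < 4 * (real k + 1)"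
  shows "\<bar>d (c k) a - d' (c' k) (transfer a)\<bar> \<le> C"
  using corr_dist[OF corr_center transfer_corr[OF assms]] .

text \<open>Where the \<open>k\<close>-th bump lives, images are within \<open>k + 1 + C\<close> of
  \<open>c' k\<close>, whereas \<open>c' k\<close> is more than \<open>4 * (k + 1)\<close> away from
  \<open>c' 0\<close>. For large \<open>k\<close> no image can lie in a given bounded set.\<close>

lemma eventually_transfer_far:
  assumes "eventually Q cod.far"
  shows "eventually (\<lambda>a. dom.bump a \<noteq> 0 \<longrightarrow> Q (transfer a)) dom.far"
proof -
  obtain B where B: "cod.mbounded B" "\<And>y. y \<in> M' - B \<Longrightarrow> Q y"
    using assms by (auto simp: cod.eventually_far)
  obtain p r where p: "B \<subseteq> cod.mcball p r" using B(1) by (auto simp: cod.mbounded_def)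
  obtain J :: nat where J: "d' (c' 0) p + r + C \<le> real J"
    using real_arch_simple by blast
  show ?thesis
    \<comment> \<open>The successor also excludes index \<open>0\<close>, so that
      \<open>c' 0\<close> and \<open>c' k\<close> are different centers and the separation
      applies.\<close>
    using dom.eventually_far_from_centers[of 0 "Suc J"]
  proof eventually_elim
    case (elim a)
    show ?case
    proof
      assume "dom.bump a \<noteq> 0"
      then obtain k where k: "d (c k) a < real k + 1"
        using dom.bump_nonzeroD elim by metis
      then have near: "d (c k) a < 4 * (real k + 1)" by auto
      then have Jk: "Suc J \<le> k" using elim by auto
      have far: "d' (c' k) (transfer a) < real k + 1 + C"
        using transfer_near_center[OF _ near] elim k by auto
      have "transfer a \<notin> B"
      proof
        assume "transfer a \<in> B"
        then have pM: "p \<in> M'" "d' p (transfer a) \<le> r" using p by auto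
        have "d' (c' 0) (c' k) \<le> d' (c' 0) p + d' p (transfer a) + d' (transfer a) (c' k)"
          using cod.triangle[of "c' 0" p "c' k"] cod.triangle[of p "transfer a" "c' k"]
            pM(1) transfer_in cod.center_in by force
        moreover have "4 * (real 0 + 1) + 4 * (real k + 1) \<le> d' (c' 0) (c' k)"
          using cod.center_sep[of 0 k] Jk by simp
        ultimately show False
          using pM(2) far J Jk cod.commute[of "c' k" "transfer a"] by simp
      qed
      then show "Q (transfer a)" using B(2) transfer_in by auto
    qed
  qed
qed

lemma pull_vanishing:
  assumes "f \<in> bounded_vanishing_functions M' d'"
  shows "(\<lambda>x\<in>M. dom.bump x * f (transfer x)) \<in> bounded_vanishing_functions M d"
  unfolding dom.bounded_vanishing_restrict_iff
proof
  have f: "bounded (f ` M')" "(f \<longlongrightarrow> 0) cod.far"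
    using assms by (auto simp: cod.bounded_vanishing_iff)
  then obtain K where K: "\<And>y. y \<in> M' \<Longrightarrow> cmod (f y) \<le> K" by (auto simp: bounded_iff)
  have le: "cmod (dom.bump x * f (transfer x)) \<le> cmod (f (transfer x))" if "x \<in> M" for x
    using dom.norm_bump_le[OF that] by (simp add: norm_mult mult_left_le_one_le)
  then have "cmod (dom.bump x * f (transfer x)) \<le> K" if "x \<in> M" for x
    using K[OF transfer_in] that by (meson order_trans)
  then show "bounded ((\<lambda>x. dom.bump x * f (transfer x)) ` M)"
    by (auto simp: bounded_iff)
  show "((\<lambda>x. dom.bump x * f (transfer x)) \<longlongrightarrow> 0) dom.far"
    unfolding tendsto_iff
  proof (intro allI impI)
    fix \<epsilon> :: real assume "\<epsilon> > 0"
    then have "eventually (\<lambda>y. cmod (f y) < \<epsilon>) cod.far" using f(2) by (auto simp: tendsto_iff)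
    from eventually_transfer_far[OF this] dom.eventually_far_in_space
    show "eventually (\<lambda>x. dist (dom.bump x * f (transfer x)) 0 < \<epsilon>) dom.far"
    proof eventually_elim
      case (elim x)
      then show ?case using le[of x] \<open>\<epsilon> > 0\<close> by (cases "dom.bump x = 0") auto
    qed
  qed
qed

text \<open>Split the difference as in the product rule. The bump varies slowly while
  \<open>f\<close> is bounded. Where the bump is nonzero at \<open>a\<close>, far out, both points
  lie in one large ball, so their images are less than \<open>R + C + 1\<close> apart and
  \<open>f\<close> varies slowly between them.\<close>

lemma pull_higson:
  assumes f: "f \<in> higson_functions M' d'"
  shows "(\<lambda>x\<in>M. dom.bump x * f (transfer x)) \<in> higson_functions M d"
proof -
  obtain K where K: "K > 0" "\<And>y. y \<in> M' \<Longrightarrow> cmod (f y) \<le> K"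
    using cod.higson_functions_bound[OF f] by blast
  show ?thesis
  proof (rule dom.higson_functionsI)
    show "cmod ((\<lambda>x\<in>M. dom.bump x * f (transfer x)) a) \<le> 1 * K" if "a \<in> M" for a
    proof -
      have "cmod (dom.bump a) * cmod (f (transfer a)) \<le> 1 * K"
        using that by (intro mult_mono dom.norm_bump_le K(2) transfer_in) auto
      then show ?thesis using that by (simp add: norm_mult)
    qed
  next
    fix R \<epsilon> :: real assume R: "R > 0" "\<epsilon> > 0"
    obtain J :: nat where J: "R \<le> real J" using real_arch_simple by blast
    have small: "eventually (\<lambda>y. \<forall>z\<in>M'. d' y z < R + C + 1 \<longrightarrow> cmod (f y - f z) < \<epsilon> / 2) cod.far"
      using R C_nonneg by (intro cod.higson_functionsD[OF f]) auto
    have pos: "\<epsilon> / (2 * K) > 0" using R K by simp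
    from eventually_transfer_far[OF small] dom.higson_functionsD[OF dom.bump_higson R(1) pos]
      dom.eventually_far_from_centers[of 0 J]
    show "eventually (\<lambda>a. \<forall>b\<in>M. d a b < R \<longrightarrow>
      cmod ((\<lambda>x\<in>M. dom.bump x * f (transfer x)) a - (\<lambda>x\<in>M. dom.bump x * f (transfer x)) b) < \<epsilon>) dom.far"
    proof eventually_elim
      case (elim a)
      show ?case
      proof (intro ballI impI)
        fix b assume b: "b \<in> M" "d a b < R"
        have 1: "cmod ((dom.bump a - dom.bump b) * f (transfer b)) < \<epsilon> / 2"
        proof -
          have "cmod ((dom.bump a - dom.bump b) * f (transfer b)) \<le> cmod (dom.bump a - dom.bump b) * K"
            using K(2)[OF transfer_in, of b] by (simp add: norm_mult mult_left_mono)
          also have "\<dots> < \<epsilon> / (2 * K) * K"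
            using elim b K(1) by (intro mult_strict_right_mono) auto
          also have "\<dots> = \<epsilon> / 2" using K(1) by simp
          finally show ?thesis .
        qed
        have 2: "cmod (dom.bump a * (f (transfer a) - f (transfer b))) < \<epsilon> / 2"
        proof (cases "dom.bump a = 0")
          case False
          then obtain k where k: "d (c k) a < real k + 1"
            using dom.bump_nonzeroD elim by metis
          then have near: "d (c k) a < 4 * (real k + 1)" by auto
          then have "real J \<le> real k" using elim by auto
          moreover have "d (c k) b \<le> d (c k) a + d a b"
            using dom.triangle[of "c k" a b] dom.center_in[of k] elim b by auto
          ultimately have "d (c k) b < 4 * (real k + 1)" 
            using b(2) k J of_nat_0_le_iff[of k, where 'a = real] by argo
          then have "\<bar>d a b - d' (transfer a) (transfer b)\<bar> \<le> C"
            using corr_dist transfer_corr near elim b(1) by blast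
          then have "d' (transfer a) (transfer b) < R + C + 1" using b(2) by auto
          then have lt: "cmod (f (transfer a) - f (transfer b)) < \<epsilon> / 2"
            using elim False transfer_in by blast
          have "cmod (dom.bump a * (f (transfer a) - f (transfer b))) \<le> cmod (f (transfer a) - f (transfer b))"
            using dom.norm_bump_le[of a] elim by (simp add: norm_mult mult_left_le_one_le)
          then show ?thesis using lt by simp
        qed (use R in simp)
        have "(\<lambda>x\<in>M. dom.bump x * f (transfer x)) a - (\<lambda>x\<in>M. dom.bump x * f (transfer x)) b =
          dom.bump a * (f (transfer a) - f (transfer b)) + (dom.bump a - dom.bump b) * f (transfer b)"
          using elim b by (simp add: algebra_simps)
        then have "cmod ((\<lambda>x\<in>M. dom.bump x * f (transfer x)) a - (\<lambda>x\<in>M. dom.bump x * f (transfer x)) b) \<le>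
          cmod (dom.bump a * (f (transfer a) - f (transfer b))) + cmod ((dom.bump a - dom.bump b) * f (transfer b))"
          by (simp only: norm_triangle_ineq)
        then show "cmod ((\<lambda>x\<in>M. dom.bump x * f (transfer x)) a - (\<lambda>x\<in>M. dom.bump x * f (transfer x)) b) < \<epsilon>"
          using 1 2 by linarith
      qed
    qed
  qed simp
qed

sublocale higson_pullback M d M' d' dom.bump transfer
  by unfold_locales (auto intro: dom.bump_higson transfer_in pull_higson pull_vanishing)

text \<open>\<open>transfer\<close> changes the distance to the center by at most \<open>C\<close>,
  hence the value of the \<open>k\<close>-th bump by at most \<open>C / (k + 1)\<close>.\<close>

lemma weights_agree:
  "(\<lambda>x\<in>M. dom.bump x * (cod.bump (transfer x) - dom.bump x)) \<in> bounded_vanishing_functions M d"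
  unfolding dom.bounded_vanishing_restrict_iff
proof
  have "cmod (dom.bump x * (cod.bump (transfer x) - dom.bump x)) \<le> 1 * (1 + 1)" if "x \<in> M" for x
    unfolding norm_mult using dom.norm_bump_le[OF that] cod.norm_bump_le[OF transfer_in, of x]
      norm_triangle_ineq4[of "cod.bump (transfer x)" "dom.bump x"]
    by (intro mult_mono) auto
  then show "bounded ((\<lambda>x. dom.bump x * (cod.bump (transfer x) - dom.bump x)) ` M)"
    unfolding bounded_iff by blast
  show "((\<lambda>x. dom.bump x * (cod.bump (transfer x) - dom.bump x)) \<longlongrightarrow> 0) dom.far"
    unfolding tendsto_iff
  proof (intro allI impI)
    fix \<epsilon> :: real assume \<epsilon>: "\<epsilon> > 0"
    obtain J :: nat where J: "C \<le> real J" "C / \<epsilon> < real J + 1"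
      using real_arch_simple[of "max C (C / \<epsilon>)"] by force
    show "eventually (\<lambda>x. dist (dom.bump x * (cod.bump (transfer x) - dom.bump x)) 0 < \<epsilon>) dom.far"
      using dom.eventually_far_from_centers[of 0 J]
    proof eventually_elim
      case (elim x)
      show ?case
      proof (cases "dom.bump x = 0")
        case False
        then obtain k where k: "d (c k) x < real k + 1"
          using dom.bump_nonzeroD elim by metis
        then have near: "d (c k) x < 4 * (real k + 1)" by auto
        then have Jk: "real J \<le> real k" using elim by auto
        have C: "\<bar>d (c k) x - d' (c' k) (transfer x)\<bar> \<le> C"
          using transfer_near_center near elim by blast
        then have near': "d' (c' k) (transfer x) < 4 * (real k + 1)"
          using k J Jk by auto
        have "cod.bump (transfer x) - dom.bump x =
          of_real (max 0 (1 - d' (c' k) (transfer x) / (real k + 1)) - max 0 (1 - d (c k) x / (real k + 1)))"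
          using dom.bump_near near cod.bump_near near' transfer_in elim by simp
        then have "cmod (cod.bump (transfer x) - dom.bump x) =
          \<bar>max 0 (1 - d' (c' k) (transfer x) / (real k + 1)) - max 0 (1 - d (c k) x / (real k + 1))\<bar>"
          by (simp only: norm_of_real)
        also have "\<dots> \<le> \<bar>d (c k) x / (real k + 1) - d' (c' k) (transfer x) / (real k + 1)\<bar>"
          by linarith
        also have "\<dots> = \<bar>d (c k) x - d' (c' k) (transfer x)\<bar> / (real k + 1)"
          by (simp flip: diff_divide_distrib)
        also have "\<dots> \<le> C / (real k + 1)"
          using C by (intro divide_right_mono) auto
        also have "\<dots> < \<epsilon>"
        proof -
          have "C / \<epsilon> < real k + 1" using J Jk by linarith
          then show ?thesis using \<epsilon> by (simp add: field_simps)
        qed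
        finally have "cmod (cod.bump (transfer x) - dom.bump x) < \<epsilon>" .
        moreover have "cmod (dom.bump x * (cod.bump (transfer x) - dom.bump x)) \<le>
            cmod (cod.bump (transfer x) - dom.bump x)"
          using dom.norm_bump_le[of x] elim by (simp add: norm_mult mult_left_le_one_le)
        ultimately show ?thesis by simp
      qed (use \<epsilon> in simp)
    qed
  qed
qed

end

text \<open>A point and its image under both transfers are related to the same point of
  \<open>M'\<close>, so they are within \<open>C\<close> of each other, and a Higson function hardly
  separates them far out.\<close>

lemma center_correspondence_equivalence:
  assumes "center_correspondence M d c M' d' c' \<R> C"
    and "center_correspondence M' d' c' M d c (\<lambda>k. (\<R> k)\<inverse>) C"
  shows "higson_partial_equivalence M d M' d'
    (sparse_centers.bump M d c) (center_correspondence.transfer d c c' \<R>)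
    (sparse_centers.bump M' d' c') (center_correspondence.transfer d' c' c (\<lambda>k. (\<R> k)\<inverse>))"
proof -
  interpret F: center_correspondence M d c M' d' c' \<R> C by fact
  interpret G: center_correspondence M' d' c' M d c "\<lambda>k. (\<R> k)\<inverse>" C by fact
  show ?thesis
  proof (unfold_locales, goal_cases)
    case 1
    show ?case by (rule F.weights_agree)
  next
    case (2 f)
    obtain K where K: "\<And>y. y \<in> M \<Longrightarrow> cmod (f y) \<le> K"
      using F.dom.higson_functions_bound[OF 2] by metis
    show ?case
      unfolding F.dom.bounded_vanishing_restrict_iff
    proof
      have "cmod (F.dom.bump x * (f (G.transfer (F.transfer x)) - f x)) \<le> 1 * (K + K)" if "x \<in> M" for x
        unfolding norm_mult using F.dom.norm_bump_le[OF that]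
        by (intro mult_mono order_trans[OF norm_triangle_ineq4] add_mono K that G.transfer_in) auto
      then show "bounded ((\<lambda>x. F.dom.bump x * (f (G.transfer (F.transfer x)) - f x)) ` M)"
        unfolding bounded_iff by blast
      show "((\<lambda>x. F.dom.bump x * (f (G.transfer (F.transfer x)) - f x)) \<longlongrightarrow> 0) F.dom.far"
        unfolding tendsto_iff
      proof (intro allI impI)
        fix \<epsilon> :: real assume \<epsilon>: "\<epsilon> > 0"
        obtain J :: nat where J: "C \<le> real J" using real_arch_simple by blast
        have "C + 1 > 0" using F.C_nonneg by simp
        from F.dom.higson_functionsD[OF 2 this \<epsilon>] F.dom.eventually_far_from_centers[of 0 J]
        show "eventually (\<lambda>x. dist (F.dom.bump x * (f (G.transfer (F.transfer x)) - f x)) 0 < \<epsilon>) F.dom.far"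
        proof eventually_elim
          case (elim x)
          show ?case
          proof (cases "F.dom.bump x = 0")
            case False
            then obtain k where k: "d (c k) x < real k + 1"
              using F.dom.bump_nonzeroD elim by metis
            then have near: "d (c k) x < 4 * (real k + 1)" by auto
            then have Jk: "real J \<le> real k" using elim by auto
            have "\<bar>d (c k) x - d' (c' k) (F.transfer x)\<bar> \<le> C"
              using F.transfer_near_center near elim by blast
            then have "d' (c' k) (F.transfer x) < 4 * (real k + 1)"
              using k J Jk by auto
            then have "(G.transfer (F.transfer x), F.transfer x) \<in> \<R> k"
              using G.transfer_corr F.transfer_in by blast
            then have "\<bar>d x (G.transfer (F.transfer x)) - d' (F.transfer x) (F.transfer x)\<bar> \<le> C"
              using F.corr_dist F.transfer_corr near elim by blast
            then have "d x (G.transfer (F.transfer x)) < C + 1"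
              using F.transfer_in by simp
            then have lt: "cmod (f x - f (G.transfer (F.transfer x))) < \<epsilon>"
              using elim G.transfer_in by blast
            have "cmod (F.dom.bump x * (f (G.transfer (F.transfer x)) - f x)) \<le>
                cmod (f (G.transfer (F.transfer x)) - f x)"
              using F.dom.norm_bump_le[of x] elim by (simp add: norm_mult mult_left_le_one_le)
            then show ?thesis using lt by (simp add: norm_minus_commute)
          qed (use \<epsilon> in simp)
        qed
      qed
    qed
  qed
qed

text \<open>A ball of radius \<open>R + (k + 1)\<close> inside \<open>S\<close> is large enough to
  contain a point of the net together with its ball of radius \<open>k + 1\<close>. The index
  \<open>4 * (k + 1)\<close> of the net is the radius on which a correspondence has to be
  total.\<close>

lemma (in Metric_space) supported_sparse_centers_exist:
  assumes net: "\<And>k. \<exists>R. \<forall>y\<in>M. \<exists>x\<in>Q k. x \<in> M \<and> d y x \<le> R"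
    and W: "openin (higson_corona M d) W" "W \<noteq> {}"
  obtains c where "sparse_centers M d c" "\<And>k. c k \<in> Q (4 * (k + 1))"
    "{\<xi> \<in> higson_characters M d. \<xi> (higson_class M d (sparse_centers.bump M d c)) \<noteq> 0} \<subseteq> W"
proof -
  obtain S where S: "\<And>\<rho> B. mbounded B \<Longrightarrow> \<exists>x\<in>M - B. mball x \<rho> \<subseteq> S"
    "\<And>\<psi> \<xi>. \<psi> \<in> higson_functions M d \<Longrightarrow> (\<And>x. x \<in> M \<Longrightarrow> \<psi> x \<noteq> 0 \<Longrightarrow> x \<in> S) \<Longrightarrow>
      \<xi> \<in> higson_characters M d \<Longrightarrow> \<xi> (higson_class M d \<psi>) \<noteq> 0 \<Longrightarrow> \<xi> \<in> W"
    using nonempty_openin_higson_corona_support[OF W] by blast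
  have "\<exists>x\<in>M - B. x \<in> Q (4 * (k + 1)) \<and> mball x (real k + 1) \<subseteq> S" if B: "mbounded B" for k B
  proof -
    obtain R where R: "\<And>y. y \<in> M \<Longrightarrow> \<exists>x\<in>Q (4 * (k + 1)). x \<in> M \<and> d y x \<le> R" using net by metis
    obtain p r where p: "B \<subseteq> mcball p r" using B by (auto simp: mbounded_def)
    obtain y where y: "y \<in> M - mcball p (r + R)" "mball y (R + (real k + 1)) \<subseteq> S"
      using S(1)[OF mbounded_mcball] by blast
    obtain x where x: "x \<in> Q (4 * (k + 1))" "x \<in> M" "d y x \<le> R" using R y(1) by blast
    have "x \<notin> B"
    proof
      assume "x \<in> B"
      then show False using p triangle[of p x y] x y(1) commute[of x y] by fastforce
    qed
    moreover have "mball x (real k + 1) \<subseteq> mball y (R + (real k + 1))"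
      using triangle[of y x] x y(1) by fastforce
    ultimately show ?thesis using x y(2) by blast
  qed
  then obtain c where c: "sparse_centers M d c" "\<And>k. c k \<in> Q (4 * (k + 1)) \<and> mball (c k) (real k + 1) \<subseteq> S"
    using sparse_centers_exist[of "\<lambda>k x. x \<in> Q (4 * (k + 1)) \<and> mball x (real k + 1) \<subseteq> S"] by metis
  interpret c: sparse_centers M d c by fact
  have "x \<in> S" if "x \<in> M" "c.bump x \<noteq> 0" for x
  proof -
    obtain k where "d (c k) x < real k + 1" using c.bump_nonzeroD[OF \<open>x \<in> M\<close> \<open>c.bump x \<noteq> 0\<close>] .
    then have "x \<in> mball (c k) (real k + 1)" using c.center_in \<open>x \<in> M\<close> by auto
    then show ?thesis using c(2) by blast
  qed
  then show ?thesis using that S(2)[OF c.bump_higson] c by blast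
qed

text \<open>The order of the quantifiers is the point: the net constant \<open>R\<close> may depend
  on \<open>k\<close>, the distortion \<open>C\<close> may not.\<close>

proposition higson_coronas_share_open_sets:
  fixes M :: "'a set" and M' :: "'b set" and C :: real
  assumes "Metric_space M d" "Metric_space M' d'"
    and net: "\<And>k. \<exists>R. \<forall>y\<in>M. \<exists>x\<in>P k. x \<in> M \<and> d y x \<le> R"
    and net': "\<And>k. \<exists>R. \<forall>y\<in>M'. \<exists>x\<in>P' k. x \<in> M' \<and> d' y x \<le> R"
    and corr: "\<And>k x x'. x \<in> M \<Longrightarrow> x' \<in> M' \<Longrightarrow> x \<in> P k \<Longrightarrow> x' \<in> P' k \<Longrightarrow> \<exists>\<R>\<subseteq>M \<times> M'. (x, x') \<in> \<R> \<and>
      (\<forall>a\<in>M. d x a < real k \<longrightarrow> (\<exists>a'. (a, a') \<in> \<R>)) \<and>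
      (\<forall>a'\<in>M'. d' x' a' < real k \<longrightarrow> (\<exists>a. (a, a') \<in> \<R>)) \<and>
      (\<forall>a a' b b'. (a, a') \<in> \<R> \<longrightarrow> (b, b') \<in> \<R> \<longrightarrow> \<bar>d a b - d' a' b'\<bar> \<le> C)"
    and V: "openin (higson_corona M d) V" "V \<noteq> {}"
    and V': "openin (higson_corona M' d') V'" "V' \<noteq> {}"
  obtains \<Omega> \<Omega>' where "openin (higson_corona M d) \<Omega>" "\<Omega> \<noteq> {}" "\<Omega> \<subseteq> V"
    "openin (higson_corona M' d') \<Omega>'" "\<Omega>' \<noteq> {}" "\<Omega>' \<subseteq> V'"
    "subtopology (higson_corona M d) \<Omega> homeomorphic_space subtopology (higson_corona M' d') \<Omega>'"
proof -
  obtain c where c: "sparse_centers M d c" "\<And>k. c k \<in> P (4 * (k + 1))"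
      "{\<xi> \<in> higson_characters M d. \<xi> (higson_class M d (sparse_centers.bump M d c)) \<noteq> 0} \<subseteq> V"
    by (rule Metric_space.supported_sparse_centers_exist[OF assms(1) net V]) (rule that)
  obtain c' where c': "sparse_centers M' d' c'" "\<And>k. c' k \<in> P' (4 * (k + 1))"
      "{\<xi> \<in> higson_characters M' d'. \<xi> (higson_class M' d' (sparse_centers.bump M' d' c')) \<noteq> 0} \<subseteq> V'"
    by (rule Metric_space.supported_sparse_centers_exist[OF assms(2) net' V']) (rule that)
  interpret c: sparse_centers M d c by fact
  interpret c': sparse_centers M' d' c' by fact
  have "\<forall>k. \<exists>\<R>\<subseteq>M \<times> M'. (c k, c' k) \<in> \<R> \<and>
      (\<forall>a\<in>M. d (c k) a < real (4 * (k + 1)) \<longrightarrow> (\<exists>a'. (a, a') \<in> \<R>)) \<and>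
      (\<forall>a'\<in>M'. d' (c' k) a' < real (4 * (k + 1)) \<longrightarrow> (\<exists>a. (a, a') \<in> \<R>)) \<and>
      (\<forall>a a' b b'. (a, a') \<in> \<R> \<longrightarrow> (b, b') \<in> \<R> \<longrightarrow> \<bar>d a b - d' a' b'\<bar> \<le> C)"
    by (intro allI corr c.center_in c'.center_in c(2) c'(2))
  from choice[OF this] obtain \<R> where \<R>: "\<forall>k. \<R> k \<subseteq> M \<times> M' \<and> (c k, c' k) \<in> \<R> k \<and>
      (\<forall>a\<in>M. d (c k) a < real (4 * (k + 1)) \<longrightarrow> (\<exists>a'. (a, a') \<in> \<R> k)) \<and>
      (\<forall>a'\<in>M'. d' (c' k) a' < real (4 * (k + 1)) \<longrightarrow> (\<exists>a. (a, a') \<in> \<R> k)) \<and>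
      (\<forall>a a' b b'. (a, a') \<in> \<R> k \<longrightarrow> (b, b') \<in> \<R> k \<longrightarrow> \<bar>d a b - d' a' b'\<bar> \<le> C)"
    by (elim exE)
  then have sub: "\<R> k \<subseteq> M \<times> M'" and cen: "(c k, c' k) \<in> \<R> k"
    and tot: "a \<in> M \<Longrightarrow> d (c k) a < real (4 * (k + 1)) \<Longrightarrow> \<exists>a'. (a, a') \<in> \<R> k"
    and onto: "a' \<in> M' \<Longrightarrow> d' (c' k) a' < real (4 * (k + 1)) \<Longrightarrow> \<exists>a. (a, a') \<in> \<R> k"
    and dis: "(a, a') \<in> \<R> k \<Longrightarrow> (b, b') \<in> \<R> k \<Longrightarrow> \<bar>d a b - d' a' b'\<bar> \<le> C" for k a a' b b'
    by blast+
  have four: "real (4 * (k + 1)) = 4 * (real k + 1)" for k by simp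
  have F: "center_correspondence M d c M' d' c' \<R> C"
    by unfold_locales (rule sub cen tot[unfolded four] dis; assumption)+
  have G: "center_correspondence M' d' c' M d c (\<lambda>k. (\<R> k)\<inverse>) C"
  proof unfold_locales
    show "(\<R> k)\<inverse> \<subseteq> M' \<times> M" for k using sub by blast
    show "\<bar>d' a b - d a' b'\<bar> \<le> C" if "(a, a') \<in> (\<R> k)\<inverse>" "(b, b') \<in> (\<R> k)\<inverse>" for a a' b b' k
      using dis[of a' a k b' b] that by (simp add: abs_minus_commute)
    show "\<exists>a'. (a, a') \<in> (\<R> k)\<inverse>" if "a \<in> M'" "d' (c' k) a < 4 * (real k + 1)" for a k
      using onto[unfolded four, OF that] by simp
  qed (simp add: cen)
  have "higson_partial_equivalence M' d' M d
    (sparse_centers.bump M' d' c') (center_correspondence.transfer d' c' c (\<lambda>k. (\<R> k)\<inverse>))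
    (sparse_centers.bump M d c) (center_correspondence.transfer d c c' \<R>)"
    using center_correspondence_equivalence[OF G] F by simp
  from higson_partial_equivalence_homeomorphic[OF center_correspondence_equivalence[OF F G] this]
  show ?thesis
    by (rule that[rotated -1, OF _ c.openin_nonvanishing_characters[OF c.bump_higson]
          c.nonempty_bump_characters c(3) c'.openin_nonvanishing_characters[OF c'.bump_higson]
          c'.nonempty_bump_characters c'(3)])
qed

section \<open>Plaques and leaf metrics\<close>

text \<open>A chain of minimal length does not repeat an element, since the part between two
  repetitions could be cut out.\<close>

lemma relpow_chain_bounded:
  assumes "finite S" "A \<subseteq> S \<times> S" "p \<in> S" "(p, q) \<in> A\<^sup>*"
  shows "\<exists>j<card S. (p, q) \<in> A ^^ j"
proof -
  define j where "j = (LEAST j. (p, q) \<in> A ^^ j)"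
  have j: "(p, q) \<in> A ^^ j"
    using assms(4) unfolding j_def rtrancl_power by (auto intro: LeastI)
  have min: "j \<le> i" if "(p, q) \<in> A ^^ i" for i
    unfolding j_def using that by (rule Least_le)
  obtain f where f: "f 0 = p" "f j = q" "\<And>i. i < j \<Longrightarrow> (f i, f (Suc i)) \<in> A"
    using j by (auto simp: relpow_fun_conv)
  have sub: "(f a, f b) \<in> A ^^ (b - a)" if "a \<le> b" "b \<le> j" for a b
    unfolding relpow_fun_conv using that f(3) by (intro exI[of _ "\<lambda>i. f (a + i)"]) auto
  have less: "f a \<noteq> f b" if "a < b" "b \<le> j" for a b
  proof
    assume eq: "f a = f b"
    have "(p, q) \<in> A ^^ a O A ^^ (j - b)"
      using sub[of 0 a] sub[of b j] that f eq by auto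
    then have "(p, q) \<in> A ^^ (a + (j - b))" by (simp add: relpow_add)
    from min[OF this] that show False by simp
  qed
  have "inj_on f {..j}"
    by (rule inj_onI, rule ccontr) (metis atMost_iff less linorder_neqE_nat)
  then have "card (f ` {..j}) = j + 1" by (simp add: card_image)
  moreover have "f ` {..j} \<subseteq> S"
  proof
    fix y assume "y \<in> f ` {..j}"
    then obtain i where i: "i \<le> j" "y = f i" by auto
    show "y \<in> S"
    proof (cases i)
      case 0
      then show ?thesis using i f(1) assms(3) by simp
    next
      case (Suc i')
      then show ?thesis using f(3)[of i'] i assms(2) by auto
    qed
  qed
  ultimately have "j + 1 \<le> card S" using card_mono[OF assms(1)] by metis
  then show ?thesis using j by (intro exI[of _ j]) auto
qed

text \<open>The members that can be reached from \<open>P\<close> and the remaining ones have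
  disjoint open unions, so connectedness leaves only empty members unreached.\<close>

lemma connectedin_open_family_chain:
  assumes "connectedin T (\<Union>\<P>)" "\<And>P. P \<in> \<P> \<Longrightarrow> openin T P" "P \<in> \<P>" "Q \<in> \<P>" "P \<noteq> {}" "Q \<noteq> {}"
  shows "(P, Q) \<in> {(P, Q). P \<in> \<P> \<and> Q \<in> \<P> \<and> P \<inter> Q \<noteq> {}}\<^sup>*"
proof -
  let ?A = "{(P, Q). P \<in> \<P> \<and> Q \<in> \<P> \<and> P \<inter> Q \<noteq> {}}"
  define \<Q> where "\<Q> = {Q \<in> \<P>. (P, Q) \<in> ?A\<^sup>*}"
  have "openin T (\<Union>\<Q>)" "openin T (\<Union>(\<P> - \<Q>))"
    using assms(2) by (auto simp: \<Q>_def)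
  moreover have "\<Union>\<P> \<subseteq> \<Union>\<Q> \<union> \<Union>(\<P> - \<Q>)" by auto
  moreover have "\<Union>\<Q> \<inter> \<Union>(\<P> - \<Q>) \<inter> \<Union>\<P> = {}"
  proof -
    have "R \<inter> S = {}" if "R \<in> \<Q>" "S \<in> \<P> - \<Q>" for R S
    proof (rule ccontr)
      assume "R \<inter> S \<noteq> {}"
      then have "(R, S) \<in> ?A" using that by (auto simp: \<Q>_def)
      then have "(P, S) \<in> ?A\<^sup>*" using that by (auto simp: \<Q>_def intro: rtrancl_into_rtrancl)
      then show False using that by (auto simp: \<Q>_def)
    qed
    then show ?thesis by blast
  qed
  moreover have "\<Union>\<Q> \<inter> \<Union>\<P> \<noteq> {}" using assms(3,5) by (auto simp: \<Q>_def)
  ultimately have "\<Union>(\<P> - \<Q>) \<inter> \<Union>\<P> = {}"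
    using assms(1) unfolding connectedin by blast
  then have "Q \<in> \<Q>" using assms(4,6) by auto
  then show ?thesis by (simp add: \<Q>_def)
qed

text \<open>Straight segments stay in the ball, by the triangle inequality for
  \<open>L2_set\<close>.\<close>

lemma connectedin_euclidean_open_ball:
  assumes "euclidean_open_ball n B"
  shows "connectedin (Euclidean_space n) B"
proof (rule path_connectedin_imp_connectedin)
  obtain c r where c: "c \<in> topspace (Euclidean_space n)" "r > 0"
    and B: "B = {x \<in> topspace (Euclidean_space n). L2_set (\<lambda>i. x i - c i) {..<n} < r}"
    using assms unfolding euclidean_open_ball_def L2_set_def by auto
  show "path_connectedin (Euclidean_space n) B"
    unfolding path_connectedin
  proof (intro conjI ballI)
    show "B \<subseteq> topspace (Euclidean_space n)" using B by auto
    fix x y assume x: "x \<in> B" and y: "y \<in> B"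
    define g where "g t = (\<lambda>i. (1 - t) * x i + t * y i)" for t :: real
    have "pathin (Euclidean_space n) g"
      unfolding pathin_def Euclidean_space_def
    proof (rule continuous_map_into_subtopology)
      show "continuous_map (top_of_set {0..1}) (powertop_real UNIV) g"
        unfolding continuous_map_componentwise_UNIV g_def
        by (auto intro!: continuous_intros)
      show "g \<in> topspace (top_of_set {0..1}) \<rightarrow> {x. \<forall>i\<ge>n. x i = 0}"
        using x y by (auto simp: g_def B topspace_Euclidean_space)
    qed
    moreover have "g t \<in> B" if t: "t \<in> {0..1}" for t
    proof -
      have "L2_set (\<lambda>i. g t i - c i) {..<n} =
          L2_set (\<lambda>i. (1 - t) * (x i - c i) + t * (y i - c i)) {..<n}"
        by (rule L2_set_cong) (auto simp: g_def algebra_simps)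
      also have "\<dots> \<le> L2_set (\<lambda>i. (1 - t) * (x i - c i)) {..<n} + L2_set (\<lambda>i. t * (y i - c i)) {..<n}"
        by (rule L2_set_triangle_ineq)
      also have "\<dots> = (1 - t) * L2_set (\<lambda>i. x i - c i) {..<n} + t * L2_set (\<lambda>i. y i - c i) {..<n}"
        using t by (simp add: L2_set_right_distrib)
      also have "\<dots> < r"
        using t x y B by (intro convex_bound_lt) auto
      finally have "L2_set (\<lambda>i. g t i - c i) {..<n} < r" .
      then show ?thesis using x y by (auto simp: g_def B topspace_Euclidean_space)
    qed
    ultimately show "\<exists>g. pathin (Euclidean_space n) g \<and> g \<in> {0..1} \<rightarrow> B \<and> g 0 = x \<and> g 1 = y"
      by (intro exI[of _ g]) (auto simp: g_def)
  qed
qed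

lemma euclidean_open_ball_nonempty: "euclidean_open_ball n B \<Longrightarrow> B \<noteq> {}"
  unfolding euclidean_open_ball_def by force

section \<open>Charts, their projections and their plaques\<close>

lemma chart_homeomorphic_maps:
  assumes "is_foliated_chart n X c"
  obtains g where "homeomorphic_maps (subtopology X (chart_dom c))
    (prod_topology (subtopology (Euclidean_space n) (chart_ball c)) (chart_trans c)) (chart_map c) g"
  using assms unfolding is_foliated_chart_def homeomorphic_map_maps by blast

lemma chart_dom_subset: "is_foliated_chart n X c \<Longrightarrow> chart_dom c \<subseteq> topspace X"
  unfolding is_foliated_chart_def by (blast dest: openin_subset)

lemma chart_proj_continuous:
  assumes "is_foliated_chart n X c"
  shows "continuous_map (subtopology X (chart_dom c)) (chart_trans c) (chart_proj c)"
proof -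
  have "continuous_map (subtopology X (chart_dom c)) (chart_trans c) (snd \<circ> chart_map c)"
    using assms unfolding is_foliated_chart_def
    by (meson continuous_map_compose continuous_map_snd homeomorphic_imp_continuous_map)
  then show ?thesis by (simp add: chart_proj_def[abs_def] comp_def)
qed

lemma chart_proj_in: "is_foliated_chart n X c \<Longrightarrow> q \<in> chart_dom c \<Longrightarrow> chart_proj c q \<in> topspace (chart_trans c)"
  using chart_proj_continuous[of n X c] chart_dom_subset[of n X c]
  by (auto simp: continuous_map_def Pi_iff)

lemma chart_proj_open:
  assumes "is_foliated_chart n X c" "openin X U"
  shows "openin (chart_trans c) (chart_proj c ` (chart_dom c \<inter> U))"
proof -
  have "open_map (subtopology X (chart_dom c)) (chart_trans c) (snd \<circ> chart_map c)"
    using assms unfolding is_foliated_chart_def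
    by (meson open_map_compose open_map_snd homeomorphic_imp_open_map)
  moreover have "openin (subtopology X (chart_dom c)) (chart_dom c \<inter> U)"
    using assms(2) by (auto simp: openin_subtopology)
  ultimately show ?thesis
    by (simp add: open_map_def chart_proj_def[abs_def] comp_def)
qed

lemma chart_proj_preimage_open:
  assumes "is_foliated_chart n X c" "openin (chart_trans c) V"
  shows "openin X {q \<in> chart_dom c. chart_proj c q \<in> V}"
proof -
  have "openin (subtopology X (chart_dom c)) {q \<in> topspace (subtopology X (chart_dom c)). chart_proj c q \<in> V}"
    using openin_continuous_map_preimage[OF chart_proj_continuous[OF assms(1)] assms(2)] .
  moreover have "openin X (chart_dom c)" using assms(1) by (simp add: is_foliated_chart_def)
  ultimately have "openin X {q \<in> topspace (subtopology X (chart_dom c)). chart_proj c q \<in> V}"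
    by (rule openin_trans_full)
  moreover have "{q \<in> topspace (subtopology X (chart_dom c)). chart_proj c q \<in> V} =
      {q \<in> chart_dom c. chart_proj c q \<in> V}"
    using chart_dom_subset[OF assms(1)] by auto
  ultimately show ?thesis by simp
qed

text \<open>Presents a plaque as a continuous image of a ball, the source of its being nonempty and
  connected.\<close>

lemma chart_plaque_param:
  assumes c: "is_foliated_chart n X c" and z: "z \<in> topspace (chart_trans c)"
  obtains \<gamma> where "continuous_map (subtopology (Euclidean_space n) (chart_ball c)) X \<gamma>"
    "\<gamma> ` chart_ball c = {q \<in> chart_dom c. chart_proj c q = z}"
proof -
  obtain g where g: "homeomorphic_maps (subtopology X (chart_dom c))
    (prod_topology (subtopology (Euclidean_space n) (chart_ball c)) (chart_trans c)) (chart_map c) g"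
    using chart_homeomorphic_maps[OF c] .
  have ball: "chart_ball c \<subseteq> topspace (Euclidean_space n)"
    using c by (auto simp: is_foliated_chart_def euclidean_open_ball_def)
  then have tb: "topspace (subtopology (Euclidean_space n) (chart_ball c)) = chart_ball c" by auto
  have td: "topspace (subtopology X (chart_dom c)) = chart_dom c"
    using chart_dom_subset[OF c] by auto
  note g' = g[unfolded homeomorphic_maps_def td topspace_prod_topology tb]
  define \<gamma> where "\<gamma> = g \<circ> (\<lambda>b. (b, z))"
  have "continuous_map (subtopology (Euclidean_space n) (chart_ball c)) (subtopology X (chart_dom c)) \<gamma>"
    unfolding \<gamma>_def using g' z
    by (intro continuous_map_compose[where X' = "prod_topology (subtopology (Euclidean_space n) (chart_ball c)) (chart_trans c)"])
       (auto simp: continuous_map_pairwise o_def)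
  then have "continuous_map (subtopology (Euclidean_space n) (chart_ball c)) X \<gamma>"
    by (simp add: continuous_map_in_subtopology)
  moreover have "\<gamma> ` chart_ball c = {q \<in> chart_dom c. chart_proj c q = z}"
  proof
    show "\<gamma> ` chart_ball c \<subseteq> {q \<in> chart_dom c. chart_proj c q = z}"
    proof
      fix q assume "q \<in> \<gamma> ` chart_ball c"
      then obtain b where b: "b \<in> chart_ball c" "q = g (b, z)" by (auto simp: \<gamma>_def)
      have "g (b, z) \<in> chart_dom c"
        using g' b z ball by (auto simp: continuous_map_def Pi_iff)
      moreover have "chart_map c (g (b, z)) = (b, z)" using g' b z by auto
      ultimately show "q \<in> {q \<in> chart_dom c. chart_proj c q = z}"
        using b by (simp add: chart_proj_def)
    qed
    show "{q \<in> chart_dom c. chart_proj c q = z} \<subseteq> \<gamma> ` chart_ball c"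
    proof
      fix q assume q: "q \<in> {q \<in> chart_dom c. chart_proj c q = z}"
      have "chart_map c q \<in> chart_ball c \<times> topspace (chart_trans c)"
        using g' q td by (auto simp: continuous_map_def Pi_iff tb)
      moreover have "g (chart_map c q) = q" using g' q by auto
      ultimately have "q = \<gamma> (fst (chart_map c q))" "fst (chart_map c q) \<in> chart_ball c"
        using q by (auto simp: \<gamma>_def chart_proj_def)
      then show "q \<in> \<gamma> ` chart_ball c" by blast
    qed
  qed
  ultimately show ?thesis using that by blast
qed

lemma chart_plaque_nonempty:
  assumes "is_foliated_chart n X c" "z \<in> topspace (chart_trans c)"
  shows "{q \<in> chart_dom c. chart_proj c q = z} \<noteq> {}"
  using chart_plaque_param[OF assms] euclidean_open_ball_nonempty assms(1)
  unfolding is_foliated_chart_def by (metis image_is_empty)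

text \<open>Two charts of the maximal atlas are compared through a chart of the given atlas.\<close>

lemma foliated_charts_locally_aligned:
  assumes at: "foliated_atlas n X \<F>"
    and c: "c \<in> foliated_charts n X \<F>" "c' \<in> foliated_charts n X \<F>"
    and q: "q \<in> chart_dom c" "q \<in> chart_dom c'"
  obtains W h where "openin X W" "q \<in> W" "W \<subseteq> chart_dom c \<inter> chart_dom c'"
    "\<And>q'. q' \<in> W \<Longrightarrow> chart_proj c' q' = h (chart_proj c q')"
proof -
  have "q \<in> topspace X" using chart_dom_subset c q by (auto simp: foliated_charts_def)
  then have "q \<in> (\<Union>c\<in>\<F>. chart_dom c)" using at by (simp add: foliated_atlas_def)
  then obtain e where e: "e \<in> \<F>" "q \<in> chart_dom e" by auto
  have "foliated_change X c e" "foliated_change X e c'"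
    using c e by (auto simp: foliated_charts_def)
  then obtain W1 f1 h1 W2 f2 h2 where
    "openin X W1" "q \<in> W1" "W1 \<subseteq> chart_dom c \<inter> chart_dom e"
    "\<And>q'. q' \<in> W1 \<Longrightarrow> chart_map e q' = (f1 (chart_map c q'), h1 (chart_proj c q'))"
    "openin X W2" "q \<in> W2" "W2 \<subseteq> chart_dom e \<inter> chart_dom c'"
    "\<And>q'. q' \<in> W2 \<Longrightarrow> chart_map c' q' = (f2 (chart_map e q'), h2 (chart_proj e q'))"
    using q e(2) unfolding foliated_change_def by (metis IntI)
  then show ?thesis
    by (intro that[of "W1 \<inter> W2" "h2 \<circ> h1"]) (auto simp: chart_proj_def)
qed

section \<open>The graph of plaques of a regular atlas\<close>

locale regular_foliated_space =
  fixes n :: nat and X :: "'x topology" and \<F> \<U> :: "('x, 'z) foliated_chart set"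
  assumes space: "compact_Polish_foliated_space n X \<F>"
    and regular: "regular_foliated_atlas n X \<F> \<U>"
begin

abbreviation "leafT \<equiv> leaf_topology n X \<F>"

abbreviation "dist\<^sub>L \<equiv> leaf_metric n X \<F> \<U>"

definition plaque :: "('x, 'z) foliated_chart \<times> 'z \<Rightarrow> 'x set" where
  "plaque v = {q \<in> chart_dom (fst v). chart_proj (fst v) q = snd v}"

text \<open>These are the points of the transversal. A vertex remembers its chart, so different
  vertices can have the same plaque.\<close>

definition verts :: "(('x, 'z) foliated_chart \<times> 'z) set" where
  "verts = (SIGMA c:\<U>. topspace (chart_trans c))"

definition adj :: "((('x, 'z) foliated_chart \<times> 'z) \<times> (('x, 'z) foliated_chart \<times> 'z)) set" where
  "adj = {(v, w). v \<in> verts \<and> w \<in> verts \<and> plaque v \<inter> plaque w \<noteq> {}}"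

lemma atlas: "foliated_atlas n X \<F>"
  using space by (simp add: compact_Polish_foliated_space_def)

lemma atlas_U: "foliated_atlas n X \<U>" and charts_U: "\<U> \<subseteq> foliated_charts n X \<F>"
  using regular by (auto simp: regular_foliated_atlas_def)

lemma chart_U: "c \<in> \<U> \<Longrightarrow> is_foliated_chart n X c"
  using atlas_U by (simp add: foliated_atlas_def)

lemma plaque_in_chart_plaques: "v \<in> verts \<Longrightarrow> plaque v \<in> chart_plaques (fst v)"
  by (auto simp: verts_def plaque_def chart_plaques_def)

lemma chart_plaques_eq: "(\<Union>c\<in>\<U>. chart_plaques c) = plaque ` verts"
  by (force simp: verts_def plaque_def chart_plaques_def image_iff)

lemma plaque_nonempty: "v \<in> verts \<Longrightarrow> plaque v \<noteq> {}"
  using chart_plaque_nonempty[OF chart_U] by (auto simp: verts_def plaque_def)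

lemma plaque_subset: "v \<in> verts \<Longrightarrow> plaque v \<subseteq> topspace X"
  using chart_dom_subset[OF chart_U] by (fastforce simp: verts_def plaque_def)

lemma vert_of_point:
  assumes "c \<in> \<U>" "q \<in> chart_dom c"
  shows "(c, chart_proj c q) \<in> verts" "q \<in> plaque (c, chart_proj c q)"
  using assms chart_proj_in[OF chart_U] by (auto simp: verts_def plaque_def)

lemma obtain_vert:
  assumes "x \<in> topspace X"
  obtains v where "v \<in> verts" "x \<in> plaque v"
  using assms atlas_U vert_of_point unfolding foliated_atlas_def by blast

lemma adj_refl: "v \<in> verts \<Longrightarrow> (v, v) \<in> adj"
  using plaque_nonempty by (auto simp: adj_def)

lemma adj_sym: "(v, w) \<in> adj \<Longrightarrow> (w, v) \<in> adj"
  by (auto simp: adj_def)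

lemma adjI: "v \<in> verts \<Longrightarrow> w \<in> verts \<Longrightarrow> x \<in> plaque v \<Longrightarrow> x \<in> plaque w \<Longrightarrow> (v, w) \<in> adj"
  by (auto simp: adj_def)

text \<open>This is the third condition of regularity: a plaque meets at most one plaque of each
  chart. It makes following a word of charts deterministic.\<close>

lemma adj_functional:
  assumes "(v, (c, z)) \<in> adj" "(v, (c, z')) \<in> adj"
  shows "z = z'"
proof -
  have v: "v \<in> verts" "(c, z) \<in> verts" "(c, z') \<in> verts" using assms by (auto simp: adj_def)
  have meet: "X closure_of plaque v \<inter> X closure_of plaque w \<noteq> {}" if "(v, w) \<in> adj" for w
  proof -
    have "w \<in> verts" "plaque v \<inter> plaque w \<noteq> {}" using that by (auto simp: adj_def)
    then show ?thesis
      using closure_of_subset[OF plaque_subset[OF v(1)]] closure_of_subset[OF plaque_subset[of w]] by blast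
  qed
  have "X closure_of plaque v \<inter> X closure_of plaque (c, z) \<noteq> {}"
    "X closure_of plaque v \<inter> X closure_of plaque (c, z') \<noteq> {}"
    using meet assms by auto
  moreover have "fst v \<in> \<U>" "c \<in> \<U>" using v by (auto simp: verts_def)
  ultimately have "plaque (c, z) = plaque (c, z')"
    using regular plaque_in_chart_plaques[OF v(1)] plaque_in_chart_plaques[OF v(2)]
      plaque_in_chart_plaques[OF v(3)]
    unfolding regular_foliated_atlas_def by simp
  then show ?thesis using plaque_nonempty[OF v(2)] by (auto simp: plaque_def)
qed

lemma relpow_adj_verts: "(v, w) \<in> adj ^^ k \<Longrightarrow> v \<in> verts \<Longrightarrow> w \<in> verts"
  by (cases k) (auto simp: adj_def)

lemma relpow_adj_mono:
  assumes "(v, w) \<in> adj ^^ j" "v \<in> verts" "j \<le> k"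
  shows "(v, w) \<in> adj ^^ k"
  using assms(3)
proof (induction k rule: dec_induct)
  case (step k)
  then show ?case using adj_refl[OF relpow_adj_verts[OF assms(1,2)]] by auto
qed (use assms in simp)

lemma relpow_adj_sym: "(v, w) \<in> adj ^^ k \<Longrightarrow> (w, v) \<in> adj ^^ k"
proof (induction k arbitrary: w)
  case (Suc k)
  then show ?case by (meson adj_sym relpow_Suc_E relpow_Suc_I2)
qed auto

lemma openin_plaque:
  assumes "v \<in> verts"
  shows "openin leafT (plaque v)"
proof -
  have "fst v \<in> foliated_charts n X \<F>" using assms charts_U by (auto simp: verts_def)
  then show ?thesis
    using plaque_in_chart_plaques[OF assms] unfolding leaf_topology_def
    by (intro topology_generated_by_Basis) blast
qed

lemma topspace_leaf_topology: "topspace leafT = topspace X"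
proof
  show "topspace leafT \<subseteq> topspace X"
    using chart_dom_subset
    by (fastforce simp: leaf_topology_def chart_plaques_def foliated_charts_def)
  show "topspace X \<subseteq> topspace leafT"
  proof
    fix x assume "x \<in> topspace X"
    then obtain v where v: "v \<in> verts" "x \<in> plaque v" by (rule obtain_vert)
    then show "x \<in> topspace leafT"
      using openin_subset[OF openin_plaque[OF v(1)]] by auto
  qed
qed

text \<open>Connectedness is needed in the leaf topology. The parametrisation by a ball is
  continuous into it, because along a plaque the transverse coordinate of any other foliated chart
  is locally constant.\<close>

lemma connectedin_plaque:
  assumes "v \<in> verts"
  shows "connectedin leafT (plaque v)"
proof -
  obtain c z where v: "v = (c, z)" "c \<in> \<U>" "z \<in> topspace (chart_trans c)"
    using assms by (auto simp: verts_def)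
  have c: "c \<in> foliated_charts n X \<F>" "is_foliated_chart n X c" using v charts_U chart_U by auto
  let ?E = "subtopology (Euclidean_space n) (chart_ball c)"
  obtain \<gamma> where \<gamma>: "continuous_map ?E X \<gamma>" "\<gamma> ` chart_ball c = {q \<in> chart_dom c. chart_proj c q = z}"
    using chart_plaque_param[OF c(2) v(3)] .
  have conn: "connectedin (Euclidean_space n) (chart_ball c)"
    using c(2) by (intro connectedin_euclidean_open_ball) (simp add: is_foliated_chart_def)
  then have tE: "topspace ?E = chart_ball c"
    using connectedin_subset_topspace by fastforce
  have "continuous_map ?E leafT \<gamma>"
    unfolding leaf_topology_def
  proof (rule continuous_on_generated_topo)
    fix Q assume "Q \<in> (\<Union>c\<in>foliated_charts n X \<F>. chart_plaques c)"
    then obtain c' z' where Q: "c' \<in> foliated_charts n X \<F>" "Q = {q \<in> chart_dom c'. chart_proj c' q = z'}"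
      by (auto simp: chart_plaques_def)
    show "openin ?E (\<gamma> -` Q \<inter> topspace ?E)"
    proof (subst openin_subopen, intro ballI)
      fix b assume b: "b \<in> \<gamma> -` Q \<inter> topspace ?E"
      then have q: "\<gamma> b \<in> chart_dom c" "chart_proj c (\<gamma> b) = z" "\<gamma> b \<in> chart_dom c'" "chart_proj c' (\<gamma> b) = z'"
        using \<gamma>(2) Q(2) tE by auto
      obtain W h where W: "openin X W" "\<gamma> b \<in> W" "W \<subseteq> chart_dom c \<inter> chart_dom c'"
        "\<And>q'. q' \<in> W \<Longrightarrow> chart_proj c' q' = h (chart_proj c q')"
        using foliated_charts_locally_aligned[OF atlas c(1) Q(1) q(1,3)] by metis
      show "\<exists>T. openin ?E T \<and> b \<in> T \<and> T \<subseteq> \<gamma> -` Q \<inter> topspace ?E"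
      proof (intro exI conjI)
        show "openin ?E {a \<in> topspace ?E. \<gamma> a \<in> W}"
          by (rule openin_continuous_map_preimage[OF \<gamma>(1) W(1)])
        show "{a \<in> topspace ?E. \<gamma> a \<in> W} \<subseteq> \<gamma> -` Q \<inter> topspace ?E"
        proof
          fix a assume a: "a \<in> {a \<in> topspace ?E. \<gamma> a \<in> W}"
          then have "chart_proj c (\<gamma> a) = z" using \<gamma>(2) tE by auto
          then have "chart_proj c' (\<gamma> a) = z'" using W(4)[of "\<gamma> a"] W(4)[OF W(2)] a q by simp
          then show "a \<in> \<gamma> -` Q \<inter> topspace ?E" using a W(3) Q(2) by auto
        qed
      qed (use b W in auto)
    qed
  next
    have "plaque v \<subseteq> \<Union>(\<Union>c\<in>foliated_charts n X \<F>. chart_plaques c)"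
      using plaque_in_chart_plaques[OF assms] c(1) v(1) by auto
    then show "\<gamma> ` topspace ?E \<subseteq> \<Union>(\<Union>c\<in>foliated_charts n X \<F>. chart_plaques c)"
      using \<gamma>(2) v(1) tE by (simp add: plaque_def)
  qed
  then have "connectedin leafT (\<gamma> ` chart_ball c)"
    using conn by (intro connectedin_continuous_map_image[of ?E]) (auto simp: connectedin_subtopology)
  then show ?thesis using \<gamma>(2) v(1) by (simp add: plaque_def)
qed

lemma leaf_subset: "L \<in> leaves n X \<F> \<Longrightarrow> L \<subseteq> topspace X"
  using connected_components_of_subset topspace_leaf_topology unfolding leaves_def by metis

lemma plaque_subset_leaf:
  "L \<in> leaves n X \<F> \<Longrightarrow> v \<in> verts \<Longrightarrow> plaque v \<inter> L \<noteq> {} \<Longrightarrow> plaque v \<subseteq> L"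
  using connected_components_of_maximal[OF _ connectedin_plaque]
  unfolding leaves_def disjnt_def by blast

lemma relpow_adj_leaf:
  assumes "L \<in> leaves n X \<F>" "(v, w) \<in> adj ^^ k" "v \<in> verts" "plaque v \<inter> L \<noteq> {}"
  shows "plaque w \<subseteq> L"
  using assms(2)
proof (induction k arbitrary: w)
  case 0
  then show ?case using plaque_subset_leaf assms by simp
next
  case (Suc k)
  then obtain u where u: "(v, u) \<in> adj ^^ k" "(u, w) \<in> adj" by auto
  then have "plaque u \<subseteq> L" using Suc by blast
  then show ?case using u(2) plaque_subset_leaf[OF assms(1)] by (fastforce simp: adj_def)
qed

lemma obtain_leaf:
  assumes "x \<in> topspace X"
  obtains L where "L \<in> leaves n X \<F>" "x \<in> L"
  using assms Union_connected_components_of[of leafT] topspace_leaf_topology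
  unfolding leaves_def by auto

text \<open>Lifts a chain of plaques, as sets, to vertices; any vertex with the right plaque will
  do. The additional step leads from \<open>v\<close> into the first plaque.\<close>

lemma set_chain_imp_adj:
  assumes \<P>: "\<P> \<subseteq> plaque ` verts"
    and chain: "(plaque u, P) \<in> {(P, Q). P \<in> \<P> \<and> Q \<in> \<P> \<and> P \<inter> Q \<noteq> {}} ^^ j"
    and v: "v \<in> verts" "u \<in> verts" "plaque v \<inter> plaque u \<noteq> {}"
    and w: "w \<in> verts" "P = plaque w"
  shows "(v, w) \<in> adj ^^ (j + 1)"
  using chain w
proof (induction j arbitrary: P w)
  case 0
  then show ?case using v by (auto simp: adj_def)
next
  case (Suc j)
  from Suc.prems(1) obtain Q where Q: "(plaque u, Q) \<in> {(P, Q). P \<in> \<P> \<and> Q \<in> \<P> \<and> P \<inter> Q \<noteq> {}} ^^ j"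
    "Q \<in> \<P>" "Q \<inter> P \<noteq> {}" by auto
  then obtain u' where u': "u' \<in> verts" "Q = plaque u'" using \<P> by blast
  from Suc.IH[OF Q(1) u'] have "(v, u') \<in> adj ^^ (j + 1)" .
  moreover have "(u', w) \<in> adj" using Q(3) u' Suc.prems by (auto simp: adj_def)
  ultimately show ?case by auto
qed

text \<open>The plaques that meet \<open>L\<close> have union exactly \<open>L\<close>, which is
  connected in the leaf topology.\<close>

lemma leaf_chain:
  assumes L: "L \<in> leaves n X \<F>" and x: "x \<in> L" "x \<in> plaque v" "v \<in> verts"
    and y: "y \<in> L" "y \<in> plaque w" "w \<in> verts"
  shows "\<exists>k. (v, w) \<in> adj ^^ k"
proof -
  define \<P> where "\<P> = plaque ` {u \<in> verts. plaque u \<inter> L \<noteq> {}}"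
  have "\<Union>\<P> = L"
  proof
    show "\<Union>\<P> \<subseteq> L" using plaque_subset_leaf[OF L] by (auto simp: \<P>_def)
    show "L \<subseteq> \<Union>\<P>"
    proof
      fix q assume q: "q \<in> L"
      then obtain u where "u \<in> verts" "q \<in> plaque u" using obtain_vert leaf_subset[OF L] by blast
      then show "q \<in> \<Union>\<P>" using q unfolding \<P>_def by blast
    qed
  qed
  then have conn: "connectedin leafT (\<Union>\<P>)"
    using L by (simp add: leaves_def connectedin_connected_components_of)
  have "plaque v \<in> \<P>" "plaque w \<in> \<P>" using x y by (auto simp: \<P>_def)
  then have "(plaque v, plaque w) \<in> {(P, Q). P \<in> \<P> \<and> Q \<in> \<P> \<and> P \<inter> Q \<noteq> {}}\<^sup>*"
    using x(3) y(3) plaque_nonempty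
    by (intro connectedin_open_family_chain[OF conn]) (auto simp: \<P>_def openin_plaque)
  then obtain j where j: "(plaque v, plaque w) \<in> {(P, Q). P \<in> \<P> \<and> Q \<in> \<P> \<and> P \<inter> Q \<noteq> {}} ^^ j"
    unfolding rtrancl_power by auto
  have "(v, w) \<in> adj ^^ (j + 1)"
    by (rule set_chain_imp_adj[OF _ j x(3) x(3) _ y(3) refl]) (use x(2) in \<open>auto simp: \<P>_def\<close>)
  then show ?thesis by blast
qed

section \<open>Leaf distance and length of plaque chains\<close>

definition linked :: "nat \<Rightarrow> 'x \<Rightarrow> 'x \<Rightarrow> bool" where
  "linked k x y \<longleftrightarrow> (\<exists>\<P>\<subseteq>plaque ` verts. finite \<P> \<and> card \<P> = k \<and>
     connectedin leafT (\<Union>\<P>) \<and> x \<in> \<Union>\<P> \<and> y \<in> \<Union>\<P>)"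

lemma leaf_metric_linked: "dist\<^sub>L x y = (if x = y then 0 else real (LEAST k. linked k x y))"
  by (simp add: leaf_metric_def linked_def chart_plaques_eq)

lemma linked_sym: "linked k x y \<Longrightarrow> linked k y x"
  unfolding linked_def by blast

lemma linked_pos: "linked k x y \<Longrightarrow> 0 < k"
  unfolding linked_def by (metis Union_empty card_gt_0_iff empty_iff)

lemma linked_trans:
  assumes "linked j x y" "linked k y z"
  shows "\<exists>m\<le>j + k. linked m x z"
proof -
  obtain \<P> where \<P>: "\<P> \<subseteq> plaque ` verts" "finite \<P>" "card \<P> = j" "connectedin leafT (\<Union>\<P>)"
    "x \<in> \<Union>\<P>" "y \<in> \<Union>\<P>" using assms(1) unfolding linked_def by blast
  obtain \<Q> where \<Q>: "\<Q> \<subseteq> plaque ` verts" "finite \<Q>" "card \<Q> = k" "connectedin leafT (\<Union>\<Q>)"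
    "y \<in> \<Union>\<Q>" "z \<in> \<Union>\<Q>" using assms(2) unfolding linked_def by blast
  have "connectedin leafT (\<Union>(\<P> \<union> \<Q>))"
    unfolding Union_Un_distrib using \<P> \<Q> by (intro connectedin_Un) auto
  then have "linked (card (\<P> \<union> \<Q>)) x z"
    unfolding linked_def using \<P> \<Q> by (intro exI[of _ "\<P> \<union> \<Q>"]) auto
  then show ?thesis using card_Un_le[of \<P> \<Q>] \<P>(3) \<Q>(3) by blast
qed

lemma leaf_metric_le: "linked k x y \<Longrightarrow> dist\<^sub>L x y \<le> real k"
  by (simp add: leaf_metric_linked Least_le)

lemma leaf_metric_attained:
  assumes "x \<noteq> y" "linked k x y"
  obtains m where "dist\<^sub>L x y = real m" "linked m x y"
  using assms LeastI[of "\<lambda>k. linked k x y" k] by (auto simp: leaf_metric_linked)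

text \<open>A chain of \<open>k\<close> steps visits \<open>k + 1\<close> plaques, fewer if some of
  them coincide as sets.\<close>

lemma linked_chain:
  assumes "v \<in> verts" "x \<in> plaque v" "y \<in> plaque w" "(v, w) \<in> adj ^^ k"
  shows "\<exists>m\<le>k + 1. linked m x y"
  using assms(3,4)
proof (induction k arbitrary: w y)
  case 0
  then have "linked 1 x y"
    unfolding linked_def using assms(1,2) connectedin_plaque by (intro exI[of _ "{plaque v}"]) auto
  then show ?case by auto
next
  case (Suc k)
  then obtain u where u: "(v, u) \<in> adj ^^ k" "(u, w) \<in> adj" by auto
  then obtain q where q: "q \<in> plaque u" "q \<in> plaque w" and w: "w \<in> verts" by (auto simp: adj_def)
  obtain m where m: "m \<le> k + 1" "linked m x q" using Suc.IH[OF q(1) u(1)] by auto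
  have "linked 1 q y"
    unfolding linked_def using q Suc.prems(1) w connectedin_plaque
    by (intro exI[of _ "{plaque w}"]) auto
  from linked_trans[OF m(2) this] obtain m' where "m' \<le> m + 1" "linked m' x y" by auto
  then show ?case using m(1) by (intro exI[of _ m']) auto
qed

lemma leaf_metric_chain_le:
  assumes "v \<in> verts" "x \<in> plaque v" "y \<in> plaque w" "(v, w) \<in> adj ^^ k"
  shows "dist\<^sub>L x y \<le> real k + 1"
  using linked_chain[OF assms] leaf_metric_le by fastforce

lemma leaf_linked:
  assumes "L \<in> leaves n X \<F>" "x \<in> L" "y \<in> L"
  shows "\<exists>k. linked k x y"
proof -
  obtain v w where "v \<in> verts" "x \<in> plaque v" "w \<in> verts" "y \<in> plaque w"
    using obtain_vert leaf_subset[OF assms(1)] assms(2,3) by (metis subsetD)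
  then show ?thesis using leaf_chain[OF assms(1)] assms linked_chain by blast
qed

lemma leaf_metric_nat:
  obtains m where "dist\<^sub>L x y = real m"
  by (simp add: leaf_metric_linked split: if_splits) (metis of_nat_0)

text \<open>A connected union of \<open>k\<close> plaques contains a chain of at most
  \<open>k - 1\<close> steps. The plaques of \<open>v\<close> and \<open>w\<close> need not be among
  them, so entering from \<open>v\<close> and leaving to \<open>w\<close> costs two more.\<close>

lemma leaf_chain_of_metric:
  assumes L: "L \<in> leaves n X \<F>" and x: "x \<in> L" "x \<in> plaque v" "v \<in> verts"
    and y: "y \<in> L" "y \<in> plaque w" "w \<in> verts" and d: "dist\<^sub>L x y \<le> real m"
  shows "(v, w) \<in> adj ^^ (m + 1)"
proof (cases "x = y")
  case True
  then have "(v, w) \<in> adj ^^ 1" using x y by (auto simp: adj_def)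
  then show ?thesis using relpow_adj_mono x(3) by (metis le_add2)
next
  case False
  obtain k where "linked k x y" using leaf_linked[OF L x(1) y(1)] by auto
  then obtain k where k: "dist\<^sub>L x y = real k" "linked k x y"
    using leaf_metric_attained[OF False] by blast
  then obtain \<P> where \<P>: "\<P> \<subseteq> plaque ` verts" "finite \<P>" "card \<P> = k" "connectedin leafT (\<Union>\<P>)"
    "x \<in> \<Union>\<P>" "y \<in> \<Union>\<P>" unfolding linked_def by blast
  obtain u u' where u: "u \<in> verts" "plaque u \<in> \<P>" "x \<in> plaque u" and u': "u' \<in> verts" "plaque u' \<in> \<P>" "y \<in> plaque u'"
    using \<P>(1,5,6) by blast
  let ?A = "{(P, Q). P \<in> \<P> \<and> Q \<in> \<P> \<and> P \<inter> Q \<noteq> {}}"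
  have "(plaque u, plaque u') \<in> ?A\<^sup>*"
    using u u' \<P>(1) openin_plaque by (intro connectedin_open_family_chain[OF \<P>(4)]) auto
  then obtain j where j: "j < k" "(plaque u, plaque u') \<in> ?A ^^ j"
    using relpow_chain_bounded[OF \<P>(2), of ?A] u(2) \<P>(3) by blast
  have "(v, u') \<in> adj ^^ (j + 1)"
    using set_chain_imp_adj[OF \<P>(1) j(2) x(3) u(1) _ u'(1) refl] x(2) u(3) by blast
  moreover have "(u', w) \<in> adj" using u' y by (auto simp: adj_def)
  ultimately have "(v, w) \<in> adj ^^ (j + 2)" by auto
  moreover have "j + 2 \<le> m + 1" using j(1) d k(1) by simp
  ultimately show ?thesis by (rule relpow_adj_mono[OF _ x(3)])
qed

lemma Metric_space_leaf:
  assumes L: "L \<in> leaves n X \<F>"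
  shows "Metric_space L dist\<^sub>L"
proof
  show "0 \<le> dist\<^sub>L x y" for x y by (simp add: leaf_metric_linked)
  have "linked k x y \<longleftrightarrow> linked k y x" for k x y using linked_sym by blast
  then show "dist\<^sub>L x y = dist\<^sub>L y x" for x y by (auto simp: leaf_metric_linked)
  show "dist\<^sub>L x y = 0 \<longleftrightarrow> x = y" if "x \<in> L" "y \<in> L" for x y
  proof
    assume 0: "dist\<^sub>L x y = 0"
    show "x = y"
    proof (rule ccontr)
      assume ne: "x \<noteq> y"
      obtain k where "linked k x y" using leaf_linked[OF L \<open>x \<in> L\<close> \<open>y \<in> L\<close>] by auto
      then obtain m where "dist\<^sub>L x y = real m" "linked m x y" using leaf_metric_attained[OF ne] by blast
      then show False using linked_pos 0 by force
    qed
  qed (simp add: leaf_metric_linked)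
  show "dist\<^sub>L x z \<le> dist\<^sub>L x y + dist\<^sub>L y z" if "x \<in> L" "y \<in> L" "z \<in> L" for x y z
  proof (cases "x = y \<or> y = z")
    case True
    then show ?thesis by (auto simp: leaf_metric_linked)
  next
    case False
    have "\<exists>k. linked k x y" "\<exists>k. linked k y z" using leaf_linked[OF L] that by auto
    then obtain j k where "linked j x y" "linked k y z" by blast
    then obtain j k where jk: "dist\<^sub>L x y = real j" "linked j x y" "dist\<^sub>L y z = real k" "linked k y z"
      using leaf_metric_attained False by metis
    then obtain m where "m \<le> j + k" "linked m x z" using linked_trans by blast
    then show ?thesis using leaf_metric_le[of m x z] jk by linarith
  qed
qed

end

section \<open>Holonomy patterns\<close>

context regular_foliated_space
begin

text \<open>Local finiteness and compactness only count charts with nonempty domain; a regular atlas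
  may contain infinitely many charts with empty domain.\<close>

lemma finite_proper_charts: "finite {c \<in> \<U>. chart_dom c \<noteq> {}}"
proof -
  define N where "N V \<longleftrightarrow> openin X V \<and> finite {c \<in> \<U>. chart_dom c \<inter> V \<noteq> {}}" for V
  have "\<exists>V. N V \<and> x \<in> V" if "x \<in> topspace X" for x
    using regular that unfolding regular_foliated_atlas_def N_def by blast
  then have "topspace X \<subseteq> \<Union>(Collect N)" by blast
  moreover have "compactin X (topspace X)"
    using space by (simp add: compact_Polish_foliated_space_def compact_space_def)
  moreover have "\<forall>V\<in>Collect N. openin X V" by (simp add: N_def)
  ultimately obtain \<V> where \<V>: "finite \<V>" "\<V> \<subseteq> Collect N" "topspace X \<subseteq> \<Union>\<V>"
    unfolding compactin_def by meson
  have "{c \<in> \<U>. chart_dom c \<noteq> {}} \<subseteq> (\<Union>V\<in>\<V>. {c \<in> \<U>. chart_dom c \<inter> V \<noteq> {}})"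
  proof
    fix c assume c: "c \<in> {c \<in> \<U>. chart_dom c \<noteq> {}}"
    then obtain q where q: "q \<in> chart_dom c" by auto
    moreover have "q \<in> topspace X" using chart_dom_subset[OF chart_U, of c] c q by auto
    ultimately obtain V where "V \<in> \<V>" "q \<in> chart_dom c \<inter> V" using \<V>(3) by auto
    then show "c \<in> (\<Union>V\<in>\<V>. {c \<in> \<U>. chart_dom c \<inter> V \<noteq> {}})"
      using c by blast
  qed
  moreover have "finite (\<Union>V\<in>\<V>. {c \<in> \<U>. chart_dom c \<inter> V \<noteq> {}})"
    using \<V>(1,2) by (intro finite_UN_I) (auto simp: N_def)
  ultimately show ?thesis by (rule finite_subset)
qed

text \<open>Holonomy along the charts \<open>c # as\<close>. The empty word yields the identity of
  the whole transversal, whatever \<open>c\<close> is; this is why \<open>hol_append\<close>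
  prescribes the chart of the starting vertex.\<close>

primrec hol :: "('x, 'z) foliated_chart \<Rightarrow> ('x, 'z) foliated_chart list \<Rightarrow>
    ((('x, 'z) foliated_chart \<times> 'z) \<times> (('x, 'z) foliated_chart \<times> 'z)) set" where
  "hol c [] = Id_on (topspace (transversal_space \<U>))"
| "hol c (a # as) = elementary_holonomy c a O hol a as"

lemma topspace_transversal: "topspace (transversal_space \<U>) = verts"
  by (simp add: transversal_space_def verts_def comp_def)

lemma elementary_holonomy_iff:
  assumes "c \<in> \<U>" "a \<in> \<U>"
  shows "(v, w) \<in> elementary_holonomy c a \<longleftrightarrow> fst v = c \<and> fst w = a \<and> (v, w) \<in> adj"
proof
  assume "(v, w) \<in> elementary_holonomy c a"
  then obtain q where q: "q \<in> chart_dom c" "q \<in> chart_dom a" "v = (c, chart_proj c q)" "w = (a, chart_proj a q)"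
    by (auto simp: elementary_holonomy_def)
  then show "fst v = c \<and> fst w = a \<and> (v, w) \<in> adj"
    using adjI[OF vert_of_point(1)[OF assms(1)] vert_of_point(1)[OF assms(2)]
        vert_of_point(2)[OF assms(1)] vert_of_point(2)[OF assms(2)]] by simp
next
  assume *: "fst v = c \<and> fst w = a \<and> (v, w) \<in> adj"
  then obtain q where q: "q \<in> plaque v" "q \<in> plaque w" by (auto simp: adj_def)
  then have "v = (c, chart_proj c q)" "w = (a, chart_proj a q)" "q \<in> chart_dom c \<inter> chart_dom a"
    using * by (auto simp: plaque_def prod_eq_iff)
  then show "(v, w) \<in> elementary_holonomy c a" by (auto simp: elementary_holonomy_def)
qed

lemma hol_in_pseudogroup:
  "c \<in> \<U> \<Longrightarrow> set as \<subseteq> \<U> \<Longrightarrow> hol c as \<in> holonomy_pseudogroup \<U>"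
proof (induction as arbitrary: c)
  case Nil
  show ?case by (simp add: holonomy_pseudogroup_def generated_pseudogroup.identity)
next
  case (Cons a as)
  have "elementary_holonomy c a \<in> holonomy_pseudogroup \<U>"
    unfolding holonomy_pseudogroup_def using Cons.prems by (intro generated_pseudogroup.generator) auto
  then show ?case
    using Cons unfolding holonomy_pseudogroup_def by (auto intro: generated_pseudogroup.composition)
qed

lemma hol_functional:
  "c \<in> \<U> \<Longrightarrow> set as \<subseteq> \<U> \<Longrightarrow> (v, w) \<in> hol c as \<Longrightarrow> (v, w') \<in> hol c as \<Longrightarrow> w = w'"
proof (induction as arbitrary: c v)
  case (Cons a as)
  obtain u where u: "(v, u) \<in> elementary_holonomy c a" "(u, w) \<in> hol a as" using Cons.prems by auto
  obtain u' where u': "(v, u') \<in> elementary_holonomy c a" "(u', w') \<in> hol a as" using Cons.prems by auto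
  have "c \<in> \<U>" "a \<in> \<U>" using Cons.prems by auto
  then have "fst u = a" "fst u' = a" "(v, u) \<in> adj" "(v, u') \<in> adj"
    using u u' elementary_holonomy_iff by auto
  then have "u = u'" using adj_functional by (metis prod.collapse)
  then show ?case using Cons.IH[of a u] u u' Cons.prems by auto
qed auto

lemma hol_imp_adj:
  "c \<in> \<U> \<Longrightarrow> set as \<subseteq> \<U> \<Longrightarrow> (v, w) \<in> hol c as \<Longrightarrow> (v, w) \<in> adj ^^ length as"
proof (induction as arbitrary: c v)
  case (Cons a as)
  obtain u where u: "(v, u) \<in> elementary_holonomy c a" "(u, w) \<in> hol a as" using Cons.prems by auto
  have "(v, u) \<in> adj" using u(1) Cons.prems elementary_holonomy_iff[of c a v u] by simp
  moreover have "(u, w) \<in> adj ^^ length as" using Cons.IH[OF _ _ u(2)] Cons.prems by simp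
  ultimately show ?case unfolding list.size(4) Suc_eq_plus1[symmetric] add_Suc_right add_0_right
    by (rule relpow_Suc_I2)
qed auto

definition words :: "nat \<Rightarrow> ('x, 'z) foliated_chart list set" where
  "words r = {as. set as \<subseteq> {c \<in> \<U>. chart_dom c \<noteq> {}} \<and> length as \<le> r}"

lemma finite_words: "finite (words r)"
  unfolding words_def by (rule finite_lists_length_le[OF finite_proper_charts])

lemma words_subset: "as \<in> words r \<Longrightarrow> set as \<subseteq> \<U>"
  by (auto simp: words_def)

lemma adj_imp_hol:
  assumes "(v, w) \<in> adj ^^ k" "v \<in> verts"
  shows "\<exists>as\<in>words k. (v, w) \<in> hol (fst v) as"
  using assms
proof (induction k arbitrary: v)
  case 0
  then show ?case by (auto simp: words_def topspace_transversal)
next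
  case (Suc k)
  obtain u where u: "(v, u) \<in> adj" "(u, w) \<in> adj ^^ k" using relpow_Suc_D2[OF Suc.prems(1)] by auto
  then have uv: "u \<in> verts" by (auto simp: adj_def)
  from Suc.IH[OF u(2) uv] obtain as where as: "as \<in> words k" "(u, w) \<in> hol (fst u) as" by auto
  have fU: "fst v \<in> \<U>" "fst u \<in> \<U>" using Suc.prems(2) uv by (auto simp: verts_def)
  then have "(v, u) \<in> elementary_holonomy (fst v) (fst u)" using u(1) elementary_holonomy_iff by blast
  moreover have "chart_dom (fst u) \<noteq> {}" using plaque_nonempty[OF uv] by (auto simp: plaque_def)
  ultimately have "(v, w) \<in> hol (fst v) (fst u # as)" "fst u # as \<in> words (Suc k)"
    using as fU by (auto simp: words_def)
  then show ?case by blast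
qed

lemma hol_append:
  assumes "c \<in> \<U>" "set as \<subseteq> \<U>" "fst v = c"
  shows "(v, u) \<in> hol c (as @ bs) \<longleftrightarrow> (\<exists>w. (v, w) \<in> hol c as \<and> (w, u) \<in> hol (fst w) bs)"
  using assms
proof (induction as arbitrary: c v)
  case Nil
  have "v \<in> verts" if "(v, u) \<in> hol c bs"
  proof (cases bs)
    case Nil
    then show ?thesis using that by (auto simp: topspace_transversal Id_on_iff)
  next
    case (Cons b bs')
    then show ?thesis using that by (auto simp: elementary_holonomy_def vert_of_point Nil.prems)
  qed
  then show ?case using Nil by (auto simp: topspace_transversal Id_on_iff)
next
  case (Cons a as)
  have "(w, u) \<in> hol a (as @ bs) \<longleftrightarrow> (\<exists>w'. (w, w') \<in> hol a as \<and> (w', u) \<in> hol (fst w') bs)"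
    if "(v, w) \<in> elementary_holonomy c a" for w
    using that Cons elementary_holonomy_iff[of c a v w] by auto
  then show ?case by auto blast+
qed

text \<open>The combinatorics of the plaques within \<open>r\<close> steps: which words of charts can be followed from \<open>v\<close>
  (the diagonal), and which of them end in the same plaque. Adjacency of two ends is read off words
  that are one letter longer.\<close>

definition pattern :: "nat \<Rightarrow> ('x, 'z) foliated_chart \<times> 'z \<Rightarrow>
    (('x, 'z) foliated_chart list \<times> ('x, 'z) foliated_chart list) set" where
  "pattern r v = {(as, bs) \<in> words r \<times> words r. \<exists>w. (v, w) \<in> hol (fst v) as \<and> (v, w) \<in> hol (fst v) bs}"

definition holonomy_free_verts :: "(('x, 'z) foliated_chart \<times> 'z) set" where
  "holonomy_free_verts = {v \<in> verts. \<exists>L\<in>leaves n X \<F>. without_holonomy \<U> L \<and> plaque v \<inter> L \<noteq> {}}"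

text \<open>Two words with the same end at a point without holonomy differ by a holonomy map whose germ
  is trivial, so they have the same end at all nearby points.\<close>

lemma pattern_lower_semicontinuous:
  assumes "v \<in> holonomy_free_verts"
  obtains W where "openin (transversal_space \<U>) W" "v \<in> W"
    "\<And>v'. v' \<in> W \<Longrightarrow> fst v' = fst v \<Longrightarrow> pattern r v \<subseteq> pattern r v'"
proof -
  let ?T = "transversal_space \<U>"
  obtain L q where v: "v \<in> verts" and L: "without_holonomy \<U> L" and q: "q \<in> plaque v" "q \<in> L"
    using assms by (auto simp: holonomy_free_verts_def)
  have c: "fst v \<in> \<U>" using v by (auto simp: verts_def)
  have "q \<in> chart_dom (fst v)" "(fst v, chart_proj (fst v) q) = v"
    using q by (auto simp: plaque_def prod_eq_iff)
  then have germs: "holonomy_germs \<U> v = {germ_at ?T v (Id_on (topspace ?T))}"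
    using L q(2) c unfolding without_holonomy_def by metis
  have "\<exists>W. openin ?T W \<and> v \<in> W \<and> (\<forall>v'\<in>W. fst v' = fst v \<longrightarrow> p \<in> pattern r v')" if p: "p \<in> pattern r v" for p
  proof -
    obtain as bs w where asbs: "p = (as, bs)" "as \<in> words r" "bs \<in> words r"
      "(v, w) \<in> hol (fst v) as" "(v, w) \<in> hol (fst v) bs"
      using p by (auto simp: pattern_def)
    let ?g = "hol (fst v) as O (hol (fst v) bs)\<inverse>"
    have "?g \<in> holonomy_pseudogroup \<U>"
      using hol_in_pseudogroup[OF c] words_subset asbs(2,3) unfolding holonomy_pseudogroup_def
      by (intro generated_pseudogroup.composition generated_pseudogroup.inversion) auto
    moreover have "(v, v) \<in> ?g" using asbs by auto
    ultimately have "germ_at ?T v ?g \<in> holonomy_germs \<U> v" by (auto simp: holonomy_germs_def)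
    then have "germ_at ?T v ?g = germ_at ?T v (Id_on (topspace ?T))" using germs by simp
    moreover have "Id_on (topspace ?T) \<in> germ_at ?T v (Id_on (topspace ?T))"
    proof -
      have "partial_homeo ?T (Id_on (topspace ?T))"
        unfolding partial_homeo_def Domain_Id_on Range_Id_on
        by (intro conjI openin_topspace exI[of _ id]) (auto simp: homeomorphic_map_id)
      then show ?thesis
        using v by (auto simp: germ_at_def topspace_transversal intro!: exI[of _ verts] openin_topspace[of ?T, unfolded topspace_transversal])
    qed
    ultimately have "Id_on (topspace ?T) \<in> germ_at ?T v ?g" by simp
    then obtain W where W: "openin ?T W" "v \<in> W" "Id_on (topspace ?T) \<inter> W \<times> UNIV = ?g \<inter> W \<times> UNIV"
      by (auto simp: germ_at_def)
    have "p \<in> pattern r v'" if v': "v' \<in> W" "fst v' = fst v" for v'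
    proof -
      have "(v', v') \<in> Id_on (topspace ?T) \<inter> W \<times> UNIV" using v' openin_subset[OF W(1)] by auto
      then have "(v', v') \<in> ?g" using W(3) by blast
      then show ?thesis using asbs v' by (auto simp: pattern_def)
    qed
    then show ?thesis using W by blast
  qed
  then obtain W where W: "\<And>p. p \<in> pattern r v \<Longrightarrow> openin ?T (W p) \<and> v \<in> W p \<and>
      (\<forall>v'\<in>W p. fst v' = fst v \<longrightarrow> p \<in> pattern r v')" by metis
  have fin: "finite (pattern r v)"
    unfolding pattern_def by (rule finite_subset[of _ "words r \<times> words r"]) (auto simp: finite_words)
  have "openin ?T (topspace ?T \<inter> \<Inter> (W ` pattern r v))"
  proof (cases "pattern r v = {}")
    case False
    then show ?thesis using W fin by (intro openin_Int openin_topspace openin_Inter) auto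
  qed simp
  then show ?thesis
    by (rule that) (use W v in \<open>auto simp: topspace_transversal\<close>)
qed

text \<open>At a holonomy-free point where the pattern is largest, it is locally constant along the
  holonomy-free points.\<close>

lemma constant_pattern_open:
  assumes "holonomy_free_verts \<noteq> {}"
  obtains c P U where "c \<in> \<U>" "openin X U" "U \<noteq> {}" "U \<subseteq> chart_dom c"
    "\<And>x L. x \<in> U \<Longrightarrow> x \<in> L \<Longrightarrow> L \<in> leaves n X \<F> \<Longrightarrow> without_holonomy \<U> L \<Longrightarrow>
      pattern r (c, chart_proj c x) = P"
proof -
  let ?T = "transversal_space \<U>"
  have fin: "finite (pattern r v)" and card: "card (pattern r v) \<le> card (words r \<times> words r)" for v
  proof -
    have "pattern r v \<subseteq> words r \<times> words r" by (auto simp: pattern_def)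
    moreover have "finite (words r \<times> words r)" using finite_words by simp
    ultimately show "finite (pattern r v)" "card (pattern r v) \<le> card (words r \<times> words r)"
      by (rule finite_subset card_mono[rotated])+
  qed
  obtain v0 where "v0 \<in> holonomy_free_verts" using assms by auto
  then obtain v where v: "v \<in> holonomy_free_verts"
    "\<And>v'. v' \<in> holonomy_free_verts \<Longrightarrow> card (pattern r v') \<le> card (pattern r v)"
    using ex_has_greatest_nat[of "\<lambda>v. v \<in> holonomy_free_verts" v0 "\<lambda>v. card (pattern r v)"] card
    by (metis le_imp_less_Suc)
  obtain W where W: "openin ?T W" "v \<in> W"
    "\<And>v'. v' \<in> W \<Longrightarrow> fst v' = fst v \<Longrightarrow> pattern r v \<subseteq> pattern r v'"
    using pattern_lower_semicontinuous[OF v(1)] by blast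
  define c where "c = fst v"
  have vv: "v \<in> verts" using v(1) by (simp add: holonomy_free_verts_def)
  then have c: "c \<in> \<U>" by (auto simp: c_def verts_def)
  define U where "U = {q \<in> chart_dom c. chart_proj c q \<in> {z. (c, z) \<in> W}}"
  have "openin (chart_trans c) {z. (c, z) \<in> W}"
    using W(1) c by (auto simp: transversal_space_def openin_sum_topology)
  then have "openin X U" unfolding U_def by (rule chart_proj_preimage_open[OF chart_U[OF c]])
  moreover have "U \<noteq> {}"
  proof -
    obtain q where "q \<in> plaque v" using plaque_nonempty[OF vv] by auto
    then have "q \<in> U" using W(2) by (auto simp: U_def plaque_def c_def)
    then show ?thesis by auto
  qed
  moreover have "pattern r (c, chart_proj c x) = pattern r v"
    if x: "x \<in> U" "x \<in> L" "L \<in> leaves n X \<F>" "without_holonomy \<U> L" for x L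
  proof -
    have "(c, chart_proj c x) \<in> W" using x(1) by (simp add: U_def)
    then have sub: "pattern r v \<subseteq> pattern r (c, chart_proj c x)" using W(3) by (simp add: c_def)
    have "x \<in> plaque (c, chart_proj c x)" "(c, chart_proj c x) \<in> verts"
      using x(1) vert_of_point[OF c] by (auto simp: U_def)
    then have "(c, chart_proj c x) \<in> holonomy_free_verts"
      using x unfolding holonomy_free_verts_def by blast
    from v(2)[OF this] show ?thesis using card_seteq[OF fin sub] by simp
  qed
  moreover have "U \<subseteq> chart_dom c" by (auto simp: U_def)
  ultimately show ?thesis using that[OF c] by blast
qed

section \<open>Uniform density of the leaves in an open set\<close>

definition saturate :: "'x set \<Rightarrow> 'x set" where
  "saturate U = (\<Union>v\<in>{v \<in> verts. plaque v \<inter> U \<noteq> {}}. plaque v)"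

text \<open>Within one chart the saturation is the preimage of a projected open set, and the
  projection is open and continuous. Openness in \<open>X\<close> is what gives compactness access
  to distances along leaves.\<close>

lemma openin_saturate:
  assumes "openin X U"
  shows "openin X (saturate U)"
proof -
  have "saturate U = (\<Union>c\<in>\<U>. {q \<in> chart_dom c. chart_proj c q \<in> chart_proj c ` (chart_dom c \<inter> U)})"
  proof (intro equalityI subsetI)
    fix x assume "x \<in> saturate U"
    then obtain v q where "v \<in> verts" "q \<in> plaque v" "q \<in> U" "x \<in> plaque v" by (auto simp: saturate_def)
    then show "x \<in> (\<Union>c\<in>\<U>. {q \<in> chart_dom c. chart_proj c q \<in> chart_proj c ` (chart_dom c \<inter> U)})"
      by (auto simp: plaque_def verts_def intro!: bexI[of _ "fst v"] image_eqI[of _ _ q])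
  next
    fix x assume "x \<in> (\<Union>c\<in>\<U>. {q \<in> chart_dom c. chart_proj c q \<in> chart_proj c ` (chart_dom c \<inter> U)})"
    then obtain c q where c: "c \<in> \<U>" "x \<in> chart_dom c" "q \<in> chart_dom c" "q \<in> U" "chart_proj c x = chart_proj c q"
      by auto
    then have "(c, chart_proj c q) \<in> verts" "q \<in> plaque (c, chart_proj c q)" "x \<in> plaque (c, chart_proj c q)"
      using vert_of_point[of c q] by (auto simp: plaque_def)
    then show "x \<in> saturate U" using c by (auto simp: saturate_def)
  qed
  also have "openin X \<dots>"
    using chart_U assms by (intro openin_Union) (auto intro!: chart_proj_preimage_open chart_proj_open)
  finally show ?thesis .
qed

text \<open>Since every leaf meets \<open>U\<close>, the iterated saturations of \<open>U\<close>
  cover the space. They are open and increasing, so one of them is everything, and its number of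
  iterations bounds the distance.\<close>

lemma uniformly_dense:
  assumes min: "minimal_foliation n X \<F>" and U: "openin X U" "U \<noteq> {}"
  shows "\<exists>m::nat. \<forall>L\<in>leaves n X \<F>. \<forall>y\<in>L. \<exists>x\<in>L \<inter> U. dist\<^sub>L y x \<le> real m"
proof -
  define S where "S m = (saturate ^^ m) U" for m
  have open_S: "openin X (S m)" for m
    by (induction m) (simp_all add: S_def U openin_saturate)
  have near: "\<exists>x\<in>L \<inter> U. dist\<^sub>L y x \<le> real m" if "L \<in> leaves n X \<F>" "y \<in> S m" "y \<in> L" for L y m
    using that(2,3)
  proof (induction m arbitrary: y)
    case 0
    then show ?case by (auto simp: S_def leaf_metric_def)
  next
    case (Suc m)
    interpret Metric_space L "dist\<^sub>L" using Metric_space_leaf[OF that(1)] .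
    obtain v q where v: "v \<in> verts" "q \<in> plaque v" "q \<in> S m" "y \<in> plaque v"
      using Suc.prems by (auto simp: S_def saturate_def)
    then have "q \<in> L" using plaque_subset_leaf[OF that(1) v(1)] Suc.prems by blast
    then obtain x where x: "x \<in> L \<inter> U" "dist\<^sub>L q x \<le> real m" using Suc.IH v by blast
    have "dist\<^sub>L y q \<le> real 0 + 1" using v by (intro leaf_metric_chain_le[of v y q v 0]) auto
    then have "dist\<^sub>L y x \<le> real (Suc m)"
      using triangle[of y q x] x \<open>q \<in> L\<close> Suc.prems by auto
    then show ?case using x by blast
  qed
  have mono_step: "S m \<subseteq> S (Suc m)" for m
  proof
    fix x assume x: "x \<in> S m"
    then have "x \<in> topspace X" using openin_subset[OF open_S] by auto
    then obtain v where "v \<in> verts" "x \<in> plaque v" by (rule obtain_vert)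
    then show "x \<in> S (Suc m)" using x unfolding S_def saturate_def funpow.simps comp_apply by blast
  qed
  have mono: "S i \<subseteq> S j" if "i \<le> j" for i j
    using that mono_step by (rule lift_Suc_mono_le[rotated])
  have plaque_S: "plaque v \<subseteq> S (k + 1)"
    if "(v, w) \<in> adj ^^ k" "v \<in> verts" "x \<in> plaque w" "x \<in> U" for v w x k
    using that(1,2)
  proof (induction k arbitrary: v)
    case 0
    then show ?case using that(3,4) by (auto simp: S_def saturate_def)
  next
    case (Suc k)
    obtain u where u: "(v, u) \<in> adj" "(u, w) \<in> adj ^^ k" using relpow_Suc_D2[OF Suc.prems(1)] by auto
    then have "plaque u \<subseteq> S (k + 1)" using Suc.IH by (auto simp: adj_def)
    then have "plaque v \<inter> S (k + 1) \<noteq> {}" using u(1) by (auto simp: adj_def)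
    then have "plaque v \<subseteq> saturate (S (k + 1))" using Suc.prems(2) unfolding saturate_def by blast
    then show ?case by (simp add: S_def)
  qed
  have "topspace X \<subseteq> (\<Union>m. S m)"
  proof
    fix y assume y: "y \<in> topspace X"
    obtain L where L: "L \<in> leaves n X \<F>" "y \<in> L" using obtain_leaf[OF y] .
    have "L \<inter> U \<noteq> {}"
    proof -
      have "X closure_of L = topspace X" using min L(1) by (simp add: minimal_foliation_def)
      then show ?thesis
        using U openin_subset[OF U(1)] by (metis Int_commute in_closure_of all_not_in_conv disjoint_iff subsetD)
    qed
    then obtain x where x: "x \<in> L" "x \<in> U" by auto
    obtain v where v: "v \<in> verts" "y \<in> plaque v" using obtain_vert[OF y] .
    have "x \<in> topspace X" using leaf_subset[OF L(1)] x by auto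
    then obtain w where w: "w \<in> verts" "x \<in> plaque w" by (rule obtain_vert)
    obtain k where "(v, w) \<in> adj ^^ k" using leaf_chain[OF L(1) L(2) v(2,1) x(1) w(2,1)] by auto
    then have "plaque v \<subseteq> S (k + 1)" using plaque_S v(1) w(2) x(2) by blast
    then show "y \<in> (\<Union>m. S m)" using v by blast
  qed
  moreover have "compactin X (topspace X)"
    using space by (simp add: compact_Polish_foliated_space_def compact_space_def)
  ultimately obtain \<V> where \<V>: "finite \<V>" "\<V> \<subseteq> range S" "topspace X \<subseteq> \<Union>\<V>"
    using open_S unfolding compactin_def by (metis (no_types, lifting) imageE)
  then obtain I where I: "finite I" "\<V> = S ` I" by (meson finite_subset_image)
  \<comment> \<open>Inserting \<open>0\<close> keeps the maximum meaningful for an empty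
    \<open>I\<close>.\<close>
  have "topspace X \<subseteq> S (Max (insert 0 I))"
  proof
    fix y assume "y \<in> topspace X"
    then obtain i where i: "i \<in> I" "y \<in> S i" using \<V>(3) I by auto
    then have "i \<le> Max (insert 0 I)" using I(1) by simp
    then show "y \<in> S (Max (insert 0 I))" using mono i(2) by blast
  qed
  then show ?thesis using near leaf_subset by blast
qed

section \<open>Correspondences between balls of two leaves\<close>

definition ball_corr :: "nat \<Rightarrow> ('x, 'z) foliated_chart \<times> 'z \<Rightarrow> ('x, 'z) foliated_chart \<times> 'z \<Rightarrow> ('x \<times> 'x) set" where
  "ball_corr k v v' = {(a, a'). \<exists>as\<in>words k. \<exists>w w'. (v, w) \<in> hol (fst v) as \<and> (v', w') \<in> hol (fst v') as \<and>
     a \<in> plaque w \<and> a' \<in> plaque w'}"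

lemma ball_corr_converse: "(ball_corr k v v')\<inverse> = ball_corr k v' v"
  unfolding ball_corr_def by (rule set_eqI) blast

context
  fixes v v' :: "('x, 'z) foliated_chart \<times> 'z" and k :: nat and L L' :: "'x set"
  assumes v: "v \<in> verts" "v' \<in> verts" "fst v' = fst v"
    and pat: "pattern (4 * k + 8) v = pattern (4 * k + 8) v'"
    and L: "L \<in> leaves n X \<F>" "plaque v \<inter> L \<noteq> {}" and L': "L' \<in> leaves n X \<F>" "plaque v' \<inter> L' \<noteq> {}"
begin

lemma ball_corr_subset: "ball_corr (k + 1) v v' \<subseteq> L \<times> L'"
proof -
  have f: "fst v \<in> \<U>" "fst v' \<in> \<U>" using v by (auto simp: verts_def)
  show ?thesis
  proof (clarify)
    fix a a' assume "(a, a') \<in> ball_corr (k + 1) v v'"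
    then obtain as w w' where w: "as \<in> words (k + 1)" "(v, w) \<in> hol (fst v) as" "(v', w') \<in> hol (fst v') as"
      "a \<in> plaque w" "a' \<in> plaque w'" unfolding ball_corr_def by blast
    then have "(v, w) \<in> adj ^^ length as" "(v', w') \<in> adj ^^ length as"
      using hol_imp_adj f words_subset by blast+
    then show "a \<in> L \<and> a' \<in> L'"
      using relpow_adj_leaf[OF L(1) _ v(1) L(2)] relpow_adj_leaf[OF L'(1) _ v(2) L'(2)] w by blast
  qed
qed

text \<open>The diagonal of the pattern tells which words can be followed, so the word leading from
  \<open>v\<close> to a plaque of \<open>a\<close> can also be followed from \<open>v'\<close>. A
  distance of \<open>k\<close> requires words of length \<open>k + 1\<close>.\<close>

lemma ball_corr_total:
  assumes x: "x \<in> plaque v" "x \<in> L" and a: "a \<in> L" "dist\<^sub>L x a \<le> real k"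
  shows "\<exists>a'. (a, a') \<in> ball_corr (k + 1) v v'"
proof -
  have f: "fst v \<in> \<U>" using v by (auto simp: verts_def)
  have "a \<in> topspace X" using a leaf_subset[OF L(1)] by auto
  then obtain w where w: "w \<in> verts" "a \<in> plaque w" by (rule obtain_vert)
  have "(v, w) \<in> adj ^^ (k + 1)"
    using leaf_chain_of_metric[OF L(1) x(2,1) v(1) a(1) w(2,1) a(2)] .
  then obtain as where as: "as \<in> words (k + 1)" "(v, w) \<in> hol (fst v) as"
    using adj_imp_hol v(1) by blast
  moreover have "as \<in> words (4 * k + 8)" using as(1) by (auto simp: words_def)
  ultimately have "(as, as) \<in> pattern (4 * k + 8) v" unfolding pattern_def by blast
  then have "(as, as) \<in> pattern (4 * k + 8) v'" using pat by simp
  then obtain w' where w': "(v', w') \<in> hol (fst v') as" by (auto simp: pattern_def)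
  then have "(v', w') \<in> adj ^^ length as" using hol_imp_adj f v(3) words_subset[OF as(1)] by metis
  then have "plaque w' \<noteq> {}" using relpow_adj_verts v(2) plaque_nonempty by blast
  then show ?thesis using as w w' unfolding ball_corr_def by blast
qed

text \<open>A shortest route between the plaques of \<open>a\<close> and \<open>b\<close> is a word
  \<open>us\<close> for which \<open>as @ us\<close> and \<open>bs\<close> have the same end.
  Equality of patterns carries this over to \<open>v'\<close>, so \<open>us\<close> also joins the
  plaques of \<open>a'\<close> and \<open>b'\<close>.\<close>

lemma ball_corr_dist_le:
  assumes a: "(a, a') \<in> ball_corr (k + 1) v v'" and b: "(b, b') \<in> ball_corr (k + 1) v v'"
  shows "dist\<^sub>L a' b' \<le> dist\<^sub>L a b + 2"
proof -
  have f: "fst v \<in> \<U>" using v by (auto simp: verts_def)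
  obtain as w w' where w: "as \<in> words (k + 1)" "(v, w) \<in> hol (fst v) as" "(v', w') \<in> hol (fst v) as"
    "a \<in> plaque w" "a' \<in> plaque w'" using a v(3) unfolding ball_corr_def by auto
  obtain bs y y' where y: "bs \<in> words (k + 1)" "(v, y) \<in> hol (fst v) bs" "(v', y') \<in> hol (fst v) bs"
    "b \<in> plaque y" "b' \<in> plaque y'" using b v(3) unfolding ball_corr_def by auto
  have U: "set as \<subseteq> \<U>" "set bs \<subseteq> \<U>" using words_subset w(1) y(1) by auto
  have vw: "(v, w) \<in> adj ^^ length as" "(v, y) \<in> adj ^^ length bs" "(v', w') \<in> adj ^^ length as"
    using hol_imp_adj f U w y by blast+
  then have verts: "w \<in> verts" "y \<in> verts" "w' \<in> verts" using relpow_adj_verts v by blast+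
  have ab: "a \<in> L" "b \<in> L" using ball_corr_subset a b by auto
  obtain m where m: "dist\<^sub>L a b = real m" using leaf_metric_nat .
  have "(w, y) \<in> adj ^^ (length as + length bs)"
    using relpow_adj_sym[OF vw(1)] vw(2) by (auto simp: relpow_add)
  then have "dist\<^sub>L a b \<le> real (length as + length bs) + 1"
    by (rule leaf_metric_chain_le[OF verts(1) w(4) y(4)])
  \<comment> \<open>Hence \<open>us\<close> has length at most \<open>2 * k + 4\<close> and
    \<open>as @ us\<close> at most \<open>3 * k + 5\<close>, within the range
    \<open>4 * k + 8\<close> of the pattern.\<close>
  then have "m \<le> 2 * k + 3" using m w(1) y(1) by (simp add: words_def)
  have "(w, y) \<in> adj ^^ (m + 1)"
    by (rule leaf_chain_of_metric[OF L(1) ab(1) w(4) verts(1) ab(2) y(4) verts(2)]) (simp add: m)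
  then obtain us where us: "us \<in> words (m + 1)" "(w, y) \<in> hol (fst w) us"
    using adj_imp_hol verts(1) by blast
  have "(v, y) \<in> hol (fst v) (as @ us)" using hol_append[OF f U(1) refl] w(2) us(2) by blast
  moreover have "as @ us \<in> words (4 * k + 8)" "bs \<in> words (4 * k + 8)"
    using y(1) w(1) us(1) \<open>m \<le> 2 * k + 3\<close> by (auto simp: words_def)
  ultimately have "(as @ us, bs) \<in> pattern (4 * k + 8) v"
    using y(2) unfolding pattern_def by blast
  then have "(as @ us, bs) \<in> pattern (4 * k + 8) v'" using pat by simp
  then obtain t where t: "(v', t) \<in> hol (fst v) (as @ us)" "(v', t) \<in> hol (fst v) bs"
    using v(3) by (auto simp: pattern_def)
  have "t = y'" using hol_functional[OF f U(2) t(2) y(3)] .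
  then obtain s where s: "(v', s) \<in> hol (fst v) as" "(s, y') \<in> hol (fst s) us"
    using t(1) hol_append[OF f U(1) v(3)] by blast
  have "s = w'" using hol_functional[OF f U(1) s(1) w(3)] .
  moreover have "fst w' \<in> \<U>" using verts by (auto simp: verts_def)
  ultimately have "(w', y') \<in> adj ^^ length us" using hol_imp_adj s(2) words_subset[OF us(1)] by blast
  then have "dist\<^sub>L a' b' \<le> real (length us) + 1"
    by (rule leaf_metric_chain_le[OF verts(3) w(5) y(5)])
  also have "\<dots> \<le> dist\<^sub>L a b + 2" using us(1) m by (simp add: words_def)
  finally show ?thesis .
qed

end

text \<open>\<open>P k\<close> is an open set on which the pattern of range \<open>4 * k + 8\<close>
  is constant along leaves without holonomy. It is chosen once for all leaves, so its points on
  different leaves can be compared.\<close>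

lemma leaves_share_balls:
  assumes min: "minimal_foliation n X \<F>" and free: "holonomy_free_verts \<noteq> {}"
  obtains P where
    "\<And>k. \<exists>R. \<forall>L\<in>leaves n X \<F>. \<forall>y\<in>L. \<exists>x\<in>P k. x \<in> L \<and> dist\<^sub>L y x \<le> R"
    "\<And>k x x' L L'. L \<in> leaves n X \<F> \<Longrightarrow> L' \<in> leaves n X \<F> \<Longrightarrow> without_holonomy \<U> L \<Longrightarrow>
      without_holonomy \<U> L' \<Longrightarrow> x \<in> L \<Longrightarrow> x' \<in> L' \<Longrightarrow> x \<in> P k \<Longrightarrow> x' \<in> P k \<Longrightarrow>
      \<exists>\<R>\<subseteq>L \<times> L'. (x, x') \<in> \<R> \<and>
        (\<forall>a\<in>L. dist\<^sub>L x a < real k \<longrightarrow> (\<exists>a'. (a, a') \<in> \<R>)) \<and>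
        (\<forall>a'\<in>L'. dist\<^sub>L x' a' < real k \<longrightarrow> (\<exists>a. (a, a') \<in> \<R>)) \<and>
        (\<forall>a a' b b'. (a, a') \<in> \<R> \<longrightarrow> (b, b') \<in> \<R> \<longrightarrow> \<bar>dist\<^sub>L a b - dist\<^sub>L a' b'\<bar> \<le> 2)"
proof -
  have "\<exists>U c P. c \<in> \<U> \<and> openin X U \<and> U \<noteq> {} \<and> U \<subseteq> chart_dom c \<and>
     (\<forall>x L. x \<in> U \<longrightarrow> x \<in> L \<longrightarrow> L \<in> leaves n X \<F> \<longrightarrow> without_holonomy \<U> L \<longrightarrow>
      pattern (4 * k + 8) (c, chart_proj c x) = P)" for k
    by (rule constant_pattern_open[OF free, of "4 * k + 8"]) blast
  then obtain U c P where U: "\<And>k. c k \<in> \<U>" "\<And>k. openin X (U k)" "\<And>k. U k \<noteq> {}" "\<And>k. U k \<subseteq> chart_dom (c k)"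
    "\<And>k x L. x \<in> U k \<Longrightarrow> x \<in> L \<Longrightarrow> L \<in> leaves n X \<F> \<Longrightarrow> without_holonomy \<U> L \<Longrightarrow>
      pattern (4 * k + 8) (c k, chart_proj (c k) x) = P k"
    by metis
  show ?thesis
  proof (rule that[of U])
    show "\<exists>R. \<forall>L\<in>leaves n X \<F>. \<forall>y\<in>L. \<exists>x\<in>U k. x \<in> L \<and> dist\<^sub>L y x \<le> R" for k
    proof -
      obtain m :: nat where "\<forall>L\<in>leaves n X \<F>. \<forall>y\<in>L. \<exists>x\<in>L \<inter> U k. dist\<^sub>L y x \<le> real m"
        using uniformly_dense[OF min U(2)[of k] U(3)[of k]] by blast
      then show ?thesis by (intro exI[of _ "real m"]) blast
    qed
    fix k x x' L L'
    assume L: "L \<in> leaves n X \<F>" "without_holonomy \<U> L" "x \<in> L" "x \<in> U k"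
      and L': "L' \<in> leaves n X \<F>" "without_holonomy \<U> L'" "x' \<in> L'" "x' \<in> U k"
    define v where "v = (c k, chart_proj (c k) x)"
    define v' where "v' = (c k, chart_proj (c k) x')"
    have v: "v \<in> verts" "x \<in> plaque v" "v' \<in> verts" "x' \<in> plaque v'"
      unfolding v_def v'_def
      by (intro vert_of_point U(1) subsetD[OF U(4)] L(4) L'(4))+
    have fst: "fst v' = fst v" "fst v = fst v'" by (simp_all add: v_def v'_def)
    have pat: "pattern (4 * k + 8) v = pattern (4 * k + 8) v'"
      using U(5)[OF L(4,3,1,2)] U(5)[OF L'(4,3,1,2)] by (simp add: v_def v'_def)
    have meet: "plaque v \<inter> L \<noteq> {}" "plaque v' \<inter> L' \<noteq> {}" using v L L' by auto
    note fwd = v(1,3) fst(1) pat L(1) meet(1) L'(1) meet(2)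
    note bwd = v(3,1) fst(2) pat[symmetric] L'(1) meet(2) L(1) meet(1)
    let ?R = "ball_corr (k + 1) v v'"
    show "\<exists>\<R>\<subseteq>L \<times> L'. (x, x') \<in> \<R> \<and>
        (\<forall>a\<in>L. dist\<^sub>L x a < real k \<longrightarrow> (\<exists>a'. (a, a') \<in> \<R>)) \<and>
        (\<forall>a'\<in>L'. dist\<^sub>L x' a' < real k \<longrightarrow> (\<exists>a. (a, a') \<in> \<R>)) \<and>
        (\<forall>a a' b b'. (a, a') \<in> \<R> \<longrightarrow> (b, b') \<in> \<R> \<longrightarrow> \<bar>dist\<^sub>L a b - dist\<^sub>L a' b'\<bar> \<le> 2)"
    proof (intro exI[of _ ?R] conjI ballI impI allI)
      show "?R \<subseteq> L \<times> L'" using ball_corr_subset[OF fwd] .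
      show "(x, x') \<in> ?R"
      proof -
        have "[] \<in> words (k + 1)" "(v, v) \<in> hol (fst v) []" "(v', v') \<in> hol (fst v') []"
          using v by (auto simp: words_def topspace_transversal)
        then show ?thesis using v unfolding ball_corr_def by blast
      qed
      show "\<exists>a'. (a, a') \<in> ?R" if "a \<in> L" "dist\<^sub>L x a < real k" for a
        using ball_corr_total[OF fwd v(2) L(3)] that by simp
      show "\<exists>a. (a, a') \<in> ?R" if "a' \<in> L'" "dist\<^sub>L x' a' < real k" for a'
        using ball_corr_total[OF bwd v(4) L'(3) that(1)] that(2) ball_corr_converse[of "k + 1" v v'] by auto
      show "\<bar>dist\<^sub>L a b - dist\<^sub>L a' b'\<bar> \<le> 2" if "(a, a') \<in> ?R" "(b, b') \<in> ?R" for a a' b b'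
      proof -
        have "(a', a) \<in> ball_corr (k + 1) v' v" "(b', b) \<in> ball_corr (k + 1) v' v"
          using that ball_corr_converse[of "k + 1" v v'] by auto
        then show ?thesis
          using ball_corr_dist_le[OF fwd that] ball_corr_dist_le[OF bwd] by force
      qed
    qed
  qed
qed

end

section \<open>Semi weak homogeneity\<close>

lemma openin_sum_topology_slice:
  assumes "i \<in> I" "openin (T i) U"
  shows "openin (sum_topology T I) ({i} \<times> U)"
  unfolding openin_sum_topology
proof (intro conjI ballI)
  show "{i} \<times> U \<subseteq> Sigma I (topspace \<circ> T)" using openin_subset[OF assms(2)] assms(1) by auto
  show "openin (T j) {x. (j, x) \<in> {i} \<times> U}" for j
    using assms(2) by (cases "j = i") auto
qed

lemma subtopology_sum_topology_slice:
  assumes "i \<in> I"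
  shows "subtopology (sum_topology T I) ({i} \<times> W) homeomorphic_space subtopology (T i) W"
proof -
  have "homeomorphic_maps (subtopology (sum_topology T I) ({i} \<times> W)) (subtopology (T i) W) snd (Pair i)"
    unfolding homeomorphic_maps_def
  proof (intro conjI ballI continuous_map_into_subtopology)
    show "continuous_map (subtopology (sum_topology T I) ({i} \<times> W)) (T i) snd"
      unfolding continuous_map_def
    proof (intro conjI allI impI)
      fix U assume U: "openin (T i) U"
      then have "openin (sum_topology T I) ({i} \<times> U)"
        by (rule openin_sum_topology_slice[OF assms])
      moreover have "{x \<in> topspace (subtopology (sum_topology T I) ({i} \<times> W)). snd x \<in> U} =
          {i} \<times> U \<inter> {i} \<times> W"
        using openin_subset[OF U] assms by auto
      ultimately show "openin (subtopology (sum_topology T I) ({i} \<times> W))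
          {x \<in> topspace (subtopology (sum_topology T I) ({i} \<times> W)). snd x \<in> U}"
        by (auto simp: openin_subtopology)
    qed auto
    show "continuous_map (subtopology (T i) W) (sum_topology T I) (Pair i)"
      using assms by (intro continuous_map_from_subtopology continuous_map_component_injection)
  qed auto
  then show ?thesis by (auto simp: homeomorphic_space_def)
qed

theorem theorem1p11:
  fixes n :: nat
    and X :: "'x topology"
    and \<F> \<U> :: "('x, 'z) foliated_chart set"
    and X\<^sub>0 :: "'x set"
  assumes "compact_Polish_foliated_space n X \<F>"
    and "regular_foliated_atlas n X \<F> \<U>"
    and "X\<^sub>0 = union_leaves_without_holonomy n X \<F> \<U>"
    and "minimal_foliation n X \<F>"
  shows "semi_weakly_homogeneous
    (sum_topology (\<lambda>L. higson_corona L (leaf_metric n X \<F> \<U>)) {L \<in> leaves n X \<F>. L \<subseteq> X\<^sub>0})"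
proof -
  interpret regular_foliated_space n X \<F> \<U> using assms(1,2) by unfold_locales
  let ?I = "{L \<in> leaves n X \<F>. L \<subseteq> X\<^sub>0}"
  let ?\<nu> = "\<lambda>L. higson_corona L dist\<^sub>L"
  \<comment> \<open>Leaves are nonempty and pairwise disjoint, so a leaf contained in the union is
    one of its members.\<close>
  have free: "without_holonomy \<U> L" if L: "L \<in> ?I" for L
  proof -
    obtain x where x: "x \<in> L"
      using L nonempty_connected_components_of unfolding leaves_def by blast
    then obtain L' where L': "L' \<in> leaves n X \<F>" "without_holonomy \<U> L'" "x \<in> L'"
      using L assms(3) unfolding union_leaves_without_holonomy_def by blast
    have "L = L'"
      using L L'(1,3) x pairwise_disjoint_connected_components_of[of leafT]
      unfolding leaves_def pairwise_def disjnt_def by blast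
    then show ?thesis using L' by simp
  qed
  show ?thesis
    unfolding semi_weakly_homogeneous_def
  proof (intro allI impI)
    fix V V'
    assume V: "openin (sum_topology ?\<nu> ?I) V \<and> V \<noteq> {} \<and> openin (sum_topology ?\<nu> ?I) V' \<and> V' \<noteq> {}"
    have slice: "\<exists>L\<in>?I. openin (?\<nu> L) {\<xi>. (L, \<xi>) \<in> W} \<and> {\<xi>. (L, \<xi>) \<in> W} \<noteq> {}"
      if W: "openin (sum_topology ?\<nu> ?I) W" "W \<noteq> {}" for W
    proof -
      obtain L \<xi> where "(L, \<xi>) \<in> W" using W(2) by auto
      moreover from this have "L \<in> ?I" using W(1) unfolding openin_sum_topology by blast
      moreover from this have "openin (?\<nu> L) {\<xi>. (L, \<xi>) \<in> W}"
        using W(1) unfolding openin_sum_topology by blast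
      ultimately show ?thesis by blast
    qed
    obtain L where L: "L \<in> ?I" "openin (?\<nu> L) {\<xi>. (L, \<xi>) \<in> V}" "{\<xi>. (L, \<xi>) \<in> V} \<noteq> {}"
      using slice V by meson
    obtain L' where L': "L' \<in> ?I" "openin (?\<nu> L') {\<xi>. (L', \<xi>) \<in> V'}" "{\<xi>. (L', \<xi>) \<in> V'} \<noteq> {}"
      using slice V by meson
    have leaf: "L \<in> leaves n X \<F>" "L' \<in> leaves n X \<F>" "without_holonomy \<U> L" "without_holonomy \<U> L'"
      using L(1) L'(1) free by auto
    \<comment> \<open>The nonempty \<open>V\<close> has already supplied a leaf without holonomy; if
      there were none, the disjoint union would be empty.\<close>
    have nonempty: "holonomy_free_verts \<noteq> {}"
    proof -
      obtain x where x: "x \<in> L"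
        using leaf(1) nonempty_connected_components_of unfolding leaves_def by blast
      then obtain v where "v \<in> verts" "x \<in> plaque v"
        using obtain_vert leaf_subset[OF leaf(1)] by blast
      then show ?thesis using leaf(1,3) x unfolding holonomy_free_verts_def by blast
    qed
    obtain P where P:
      "\<And>k. \<exists>R. \<forall>L\<in>leaves n X \<F>. \<forall>y\<in>L. \<exists>x\<in>P k. x \<in> L \<and> dist\<^sub>L y x \<le> R"
      "\<And>k x x' L L'. L \<in> leaves n X \<F> \<Longrightarrow> L' \<in> leaves n X \<F> \<Longrightarrow> without_holonomy \<U> L \<Longrightarrow>
        without_holonomy \<U> L' \<Longrightarrow> x \<in> L \<Longrightarrow> x' \<in> L' \<Longrightarrow> x \<in> P k \<Longrightarrow> x' \<in> P k \<Longrightarrow>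
        \<exists>\<R>\<subseteq>L \<times> L'. (x, x') \<in> \<R> \<and>
          (\<forall>a\<in>L. dist\<^sub>L x a < real k \<longrightarrow> (\<exists>a'. (a, a') \<in> \<R>)) \<and>
          (\<forall>a'\<in>L'. dist\<^sub>L x' a' < real k \<longrightarrow> (\<exists>a. (a, a') \<in> \<R>)) \<and>
          (\<forall>a a' b b'. (a, a') \<in> \<R> \<longrightarrow> (b, b') \<in> \<R> \<longrightarrow> \<bar>dist\<^sub>L a b - dist\<^sub>L a' b'\<bar> \<le> 2)"
      by (rule leaves_share_balls[OF assms(4) nonempty]) (rule that)
    have net: "\<exists>R. \<forall>y\<in>K. \<exists>x\<in>P k. x \<in> K \<and> dist\<^sub>L y x \<le> R" if "K \<in> leaves n X \<F>" for K k
      using P(1)[of k] that by blast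
    obtain \<Omega> \<Omega>' where \<Omega>: "openin (?\<nu> L) \<Omega>" "\<Omega> \<noteq> {}" "\<Omega> \<subseteq> {\<xi>. (L, \<xi>) \<in> V}"
      and \<Omega>': "openin (?\<nu> L') \<Omega>'" "\<Omega>' \<noteq> {}" "\<Omega>' \<subseteq> {\<xi>. (L', \<xi>) \<in> V'}"
      and homeo: "subtopology (?\<nu> L) \<Omega> homeomorphic_space subtopology (?\<nu> L') \<Omega>'"
    proof (rule higson_coronas_share_open_sets[where P = P and P' = P and C = 2,
          OF Metric_space_leaf[OF leaf(1)] Metric_space_leaf[OF leaf(2)] _ _ _ L(2,3) L'(2,3)])
    qed (rule net[OF leaf(1)] net[OF leaf(2)] P(2)[OF leaf] that; assumption)+
    have "subtopology (sum_topology ?\<nu> ?I) ({L} \<times> \<Omega>) homeomorphic_space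
        subtopology (sum_topology ?\<nu> ?I) ({L'} \<times> \<Omega>')"
      using subtopology_sum_topology_slice[OF L(1), of ?\<nu> \<Omega>] subtopology_sum_topology_slice[OF L'(1), of ?\<nu> \<Omega>'] homeo
      by (meson homeomorphic_space_sym homeomorphic_space_trans)
    then show "\<exists>\<Omega> \<Omega>'. openin (sum_topology ?\<nu> ?I) \<Omega> \<and> \<Omega> \<noteq> {} \<and> \<Omega> \<subseteq> V \<and>
        openin (sum_topology ?\<nu> ?I) \<Omega>' \<and> \<Omega>' \<noteq> {} \<and> \<Omega>' \<subseteq> V' \<and>
        subtopology (sum_topology ?\<nu> ?I) \<Omega> homeomorphic_space subtopology (sum_topology ?\<nu> ?I) \<Omega>'"
      using openin_sum_topology_slice[OF L(1), of ?\<nu>, OF \<Omega>(1)]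
        openin_sum_topology_slice[OF L'(1), of ?\<nu>, OF \<Omega>'(1)] \<Omega>(2,3) \<Omega>'(2,3)
      by (intro exI[of _ "{L} \<times> \<Omega>"] exI[of _ "{L'} \<times> \<Omega>'"]) auto
  qed
qed

end
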